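(* Let $0<\beta<1$ and $h=0$. Define $$H := \frac{1}{N}\sum_{1\le i<j\le N} g_{ij}\sigma_i\sigma_j - \frac{\sqrt N\beta}{2}.$$ Then there is a constant $C(\beta)$ depending only on $\beta$ such that for every $N$ and every bounded measurable $u:\mathbb{R}\to\mathbb{R}$, $$\mathbb{E}\Bigl(\langle u(H)\rangle - \int_{\mathbb{R}} u(t)\,\phi_{0,1/2}(t)\,dt\Bigr)^2 \le \frac{C(\beta)\|u\|_\infty^2}{N}.$$
   Context: Sherrington–Kirkpatrick model: for a positive integer $N$, let $\Sigma_N=\{-1,1\}^N$ and let $g=(g_{ij})_{1\le i<j\le N}$ be i.i.d. standard Gaussian random variables (the disorder). Given $g$, the Gibbs measure on $\Sigma_N$ is $G_N(\sigma)=Z_N^{-1}\exp\bigl(\frac{\beta}{\sqrt N}\sum_{1\le i<j\le N} g_{ij}\sigma_i\sigma_j + h\sum_{i=1}^N\sigma_i\bigr)$, with $Z_N$ the normalizing constant. $\langle\cdot\rangle$ denotes the quenched average over $\sigma\sim G_N$ with $g$ fixed, and $\mathbb{E}$ is expectation over the disorder. $\phi_{0,1/2}(t)=\frac{1}{\sqrt{\pi}}e^{-t^2}$ is the Gaussian density with mean $0$ and variance $1/2$. *)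

theory Defs
  imports "HOL-Probability.Probability"
begin

definition sk_pairs :: "nat \<Rightarrow> (nat \<times> nat) set" where
  "sk_pairs N = {(i, j). 1 \<le> i \<and> i < j \<and> j \<le> N}"

definition sk_disorder :: "nat \<Rightarrow> (nat \<times> nat \<Rightarrow> real) measure" where
  "sk_disorder N = PiM (sk_pairs N) (\<lambda>_. std_normal_distribution)"

definition sk_configs :: "nat \<Rightarrow> (nat \<Rightarrow> real) set" where
  "sk_configs N = PiE {1..N} (\<lambda>_. {-1, 1})"

definition sk_interaction :: "nat \<Rightarrow> (nat \<times> nat \<Rightarrow> real) \<Rightarrow> (nat \<Rightarrow> real) \<Rightarrow> real" where
  "sk_interaction N g \<sigma> = (\<Sum>(i, j)\<in>sk_pairs N. g (i, j) * \<sigma> i * \<sigma> j)"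

definition sk_weight :: "real \<Rightarrow> real \<Rightarrow> nat \<Rightarrow> (nat \<times> nat \<Rightarrow> real) \<Rightarrow> (nat \<Rightarrow> real) \<Rightarrow> real" where
  "sk_weight \<beta> h N g \<sigma> =
     exp (\<beta> / sqrt (real N) * sk_interaction N g \<sigma> + h * (\<Sum>i\<in>{1..N}. \<sigma> i))"

definition sk_Z :: "real \<Rightarrow> real \<Rightarrow> nat \<Rightarrow> (nat \<times> nat \<Rightarrow> real) \<Rightarrow> real" where
  "sk_Z \<beta> h N g = (\<Sum>\<sigma>\<in>sk_configs N. sk_weight \<beta> h N g \<sigma>)"

definition gibbs_avg :: "real \<Rightarrow> real \<Rightarrow> nat \<Rightarrow> (nat \<times> nat \<Rightarrow> real) \<Rightarrow> ((nat \<Rightarrow> real) \<Rightarrow> real) \<Rightarrow> real" where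
  "gibbs_avg \<beta> h N g f = (\<Sum>\<sigma>\<in>sk_configs N. f \<sigma> * sk_weight \<beta> h N g \<sigma>) / sk_Z \<beta> h N g"

definition sk_H :: "real \<Rightarrow> nat \<Rightarrow> (nat \<times> nat \<Rightarrow> real) \<Rightarrow> (nat \<Rightarrow> real) \<Rightarrow> real" where
  "sk_H \<beta> N g \<sigma> = sk_interaction N g \<sigma> / real N - sqrt (real N) * \<beta> / 2"

text \<open>Gaussian density with mean 0 and variance 1/2.\<close>
definition phi_half :: "real \<Rightarrow> real" where
  "phi_half t = exp (- t\<^sup>2) / sqrt pi"

end

theory Submission
  imports Defs
begin

text \<open>
  Write \<open>\<langle>\<cdot>\<rangle>\<close> for the Gibbs average, \<open>Q\<close> for \<open>N R\<^sup>2 - 1\<close> with \<open>R\<close> the overlap of two replicas, and \<open>v\<close> for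
  \<open>u - \<integral> u \<phi>\<close>.  Stein's equation \<open>f' - 2 t f = v\<close> for the normal law of variance \<open>1/2\<close> has a solution
  with \<open>f\<close> and \<open>f'\<close> of order \<open>\<parallel>u\<parallel>\<close>.  Gaussian integration by parts in the disorder turns
  \<open>E \<langle>(f'(H) - 2 H f(H)) \<psi>\<rangle>\<close> into terms carrying a factor \<open>1/N\<close> or \<open>\<beta>/\<surd>N\<close> together with a factor \<open>1\<close> or
  \<open>Q\<close>, plus a term with the derivative of \<open>\<psi>\<close>.  For \<open>\<psi> = \<langle>v(H)\<rangle>\<close> the left side is the quantity to be
  bounded, and the derivative term is handled by two more applications with
  \<open>\<psi>\<close> an average of \<open>f(H) Q\<close>.  Everything then follows from bounds on
  \<open>E \<langle>Q\<^sup>2\<rangle>\<close> and \<open>E \<langle>H\<^sup>2\<rangle>\<close> that are uniform in \<open>N\<close>.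

  These come from a bound on the second moment of the negative part of \<open>L = ln (Z / E Z)\<close>.  By
  integration by parts, its derivative in \<open>\<beta>\<close> is controlled by \<open>E (1 + L\<^sub>-) \<langle>Q\<rangle>\<close>.  By Jensen
  \<open>\<epsilon> \<langle>Q\<rangle> \<le> ln \<langle>exp (\<epsilon> Q)\<rangle>\<close>, where \<open>\<langle>exp (\<epsilon> Q)\<rangle>\<close> is \<open>(E Z / Z)\<^sup>2\<close> times a quantity whose
  expectation is bounded because \<open>\<beta> < 1\<close>.  So the derivative is at most affine in the moment
  itself, and Gronwall's argument, started at \<open>\<beta> = 0\<close> where \<open>L = 0\<close>, closes.
\<close>

section \<open>Standard Gaussian measure\<close>

text \<open>The bound may involve \<open>u\<close> only through its supremum norm, but integration
  by parts differentiates \<open>\<langle>v(H)\<rangle>\<close> and so produces \<open>v'\<close>.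
  One of the two further applications therefore takes \<open>v\<close> in the role of
  \<open>f\<close>: it trades \<open>v'\<close> for \<open>2 H v\<close>, at the price of a second
  moment of \<open>H\<close>. With no derivative left, the estimate passes to bounded measurable
  \<open>u\<close> by dominated convergence, because the law of each \<open>H\<close> is absolutely
  continuous as soon as there is one coupling. A single spin has none and is treated trivially.

  Comparing Gibbs averages with their versions normalized by \<open>E Z\<close> would call for
  negative moments of \<open>Z\<close>. The logarithm in Jensen's inequality turns
  \<open>(E Z / Z)\<^sup>2\<close> into \<open>- 2 L\<close>, so the negative part of
  \<open>L\<close> is enough. The decisive use of \<open>\<beta> < 1\<close> is the exponential
  moment of the squared overlap of two independent uniform configurations, which is bounded
  uniformly in \<open>N\<close> below that threshold. The coupling
  \<open>b0 = \<beta> / \<surd>N\<close> and a tilt \<open>\<eta>\<close> of order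
  \<open>1/N\<close> make Gronwall's exponent, a multiple of \<open>b0\<^sup>2 / \<eta>\<close>,
  independent of \<open>N\<close>.\<close>

abbreviation std_gauss :: "real measure" where
  "std_gauss \<equiv> std_normal_distribution"

lemma prob_space_std_gauss: "prob_space std_gauss"
  by (rule prob_space_normal_density) simp

lemma integral_std_gauss:
  fixes f :: "real \<Rightarrow> real"
  assumes [measurable]: "f \<in> borel_measurable borel"
  shows "integral\<^sup>L std_gauss f = (\<integral>x. std_normal_density x * f x \<partial>lborel)"
  by (subst integral_density) auto

lemma integrable_std_gauss:
  fixes f :: "real \<Rightarrow> real"
  assumes [measurable]: "f \<in> borel_measurable borel"
  shows "integrable std_gauss f \<longleftrightarrow> integrable lborel (\<lambda>x. std_normal_density x * f x)"
  by (subst integrable_density) auto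

lemma std_gauss_exp:
  "integrable std_gauss (\<lambda>x. exp (a * x))" "(\<integral>x. exp (a * x) \<partial>std_gauss) = exp (a\<^sup>2 / 2)"
proof -
  have eq: "std_normal_density x * exp (a * x) = exp (a\<^sup>2 / 2) * normal_density a 1 x" for x
  proof -
    have "- x\<^sup>2 / 2 + a * x = a\<^sup>2 / 2 + (- (x - a)\<^sup>2 / 2)"
      by (simp add: power2_eq_square field_simps)
    then show ?thesis
      by (simp add: std_normal_density_def normal_density_def mult_exp_exp field_simps flip: exp_add)
  qed
  show "integrable std_gauss (\<lambda>x. exp (a * x))"
    by (subst integrable_std_gauss) (simp_all add: eq)
  show "(\<integral>x. exp (a * x) \<partial>std_gauss) = exp (a\<^sup>2 / 2)"
    by (subst integral_std_gauss) (simp_all add: eq)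
qed

text \<open>The tilted density is a multiple of the normal density with standard deviation
  \<open>s\<close>. The threshold \<open>1/2\<close> is where \<open>\<beta> < 1\<close> will be
  needed: \<open>sk_risk_smooth\<close> takes \<open>c = (1 + \<beta>\<^sup>2) / 4\<close>.\<close>

lemma std_gauss_exp_square:
  assumes c: "c < 1 / 2"
  shows "integrable std_gauss (\<lambda>x. exp (c * x\<^sup>2))"
proof -
  define s where "s = 1 / sqrt (1 - 2 * c)"
  have s: "s > 0" "1 / s\<^sup>2 = 1 - 2 * c" using c by (auto simp: s_def field_simps)
  have "std_normal_density x * exp (c * x\<^sup>2) = s * normal_density 0 s x" for x
  proof -
    have "- x\<^sup>2 / 2 + c * x\<^sup>2 = - (x\<^sup>2 * (1 / s\<^sup>2) / 2)"
      unfolding s(2) by (simp add: field_simps)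
    then have "exp (- x\<^sup>2 / 2) * exp (c * x\<^sup>2) = exp (- (x\<^sup>2 / (2 * s\<^sup>2)))"
      by (simp flip: exp_add)
    moreover have "sqrt (2 * pi * s\<^sup>2) = s * sqrt (2 * pi)"
      using s by (simp add: real_sqrt_mult)
    ultimately show ?thesis
      using s by (simp add: std_normal_density_def normal_density_def)
  qed
  then show ?thesis using s by (subst integrable_std_gauss) simp_all
qed

lemma std_gauss_square: "integrable std_gauss (\<lambda>x. x\<^sup>2)"
  using integrable_std_normal_moment[of 2] by (subst integrable_std_gauss) simp_all

lemma has_derivative_everywhere:
  fixes f f' :: "real \<Rightarrow> real"
  assumes "\<And>x. (f has_real_derivative f' x) (at x)"
  shows "continuous_on UNIV f" "f \<in> borel_measurable borel"
proof -
  show "continuous_on UNIV f"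
    using assms by (auto simp: continuous_on_eq_continuous_at intro: DERIV_isCont)
  then show "f \<in> borel_measurable borel" by (rule borel_measurable_continuous_onI)
qed

lemma std_normal_density_deriv:
  "(std_normal_density has_real_derivative - x * std_normal_density x) (at x)"
  unfolding std_normal_density_def
  by (auto intro!: derivative_eq_intros simp: field_simps)

text \<open>Removes the boundary terms in \<open>std_gauss_ibp\<close>, where \<open>F\<close> may
  grow linearly.\<close>

lemma std_normal_density_linear_tendsto:
  "((\<lambda>x. (1 + \<bar>x\<bar>) * std_normal_density x) \<longlongrightarrow> 0) at_top"
  "((\<lambda>x. (1 + \<bar>x\<bar>) * std_normal_density x) \<longlongrightarrow> 0) at_bot"
proof -
  have 1: "((\<lambda>x::real. (1 + x) * (1 / sqrt (2 * pi) * exp (- x\<^sup>2 / 2))) \<longlongrightarrow> 0) at_top"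
  proof (rule tendsto_sandwich[where f="\<lambda>_. 0"])
    show "\<forall>\<^sub>F x in at_top. (1 + x) * (1 / sqrt (2 * pi) * exp (- x\<^sup>2 / 2)) \<le> x ^ 0 / exp x + x ^ 1 / exp x"
    proof (rule eventually_mono[OF eventually_ge_at_top[of 2]])
      fix x :: real assume x: "2 \<le> x"
      have "exp (- x\<^sup>2 / 2) \<le> exp (- x)" using x by (simp add: power2_eq_square)
      moreover have "1 / sqrt (2 * pi) \<le> 1" using pi_gt3 by (simp add: field_simps)
      ultimately have "1 / sqrt (2 * pi) * exp (- x\<^sup>2 / 2) \<le> 1 * exp (- x)" by (intro mult_mono) auto
      then have "(1 + x) * (1 / sqrt (2 * pi) * exp (- x\<^sup>2 / 2)) \<le> (1 + x) * exp (- x)"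
        using x by (intro mult_left_mono) auto
      then show "(1 + x) * (1 / sqrt (2 * pi) * exp (- x\<^sup>2 / 2)) \<le> x ^ 0 / exp x + x ^ 1 / exp x"
        by (simp add: exp_minus field_simps)
    qed
    show "((\<lambda>x::real. x ^ 0 / exp x + x ^ 1 / exp x) \<longlongrightarrow> 0) at_top"
      using tendsto_add[OF tendsto_power_div_exp_0[of 0] tendsto_power_div_exp_0[of 1]] by simp
  qed (auto intro!: eventually_mono[OF eventually_ge_at_top[of 0]])
  show "((\<lambda>x. (1 + \<bar>x\<bar>) * std_normal_density x) \<longlongrightarrow> 0) at_top"
    unfolding std_normal_density_def
    by (rule Lim_transform_eventually[OF 1]) (auto intro: eventually_mono[OF eventually_ge_at_top[of 0]])
  then show "((\<lambda>x. (1 + \<bar>x\<bar>) * std_normal_density x) \<longlongrightarrow> 0) at_bot"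
    by (subst filterlim_at_bot_mirror) (simp add: std_normal_density_def)
qed

lemma std_gauss_linear_square:
  assumes "A \<ge> 0" shows "integrable std_gauss (\<lambda>x. A * (1 + \<bar>x\<bar>)\<^sup>2)"
proof -
  interpret prob_space std_gauss by (rule prob_space_std_gauss)
  have "integrable std_gauss (\<lambda>x. A * (2 + 2 * x\<^sup>2))" using std_gauss_square by simp
  then show ?thesis
  proof (rule Bochner_Integration.integrable_bound)
    have "(1 + \<bar>x\<bar>)\<^sup>2 \<le> 2 + 2 * x\<^sup>2" for x :: real
      using zero_le_power2[of "1 - \<bar>x\<bar>"] by (simp add: power2_eq_square algebra_simps)
    then show "AE x in std_gauss. norm (A * (1 + \<bar>x\<bar>)\<^sup>2) \<le> norm (A * (2 + 2 * x\<^sup>2))"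
      using assms by (auto simp: abs_mult intro!: mult_left_mono)
  qed simp
qed

text \<open>\<open>- \<phi> F\<close> has derivative \<open>\<phi> (x F - F')\<close>, so the
  integral over \<open>[-k, k]\<close> is a difference of boundary values, which vanish as
  \<open>k\<close> grows. Linear growth rather than boundedness is allowed because \<open>L\<close>,
  and with it \<open>softplus_sq_d1 (L b g)\<close>, is only bounded linearly in the
  disorder.\<close>

lemma std_gauss_ibp:
  fixes F F' :: "real \<Rightarrow> real"
  assumes der: "\<And>x. (F has_real_derivative F' x) (at x)"
    and F'[measurable]: "F' \<in> borel_measurable borel"
    and bF: "\<And>x. \<bar>F x\<bar> \<le> A * (1 + \<bar>x\<bar>)" and bF': "\<And>x. \<bar>F' x\<bar> \<le> A * (1 + \<bar>x\<bar>)"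
  shows "(\<integral>x. x * F x - F' x \<partial>std_gauss) = 0"
proof -
  have F[measurable]: "F \<in> borel_measurable borel" by (rule has_derivative_everywhere(2)[OF der])
  have A: "A \<ge> 0" using bF[of 0] by simp
  let ?\<phi> = std_normal_density
  define w where "w x = ?\<phi> x * (x * F x - F' x)" for x
  have int: "integrable std_gauss (\<lambda>x. x * F x - F' x)"
  proof (rule Bochner_Integration.integrable_bound[OF std_gauss_linear_square[of "2 * A"]])
    show "AE x in std_gauss. norm (x * F x - F' x) \<le> norm (2 * A * (1 + \<bar>x\<bar>)\<^sup>2)"
    proof (rule AE_I2)
      fix x :: real
      have "\<bar>x * F x - F' x\<bar> \<le> \<bar>x\<bar> * \<bar>F x\<bar> + \<bar>F' x\<bar>" by (metis abs_triangle_ineq4 abs_mult)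
      also have "\<dots> \<le> \<bar>x\<bar> * (A * (1 + \<bar>x\<bar>)) + A * (1 + \<bar>x\<bar>)"
        using bF[of x] bF'[of x] by (intro add_mono mult_left_mono) auto
      also have "\<dots> \<le> 2 * A * (1 + \<bar>x\<bar>)\<^sup>2" using A by (simp add: power2_eq_square algebra_simps)
      finally show "norm (x * F x - F' x) \<le> norm (2 * A * (1 + \<bar>x\<bar>)\<^sup>2)" using A by (simp add: abs_mult)
    qed
  qed (use A in auto)
  then have w_int: "integrable lborel w" unfolding w_def by (subst (asm) integrable_std_gauss) auto
  have derw: "((\<lambda>x. - (?\<phi> x * F x)) has_real_derivative w x) (at x)" for x
    unfolding w_def
    by (rule derivative_eq_intros std_normal_density_deriv der refl)+ (simp add: algebra_simps)
  have lim0: "(\<lambda>k. ?\<phi> (f k) * F (f k)) \<longlonglongrightarrow> 0"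
    if f: "(\<lambda>k. (1 + \<bar>f k\<bar>) * ?\<phi> (f k)) \<longlonglongrightarrow> 0" for f :: "nat \<Rightarrow> real"
  proof (rule Lim_null_comparison)
    show "\<forall>\<^sub>F k in sequentially. norm (?\<phi> (f k) * F (f k)) \<le> A * ((1 + \<bar>f k\<bar>) * ?\<phi> (f k))"
      using bF by (auto simp: abs_mult mult.commute[of _ "\<bar>F _\<bar>"] mult.assoc[symmetric] intro!: always_eventually mult_right_mono)
    show "(\<lambda>k. A * ((1 + \<bar>f k\<bar>) * ?\<phi> (f k))) \<longlonglongrightarrow> 0"
      using tendsto_mult_left[OF f, of A] by simp
  qed
  have t: "filterlim (\<lambda>k. real k) at_top sequentially" "filterlim (\<lambda>k. - real k) at_bot sequentially"
    using filterlim_real_sequentially by (auto simp: filterlim_uminus_at_bot)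
  have lim: "(\<lambda>k. ?\<phi> (- real k) * F (- real k) - ?\<phi> (real k) * F (real k)) \<longlonglongrightarrow> 0 - 0"
    by (intro tendsto_diff lim0 filterlim_compose[OF std_normal_density_linear_tendsto(1) t(1)]
      filterlim_compose[OF std_normal_density_linear_tendsto(2) t(2)])
  have eq: "(\<integral>x. indicator {- real k..real k} x * w x \<partial>lborel) = ?\<phi> (- real k) * F (- real k) - ?\<phi> (real k) * F (real k)" for k
  proof -
    \<comment> \<open>\<open>F'\<close> is only measurable, so the fundamental theorem is used for
      the gauge integral and transferred to the Lebesgue integral through the integrability of
      \<open>w\<close>.\<close>
    have "(w has_integral (- (?\<phi> (real k) * F (real k)) - - (?\<phi> (- real k) * F (- real k)))) {- real k..real k}"
      using derw by (intro fundamental_theorem_of_calculus)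
        (auto simp: has_real_derivative_iff_has_vector_derivative[symmetric] intro: DERIV_subset)
    moreover have "set_integrable lborel {- real k..real k} w"
      unfolding set_integrable_def using w_int by (intro integrable_mult_indicator) auto
    ultimately show ?thesis
      using set_borel_integral_eq_integral(2)[of "{- real k..real k}" w]
      by (auto simp: set_lebesgue_integral_def dest: integral_unique)
  qed
  have "(\<lambda>k. \<integral>x. indicator {- real k..real k} x * w x \<partial>lborel) \<longlonglongrightarrow> integral\<^sup>L lborel w"
  proof (rule integral_dominated_convergence[where w="\<lambda>x. \<bar>w x\<bar>"])
    show "AE x in lborel. (\<lambda>k. indicator {- real k..real k} x * w x) \<longlonglongrightarrow> w x"
    proof (rule AE_I2)
      fix x :: real
      obtain K :: nat where "\<bar>x\<bar> \<le> real K" using real_arch_simple by blast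
      then have "eventually (\<lambda>k. indicator {- real k..real k} x * w x = w x) sequentially"
        by (intro eventually_sequentiallyI[of K]) (auto simp: indicator_def)
      then show "(\<lambda>k. indicator {- real k..real k} x * w x) \<longlonglongrightarrow> w x" by (rule tendsto_eventually)
    qed
    show "w \<in> borel_measurable lborel" unfolding w_def by measurable
  qed (use w_int in \<open>auto simp: indicator_def\<close>)
  then have "integral\<^sup>L lborel w = 0" using lim LIMSEQ_unique by (auto simp: eq)
  then show ?thesis by (subst integral_std_gauss) (auto simp: w_def[abs_def])
qed

section \<open>Gibbs measures with Gaussian Hamiltonian\<close>

text \<open>In the application \<open>I\<close> is the set of pairs, \<open>S\<close> the set of
  spin configurations and \<open>e \<sigma> (i, j)\<close> the product of the spins at
  \<open>i\<close> and \<open>j\<close>. The condition on squares gives all energies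
  \<open>X g \<sigma>\<close> the same variance \<open>card I\<close>.\<close>

locale gaussian_gibbs =
  fixes I :: "'i set" and S :: "'s set" and e :: "'s \<Rightarrow> 'i \<Rightarrow> real"
  assumes finite_I: "finite I" and finite_S: "finite S" and S_nonempty: "S \<noteq> {}"
    and e_square: "\<And>\<sigma> k. \<sigma> \<in> S \<Longrightarrow> k \<in> I \<Longrightarrow> (e \<sigma> k)\<^sup>2 = 1"
begin

definition G :: "('i \<Rightarrow> real) measure" where
  "G = PiM I (\<lambda>_. std_gauss)"

definition X :: "('i \<Rightarrow> real) \<Rightarrow> 's \<Rightarrow> real" where
  "X g \<sigma> = (\<Sum>k\<in>I. e \<sigma> k * g k)"

text \<open>The covariance of the energies of \<open>\<sigma>\<close> and
  \<open>\<tau>\<close>.\<close>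

definition q :: "'s \<Rightarrow> 's \<Rightarrow> real" where
  "q \<sigma> \<tau> = (\<Sum>k\<in>I. e \<sigma> k * e \<tau> k)"

definition Z :: "real \<Rightarrow> ('i \<Rightarrow> real) \<Rightarrow> real" where
  "Z b g = (\<Sum>\<sigma>\<in>S. exp (b * X g \<sigma>))"

definition p :: "real \<Rightarrow> ('i \<Rightarrow> real) \<Rightarrow> 's \<Rightarrow> real" where
  "p b g \<sigma> = exp (b * X g \<sigma>) / Z b g"

text \<open>A common majorant: \<open>X\<close>, \<open>mean_X\<close> and \<open>L\<close> are at
  most constant multiples of it, and the summand \<open>1\<close> lets it absorb additive
  constants.\<close>

definition growth :: "('i \<Rightarrow> real) \<Rightarrow> real" where
  "growth g = 1 + (\<Sum>k\<in>I. \<bar>g k\<bar>)"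

text \<open>The function \<open>\<Psi>\<close> depends on the disorder through the \<open>X g \<tau>\<close>, and \<open>K \<tau>\<close> is its
  partial derivative in \<open>X g \<tau>\<close>.\<close>
definition xderiv :: "(('i \<Rightarrow> real) \<Rightarrow> real) \<Rightarrow> ('s \<Rightarrow> real) \<Rightarrow> ('i \<Rightarrow> real) \<Rightarrow> bool" where
  "xderiv \<Psi> K g \<longleftrightarrow>
     (\<forall>i\<in>I. ((\<lambda>x. \<Psi> (g(i := x))) has_real_derivative (\<Sum>\<tau>\<in>S. e \<tau> i * K \<tau>)) (at (g i)))"

lemma sets_G: "sets G = sets (PiM I (\<lambda>_. borel))"
  unfolding G_def by (intro sets_PiM_cong) auto

lemma measurable_G: "measurable G N = measurable (PiM I (\<lambda>_. borel)) N"
  by (rule measurable_cong_sets) (auto simp: sets_G)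

lemma coord_measurable: "k \<in> I \<Longrightarrow> (\<lambda>g. g k) \<in> borel_measurable G"
  unfolding measurable_G by measurable

lemma X_measurable [measurable]: "(\<lambda>g. X g \<sigma>) \<in> borel_measurable G"
  unfolding X_def by (intro borel_measurable_sum borel_measurable_times coord_measurable) auto

lemma Z_measurable [measurable]: "(\<lambda>g. Z b g) \<in> borel_measurable G"
  unfolding Z_def by measurable

lemma p_measurable [measurable]: "(\<lambda>g. p b g \<sigma>) \<in> borel_measurable G"
  unfolding p_def by measurable

lemma growth_measurable [measurable]: "growth \<in> borel_measurable G"
  unfolding growth_def using coord_measurable by (auto intro!: borel_measurable_sum borel_measurable_add borel_measurable_abs)

lemma prob_space_G: "prob_space G"
  unfolding G_def by (intro prob_space_PiM prob_space_std_gauss)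

lemma product_sigma_finite_std_gauss: "product_sigma_finite (\<lambda>_::'i. std_gauss)"
  using prob_space_std_gauss by (auto simp: product_sigma_finite_def intro: prob_space_imp_sigma_finite)

lemma Z_pos: "Z b g > 0"
  unfolding Z_def using finite_S S_nonempty by (intro sum_pos) auto

lemma p_nonneg: "p b g \<sigma> \<ge> 0"
  unfolding p_def using Z_pos[of b g] by simp

lemma sum_p: "(\<Sum>\<sigma>\<in>S. p b g \<sigma>) = 1"
  unfolding p_def using Z_pos[of b g] by (simp add: sum_divide_distrib[symmetric]) (simp add: Z_def)

lemma p_le_1: "\<sigma> \<in> S \<Longrightarrow> p b g \<sigma> \<le> 1"
  using member_le_sum[of \<sigma> S "p b g"] p_nonneg finite_S by (simp add: sum_p)

lemma growth_ge_1: "growth g \<ge> 1"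
  unfolding growth_def by (simp add: sum_nonneg)

lemma abs_e: "\<sigma> \<in> S \<Longrightarrow> k \<in> I \<Longrightarrow> \<bar>e \<sigma> k\<bar> = 1"
  using e_square by (simp add: abs_square_eq_1)

lemma abs_X_le: "\<sigma> \<in> S \<Longrightarrow> \<bar>X g \<sigma>\<bar> \<le> growth g"
proof -
  assume "\<sigma> \<in> S"
  then have "\<bar>X g \<sigma>\<bar> \<le> (\<Sum>k\<in>I. \<bar>g k\<bar>)"
    unfolding X_def by (intro order.trans[OF sum_abs] sum_mono) (simp add: abs_mult abs_e)
  then show ?thesis by (simp add: growth_def)
qed

lemma abs_q_le: "\<sigma> \<in> S \<Longrightarrow> \<tau> \<in> S \<Longrightarrow> \<bar>q \<sigma> \<tau>\<bar> \<le> real (card I)"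
  using sum_abs[of "\<lambda>k. e \<sigma> k * e \<tau> k" I] by (simp add: q_def abs_mult abs_e)

lemma q_diag: "\<sigma> \<in> S \<Longrightarrow> q \<sigma> \<sigma> = real (card I)"
  unfolding q_def using e_square by (simp add: power2_eq_square)

lemma q_sym: "q \<sigma> \<tau> = q \<tau> \<sigma>"
  unfolding q_def by (simp add: mult.commute)

lemma G_exp:
  "integrable G (\<lambda>g. exp (\<Sum>k\<in>I. a k * g k))"
  "(\<integral>g. exp (\<Sum>k\<in>I. a k * g k) \<partial>G) = exp ((\<Sum>k\<in>I. (a k)\<^sup>2) / 2)"
proof -
  interpret product_sigma_finite "\<lambda>_::'i. std_gauss" by (rule product_sigma_finite_std_gauss)
  show "integrable G (\<lambda>g. exp (\<Sum>k\<in>I. a k * g k))"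
    unfolding G_def exp_sum[OF finite_I]
    by (rule product_integrable_prod[OF finite_I]) (rule std_gauss_exp)
  have "(\<integral>g. exp (\<Sum>k\<in>I. a k * g k) \<partial>G) = (\<Prod>k\<in>I. exp ((a k)\<^sup>2 / 2))"
    unfolding G_def exp_sum[OF finite_I]
    by (subst product_integral_prod[OF finite_I]) (simp_all add: std_gauss_exp)
  then show "(\<integral>g. exp (\<Sum>k\<in>I. a k * g k) \<partial>G) = exp ((\<Sum>k\<in>I. (a k)\<^sup>2) / 2)"
    by (simp add: exp_sum[OF finite_I, symmetric] sum_divide_distrib)
qed

text \<open>Bounding \<open>1 + x\<close> by \<open>exp x\<close> turns the square of a sum into a
  product over coordinates, which is integrable factor by factor.\<close>

lemma integrable_growth_square: "integrable G (\<lambda>g. (growth g)\<^sup>2)"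
proof (rule Bochner_Integration.integrable_bound)
  interpret product_sigma_finite "\<lambda>_::'i. std_gauss" by (rule product_sigma_finite_std_gauss)
  have "integrable std_gauss (\<lambda>x. exp (2 * \<bar>x\<bar>))"
  proof (rule Bochner_Integration.integrable_bound)
    show "integrable std_gauss (\<lambda>x. exp (2 * x) + exp (-2 * x))"
      by (intro Bochner_Integration.integrable_add std_gauss_exp)
    have "norm (exp (2 * \<bar>x\<bar>)) \<le> norm (exp (2 * x) + exp (-2 * x))" for x :: real
      using exp_gt_zero[of "2 * x"] exp_gt_zero[of "-2 * x"] by (cases "x \<ge> 0") (auto simp: abs_of_pos add_pos_pos)
    then show "AE x in std_gauss. norm (exp (2 * \<bar>x\<bar>)) \<le> norm (exp (2 * x) + exp (-2 * x))" by auto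
  qed simp
  then show "integrable G (\<lambda>g. \<Prod>k\<in>I. exp (2 * \<bar>g k\<bar>))"
    unfolding G_def by (intro product_integrable_prod[OF finite_I])
  have "(growth g)\<^sup>2 \<le> (\<Prod>k\<in>I. exp (2 * \<bar>g k\<bar>))" for g
  proof -
    have "growth g \<le> exp (\<Sum>k\<in>I. \<bar>g k\<bar>)" unfolding growth_def by (rule exp_ge_add_one_self)
    then have "(growth g)\<^sup>2 \<le> (exp (\<Sum>k\<in>I. \<bar>g k\<bar>))\<^sup>2" using growth_ge_1[of g] by (intro power_mono) auto
    also have "\<dots> = (\<Prod>k\<in>I. exp (2 * \<bar>g k\<bar>))"
      by (simp add: exp_sum[OF finite_I] exp_double prod_power_distrib)
    finally show ?thesis .
  qed
  then show "AE g in G. norm ((growth g)\<^sup>2) \<le> norm (\<Prod>k\<in>I. exp (2 * \<bar>g k\<bar>))"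
    by (auto simp: prod_nonneg abs_of_nonneg)
qed measurable

lemma integrable_growth_square_bound:
  assumes [measurable]: "\<Psi> \<in> borel_measurable G" and "\<And>g. \<bar>\<Psi> g\<bar> \<le> A * (growth g)\<^sup>2"
  shows "integrable G \<Psi>"
proof (rule Bochner_Integration.integrable_bound)
  show "integrable G (\<lambda>g. A * (growth g)\<^sup>2)" using integrable_growth_square by simp
  show "AE g in G. norm (\<Psi> g) \<le> norm (A * (growth g)\<^sup>2)" using assms(2) by (auto intro!: AE_I2 order_trans[OF assms(2)])
qed simp

lemma growth_le_square: "growth g \<le> (growth g)\<^sup>2"
  using growth_ge_1[of g] by (simp add: power2_eq_square mult_le_cancel_left1)

lemma integrable_growth_bound:
  assumes "\<Psi> \<in> borel_measurable G" and "\<And>g. \<bar>\<Psi> g\<bar> \<le> A * growth g"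
  shows "integrable G \<Psi>"
proof (rule integrable_growth_square_bound[OF assms(1), of A])
  fix g
  have "A \<ge> 0" using assms(2)[of g] growth_ge_1[of g] by (smt (verit) mult_nonneg_nonneg zero_le_mult_iff)
  then show "\<bar>\<Psi> g\<bar> \<le> A * (growth g)\<^sup>2" using assms(2)[of g] growth_le_square[of g] by (smt (verit) mult_left_mono)
qed

lemma integrable_bounded:
  fixes A :: real
  assumes "\<Psi> \<in> borel_measurable G" and "\<And>g. \<bar>\<Psi> g\<bar> \<le> A"
  shows "integrable G \<Psi>"
proof (rule integrable_growth_bound[OF assms(1), of A])
  fix g
  show "\<bar>\<Psi> g\<bar> \<le> A * growth g" using assms(2)[of g] growth_ge_1[of g] by (smt (verit) mult_le_cancel_left1)
qed

text \<open>Fubini isolates the coordinate \<open>i\<close>. With the others frozen,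
  \<open>growth\<close> is linear in \<open>g i\<close>, so \<open>std_gauss_ibp\<close> makes the
  inner integral of \<open>g i * \<Psi> g - D g\<close> vanish.\<close>

lemma ibp_coord:
  assumes i: "i \<in> I" and [measurable]: "\<Psi> \<in> borel_measurable G" "D \<in> borel_measurable G"
    and der: "\<And>g. ((\<lambda>x. \<Psi> (g(i := x))) has_real_derivative D g) (at (g i))"
    and b: "\<And>g. \<bar>\<Psi> g\<bar> \<le> A * growth g" "\<And>g. \<bar>D g\<bar> \<le> A * growth g"
  shows "integrable G (\<lambda>g. g i * \<Psi> g)" "(\<integral>g. g i * \<Psi> g \<partial>G) = (\<integral>g. D g \<partial>G)"
proof -
  interpret product_sigma_finite "\<lambda>_::'i. std_gauss" by (rule product_sigma_finite_std_gauss)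
  have [measurable]: "(\<lambda>g. g i) \<in> borel_measurable G" using coord_measurable[OF i] .
  define J where "J = I - {i}"
  have J: "I = insert i J" "finite J" "i \<notin> J" using i finite_I by (auto simp: J_def)
  have gi: "\<bar>g i\<bar> \<le> growth g" for g
    using member_le_sum[OF i, of "\<lambda>k. \<bar>g k\<bar>"] finite_I by (simp add: growth_def)
  show int1: "integrable G (\<lambda>g. g i * \<Psi> g)"
  proof (rule integrable_growth_square_bound[where A=A])
    fix g
    have "\<bar>g i * \<Psi> g\<bar> \<le> growth g * (A * growth g)"
      unfolding abs_mult using gi[of g] b(1)[of g] growth_ge_1[of g] by (intro mult_mono) auto
    then show "\<bar>g i * \<Psi> g\<bar> \<le> A * (growth g)\<^sup>2" by (simp add: power2_eq_square mult_ac)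
  qed simp
  have int2: "integrable G D" by (rule integrable_growth_bound[OF assms(3) b(2)])
  have int: "integrable G (\<lambda>g. g i * \<Psi> g - D g)" using int1 int2 by simp
  have "(\<integral>g. g i * \<Psi> g - D g \<partial>G) = (\<integral>x. (\<integral>y. y * \<Psi> (x(i := y)) - D (x(i := y)) \<partial>std_gauss) \<partial>PiM J (\<lambda>_. std_gauss))"
    using product_integral_insert[OF J(2,3), of "\<lambda>g. g i * \<Psi> g - D g"] int
    unfolding G_def by (simp add: J(1)[symmetric])
  also have "\<dots> = (\<integral>x. 0 \<partial>PiM J (\<lambda>_. std_gauss))"
  proof (rule Bochner_Integration.integral_cong[OF refl])
    fix x assume x: "x \<in> space (PiM J (\<lambda>_::'i. std_gauss))"
    define c where "c = 1 + (\<Sum>k\<in>J. \<bar>x k\<bar>)"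
    have linc: "growth (x(i := y)) \<le> c * (1 + \<bar>y\<bar>)" for y
    proof -
      have "(\<Sum>k\<in>J. \<bar>(x(i := y)) k\<bar>) = (\<Sum>k\<in>J. \<bar>x k\<bar>)" using J(3) by (intro sum.cong) auto
      then have "(\<Sum>k\<in>I. \<bar>(x(i := y)) k\<bar>) = \<bar>y\<bar> + (\<Sum>k\<in>J. \<bar>x k\<bar>)" using J(2,3) by (subst J(1)) simp
      then have "growth (x(i := y)) = c + \<bar>y\<bar>" by (simp add: growth_def c_def)
      moreover have "c \<ge> 1" by (simp add: c_def sum_nonneg)
      ultimately show ?thesis using mult_right_mono[of 1 c "\<bar>y\<bar>"] by (simp add: algebra_simps)
    qed
    have A: "A \<ge> 0" using b(1)[of x] growth_ge_1[of x] by (smt (verit) mult_nonneg_nonneg zero_le_mult_iff)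
    show "(\<integral>y. y * \<Psi> (x(i := y)) - D (x(i := y)) \<partial>std_gauss) = 0"
    proof (rule std_gauss_ibp[where A="A * c"])
      fix y
      show "((\<lambda>y. \<Psi> (x(i := y))) has_real_derivative D (x(i := y))) (at y)"
        using der[of "x(i := y)"] by simp
      show "\<bar>\<Psi> (x(i := y))\<bar> \<le> A * c * (1 + \<bar>y\<bar>)" "\<bar>D (x(i := y))\<bar> \<le> A * c * (1 + \<bar>y\<bar>)"
        using b[of "x(i := y)"] mult_left_mono[OF linc[of y] A] by (auto simp: mult.assoc intro: order_trans)
    next
      have "(\<lambda>y. x(i := y)) \<in> measurable std_gauss G"
        using measurable_component_update[OF x J(3)] by (simp add: G_def J(1)[symmetric])
      from measurable_comp[OF this assms(3)] show "(\<lambda>y. D (x(i := y))) \<in> borel_measurable borel"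
        by (simp add: comp_def)
    qed
  qed
  finally show "(\<integral>g. g i * \<Psi> g \<partial>G) = (\<integral>g. D g \<partial>G)" using int1 int2 by simp
qed

text \<open>\<open>X g \<sigma>\<close> is a combination of coordinates; summing
  \<open>ibp_coord\<close> over them gathers the products \<open>e \<sigma> i * e \<tau> i\<close>
  into the covariance \<open>q \<sigma> \<tau>\<close>. Afterwards the calculus refers to energies
  only, no longer to single couplings.\<close>

theorem ibp:
  assumes \<sigma>: "\<sigma> \<in> S" and [measurable]: "\<Psi> \<in> borel_measurable G"
    and K[measurable]: "\<And>\<tau>. \<tau> \<in> S \<Longrightarrow> (\<lambda>g. K g \<tau>) \<in> borel_measurable G"
    and der: "\<And>g. xderiv \<Psi> (K g) g"
    and b: "\<And>g. \<bar>\<Psi> g\<bar> \<le> A * growth g" "\<And>g \<tau>. \<tau> \<in> S \<Longrightarrow> \<bar>K g \<tau>\<bar> \<le> A * growth g"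
  shows "integrable G (\<lambda>g. X g \<sigma> * \<Psi> g)"
    "(\<integral>g. X g \<sigma> * \<Psi> g \<partial>G) = (\<integral>g. (\<Sum>\<tau>\<in>S. q \<sigma> \<tau> * K g \<tau>) \<partial>G)"
proof -
  define D where "D i g = (\<Sum>\<tau>\<in>S. e \<tau> i * K g \<tau>)" for i g
  have Dm: "D i \<in> borel_measurable G" for i
    unfolding D_def using K by (intro borel_measurable_sum) auto
  have c1: "1 \<le> real (card S)" using finite_S S_nonempty by (simp add: Suc_leI card_gt_0_iff)
  have A: "0 \<le> A * growth g" for g using b(1)[of g] by linarith
  have b1: "\<bar>\<Psi> g\<bar> \<le> (real (card S) * A) * growth g" for g
    using b(1)[of g] mult_right_mono[OF c1 A[of g]] by simp
  have b2: "\<bar>D i g\<bar> \<le> (real (card S) * A) * growth g" if "i \<in> I" for i g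
  proof -
    have "\<bar>D i g\<bar> \<le> (\<Sum>\<tau>\<in>S. \<bar>e \<tau> i * K g \<tau>\<bar>)" unfolding D_def by (rule sum_abs)
    also have "\<dots> \<le> (\<Sum>\<tau>\<in>S. A * growth g)" using that b(2) by (intro sum_mono) (simp add: abs_mult abs_e)
    finally show ?thesis by simp
  qed
  have co: "integrable G (\<lambda>g. g i * \<Psi> g)" "(\<integral>g. g i * \<Psi> g \<partial>G) = (\<integral>g. D i g \<partial>G)" if "i \<in> I" for i
    using ibp_coord[OF that assms(2) Dm[of i] _ b1 b2[OF that]] der that
    by (auto simp: xderiv_def D_def)
  have intD: "integrable G (D i)" if "i \<in> I" for i by (rule integrable_growth_bound[OF Dm b2[OF that]])
  have eq: "X g \<sigma> * \<Psi> g = (\<Sum>i\<in>I. e \<sigma> i * (g i * \<Psi> g))" for g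
    unfolding X_def by (simp add: sum_distrib_left sum_distrib_right mult_ac)
  show "integrable G (\<lambda>g. X g \<sigma> * \<Psi> g)"
    unfolding eq using co(1) by (intro Bochner_Integration.integrable_sum integrable_mult_right) auto
  have "(\<integral>g. X g \<sigma> * \<Psi> g \<partial>G) = (\<Sum>i\<in>I. e \<sigma> i * (\<integral>g. g i * \<Psi> g \<partial>G))"
    unfolding eq using co(1) by (subst Bochner_Integration.integral_sum) auto
  also have "\<dots> = (\<Sum>i\<in>I. e \<sigma> i * (\<integral>g. D i g \<partial>G))" using co(2) by simp
  also have "\<dots> = (\<integral>g. (\<Sum>i\<in>I. e \<sigma> i * D i g) \<partial>G)"
    using intD by (subst Bochner_Integration.integral_sum) auto
  also have "(\<lambda>g. \<Sum>i\<in>I. e \<sigma> i * D i g) = (\<lambda>g. \<Sum>\<tau>\<in>S. q \<sigma> \<tau> * K g \<tau>)"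
    unfolding D_def q_def by (rule ext, subst sum.swap[of _ S I] | simp add: sum_distrib_left sum_distrib_right mult_ac)+
  finally show "(\<integral>g. X g \<sigma> * \<Psi> g \<partial>G) = (\<integral>g. (\<Sum>\<tau>\<in>S. q \<sigma> \<tau> * K g \<tau>) \<partial>G)" .
qed

section \<open>Rules for differentiating with respect to the energies\<close>

lemma xderiv_cong: "xderiv \<Psi> K g \<Longrightarrow> (\<And>\<tau>. \<tau> \<in> S \<Longrightarrow> K \<tau> = K' \<tau>) \<Longrightarrow> xderiv \<Psi> K' g"
  unfolding xderiv_def by (metis (mono_tags, lifting) sum.cong)

lemma xderiv_X: "\<sigma> \<in> S \<Longrightarrow> xderiv (\<lambda>g. X g \<sigma>) (\<lambda>\<tau>. of_bool (\<tau> = \<sigma>)) g"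
  unfolding xderiv_def
proof
  fix i assume \<sigma>: "\<sigma> \<in> S" and i: "i \<in> I"
  have "X (g(i := x)) \<sigma> = e \<sigma> i * x + (\<Sum>k\<in>I - {i}. e \<sigma> k * g k)" for x
    unfolding X_def by (subst sum.remove[OF finite_I i]) (auto intro!: sum.cong)
  moreover have "(\<Sum>\<tau>\<in>S. e \<tau> i * of_bool (\<tau> = \<sigma>)) = e \<sigma> i"
    using \<sigma> finite_S by (simp add: of_bool_def if_distrib sum.delta cong: if_cong)
  ultimately show "((\<lambda>x. X (g(i := x)) \<sigma>) has_real_derivative (\<Sum>\<tau>\<in>S. e \<tau> i * of_bool (\<tau> = \<sigma>))) (at (g i))"
    by (auto intro!: derivative_eq_intros)
qed

lemma xderiv_sum:
  "finite T \<Longrightarrow> (\<And>t. t \<in> T \<Longrightarrow> xderiv (\<Psi> t) (K t) g) \<Longrightarrow> xderiv (\<lambda>g. \<Sum>t\<in>T. \<Psi> t g) (\<lambda>\<tau>. \<Sum>t\<in>T. K t \<tau>) g"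
  unfolding xderiv_def
  by (auto intro!: derivative_eq_intros simp: sum_distrib_left sum.swap[of _ S T])

lemma xderiv_mult:
  "xderiv \<Psi> K g \<Longrightarrow> xderiv \<Phi> L g \<Longrightarrow> xderiv (\<lambda>g. \<Psi> g * \<Phi> g) (\<lambda>\<tau>. K \<tau> * \<Phi> g + \<Psi> g * L \<tau>) g"
  unfolding xderiv_def
  by (auto intro!: derivative_eq_intros simp: sum_distrib_left sum_distrib_right sum.distrib algebra_simps)

lemma xderiv_comp:
  "(f has_real_derivative d) (at (\<Psi> g)) \<Longrightarrow> xderiv \<Psi> K g \<Longrightarrow> xderiv (\<lambda>g. f (\<Psi> g)) (\<lambda>\<tau>. d * K \<tau>) g"
  unfolding xderiv_def
proof
  fix i assume f: "(f has_real_derivative d) (at (\<Psi> g))" and i: "i \<in> I"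
    and d: "\<forall>i\<in>I. ((\<lambda>x. \<Psi> (g(i := x))) has_real_derivative (\<Sum>\<tau>\<in>S. e \<tau> i * K \<tau>)) (at (g i))"
  have "((\<lambda>x. f (\<Psi> (g(i := x)))) has_real_derivative d * (\<Sum>\<tau>\<in>S. e \<tau> i * K \<tau>)) (at (g i))"
    using f d i by (intro DERIV_chain'[where f="\<lambda>x. \<Psi> (g(i := x))"]) auto
  then show "((\<lambda>x. f (\<Psi> (g(i := x)))) has_real_derivative (\<Sum>\<tau>\<in>S. e \<tau> i * (d * K \<tau>))) (at (g i))"
    by (simp add: sum_distrib_left mult_ac)
qed

lemma xderiv_fun_X: "\<sigma> \<in> S \<Longrightarrow> (f has_real_derivative d) (at (X g \<sigma>)) \<Longrightarrow>
    xderiv (\<lambda>g. f (X g \<sigma>)) (\<lambda>\<tau>. d * of_bool (\<tau> = \<sigma>)) g"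
  by (rule xderiv_comp[OF _ xderiv_X])

lemma xderiv_Z: "xderiv (Z b) (\<lambda>\<tau>. b * exp (b * X g \<tau>)) g"
proof -
  have "xderiv (\<lambda>g. \<Sum>\<sigma>\<in>S. exp (b * X g \<sigma>)) (\<lambda>\<tau>. \<Sum>\<sigma>\<in>S. (b * exp (b * X g \<sigma>)) * of_bool (\<tau> = \<sigma>)) g"
    by (intro xderiv_sum finite_S xderiv_fun_X[of _ "\<lambda>x. exp (b * x)"]) (auto intro!: derivative_eq_intros)
  then show ?thesis unfolding Z_def[abs_def]
    by (rule xderiv_cong) (use finite_S in \<open>simp add: of_bool_def if_distrib sum.delta' cong: if_cong\<close>)
qed

text \<open>The term \<open>- p b g \<tau>\<close> comes from the normalization \<open>Z\<close>; in
  later sums over \<open>\<tau>\<close> it acts as the average over a new replica.\<close>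

lemma xderiv_p: "\<sigma> \<in> S \<Longrightarrow> xderiv (\<lambda>g. p b g \<sigma>) (\<lambda>\<tau>. b * p b g \<sigma> * (of_bool (\<tau> = \<sigma>) - p b g \<tau>)) g"
proof -
  assume \<sigma>: "\<sigma> \<in> S"
  have "xderiv (\<lambda>g. exp (b * X g \<sigma>) * inverse (Z b g))
    (\<lambda>\<tau>. (b * exp (b * X g \<sigma>)) * of_bool (\<tau> = \<sigma>) * inverse (Z b g) + exp (b * X g \<sigma>) * (- (1 / (Z b g)\<^sup>2) * (b * exp (b * X g \<tau>)))) g"
    using Z_pos[of b g] \<sigma>
    by (intro xderiv_mult xderiv_fun_X[of _ "\<lambda>x. exp (b * x)"] xderiv_comp[OF _ xderiv_Z, of inverse])
      (auto intro!: derivative_eq_intros simp: power2_eq_square field_simps)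
  then have "xderiv (\<lambda>g. p b g \<sigma>) (\<lambda>\<tau>. (b * exp (b * X g \<sigma>)) * of_bool (\<tau> = \<sigma>) * inverse (Z b g) + exp (b * X g \<sigma>) * (- (1 / (Z b g)\<^sup>2) * (b * exp (b * X g \<tau>)))) g"
    by (simp add: p_def divide_inverse)
  then show ?thesis
    using Z_pos[of b g] by (rule_tac xderiv_cong) (auto simp: p_def power2_eq_square divide_simps algebra_simps)
qed

lemma sum_delta_S: "\<tau> \<in> S \<Longrightarrow> (\<Sum>\<sigma>\<in>S. f \<sigma> * of_bool (\<tau> = \<sigma>)) = (f \<tau> :: real)"
  using finite_S by (simp add: of_bool_def if_distrib sum.delta' cong: if_cong)

end

section \<open>The lower tail of the partition function\<close>

text \<open>\<open>softplus\<close> is a smooth, decreasing upper bound for the negative part.\<close>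
definition softplus :: "real \<Rightarrow> real" where
  "softplus x = ln (1 + exp (- x))"

definition logistic :: "real \<Rightarrow> real" where
  "logistic x = 1 / (1 + exp x)"

lemma logistic_bounds: "0 < logistic x" "logistic x < 1"
  by (auto simp: logistic_def add_pos_pos)

lemma softplus_pos: "0 < softplus x"
  unfolding softplus_def by (rule ln_gt_zero) simp

lemma softplus_ge: "- x \<le> softplus x"
  unfolding softplus_def by (subst ln_ge_iff) (auto simp: add_pos_pos)

lemma softplus_antimono: "x \<le> y \<Longrightarrow> softplus y \<le> softplus x"
  unfolding softplus_def by (simp add: add_pos_pos)

lemma softplus_le: "softplus x \<le> 1 + \<bar>x\<bar>"
proof -
  have "1 + exp (- x) \<le> exp \<bar>x\<bar> + exp \<bar>x\<bar>"
    by (intro add_mono) auto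
  also have "\<dots> \<le> exp 1 * exp \<bar>x\<bar>" using exp_ge_add_one_self[of "1::real"] by simp
  finally have "ln (1 + exp (- x)) \<le> ln (exp (1 + \<bar>x\<bar>))"
    by (subst ln_le_cancel_iff) (auto simp: exp_add add_pos_pos)
  then show ?thesis by (simp add: softplus_def)
qed

lemma softplus_deriv: "(softplus has_real_derivative - logistic x) (at x)"
proof -
  have "(softplus has_real_derivative - exp (- x) / (1 + exp (- x))) (at x)"
    unfolding softplus_def[abs_def] by (auto intro!: derivative_eq_intros simp: add_pos_pos)
  moreover have "exp (- x) / (1 + exp (- x)) = logistic x"
    by (simp add: logistic_def exp_minus field_simps add_pos_pos)
  ultimately show ?thesis by simp
qed

lemma logistic_deriv: "(logistic has_real_derivative - logistic x * (1 - logistic x)) (at x)"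
proof -
  have p: "1 + exp x \<noteq> 0" using exp_gt_zero[of x] by linarith
  have "(logistic has_real_derivative - exp x / (1 + exp x)\<^sup>2) (at x)"
    unfolding logistic_def[abs_def] using p by (auto intro!: derivative_eq_intros simp: power2_eq_square)
  moreover have "- exp x / (1 + exp x)\<^sup>2 = - logistic x * (1 - logistic x)"
    using p by (simp add: logistic_def power2_eq_square divide_simps)
  ultimately show ?thesis by simp
qed

lemma softplus_measurable [measurable]: "softplus \<in> borel_measurable borel"
  unfolding softplus_def[abs_def] by measurable

lemma logistic_measurable [measurable]: "logistic \<in> borel_measurable borel"
  unfolding logistic_def[abs_def] by measurable

definition softplus_sq_d1 :: "real \<Rightarrow> real" where
  "softplus_sq_d1 x = - 2 * softplus x * logistic x"

definition softplus_sq_d2 :: "real \<Rightarrow> real" where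
  "softplus_sq_d2 x = 2 * (logistic x)\<^sup>2 + 2 * softplus x * logistic x * (1 - logistic x)"

lemma softplus_sq_derivs_measurable [measurable]: "softplus_sq_d1 \<in> borel_measurable borel" "softplus_sq_d2 \<in> borel_measurable borel"
  unfolding softplus_sq_d1_def[abs_def] softplus_sq_d2_def[abs_def] by measurable

lemma softplus_sq_deriv: "((\<lambda>x. (softplus x)\<^sup>2) has_real_derivative softplus_sq_d1 x) (at x)"
  unfolding softplus_sq_d1_def by (auto intro!: derivative_eq_intros softplus_deriv)

lemma softplus_sq_d1_deriv: "(softplus_sq_d1 has_real_derivative softplus_sq_d2 x) (at x)"
  unfolding softplus_sq_d1_def[abs_def] softplus_sq_d2_def
  by (auto intro!: derivative_eq_intros softplus_deriv logistic_deriv simp: power2_eq_square algebra_simps)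

text \<open>The first derivative of \<open>softplus\<^sup>2\<close> is unbounded at minus infinity,
  but the second is not: \<open>softplus x \<le> exp (- x)\<close> and
  \<open>exp (- x) * (1 - logistic x) = logistic x\<close>, so each of the two summands is at most
  \<open>2\<close>.\<close>

lemma softplus_sq_d2_bounds: "0 \<le> softplus_sq_d2 x" "softplus_sq_d2 x \<le> 4"
proof -
  note l = logistic_bounds[of x] and s = softplus_pos[of x]
  show "0 \<le> softplus_sq_d2 x" unfolding softplus_sq_d2_def using l s by auto
  have "softplus x \<le> exp (- x)" unfolding softplus_def by (rule ln_add_one_self_le_self) simp
  then have "softplus x * (1 - logistic x) \<le> exp (- x) * (1 - logistic x)"
    using l by (intro mult_right_mono) auto
  also have "\<dots> = logistic x"
    using exp_gt_zero[of x] by (simp add: logistic_def exp_minus divide_simps) (use add_pos_pos[OF zero_less_one exp_gt_zero[of x]] in linarith)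
  finally have "logistic x * (softplus x * (1 - logistic x)) \<le> logistic x * logistic x"
    using l by (intro mult_left_mono) auto
  moreover have "logistic x * logistic x \<le> 1" using l by (simp add: mult_le_one)
  ultimately show "softplus_sq_d2 x \<le> 4" unfolding softplus_sq_d2_def by (simp add: power2_eq_square algebra_simps)
qed

lemma softplus_sq_d1_bounds: "- 2 * softplus x \<le> softplus_sq_d1 x" "softplus_sq_d1 x \<le> 0"
  using logistic_bounds[of x] softplus_pos[of x] unfolding softplus_sq_d1_def by (auto simp: mult_le_cancel_left1)

lemma mean_value_between:
  assumes "\<And>x. (f has_real_derivative f' x) (at x)"
  shows "\<exists>z. \<bar>z - x\<bar> \<le> \<bar>y\<bar> \<and> f (x + y) - f x = y * f' z"
proof -
  consider "y = 0" | "y > 0" | "y < 0" by linarith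
  then show ?thesis
  proof cases
    case 2
    with MVT2[of x "x + y" f f'] assms obtain z where "x < z" "z < x + y" "f (x + y) - f x = (x + y - x) * f' z" by auto
    then show ?thesis by (intro exI[of _ z]) auto
  next
    case 3
    with MVT2[of "x + y" x f f'] assms obtain z where "x + y < z" "z < x" "f x - f (x + y) = (x - (x + y)) * f' z" by auto
    then show ?thesis by (intro exI[of _ z]) auto
  qed auto
qed

text \<open>Two applications of the mean value theorem give the full bound \<open>4\<close> on the
  second derivative as error constant, without the usual factor \<open>1/2\<close>.\<close>

lemma softplus_sq_taylor: "(softplus (x + y))\<^sup>2 \<le> (softplus x)\<^sup>2 + softplus_sq_d1 x * y + 4 * y\<^sup>2"
proof -
  obtain z where z: "\<bar>z - x\<bar> \<le> \<bar>y\<bar>" "(softplus (x + y))\<^sup>2 - (softplus x)\<^sup>2 = y * softplus_sq_d1 z"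
    using mean_value_between[OF softplus_sq_deriv, of x y] by auto
  obtain w where w: "softplus_sq_d1 z - softplus_sq_d1 x = (z - x) * softplus_sq_d2 w"
    using mean_value_between[OF softplus_sq_d1_deriv, of x "z - x"] by auto
  have "\<bar>softplus_sq_d1 z - softplus_sq_d1 x\<bar> \<le> \<bar>y\<bar> * 4"
    unfolding w abs_mult using z(1) softplus_sq_d2_bounds[of w] by (intro mult_mono) auto
  then have "\<bar>y * (softplus_sq_d1 z - softplus_sq_d1 x)\<bar> \<le> \<bar>y\<bar> * (\<bar>y\<bar> * 4)" unfolding abs_mult by (intro mult_left_mono) auto
  then have "y * (softplus_sq_d1 z - softplus_sq_d1 x) \<le> 4 * y\<^sup>2" by (simp add: power2_eq_square)
  then show ?thesis using z(2) by (simp add: algebra_simps)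
qed

text \<open>A linear bound on the squared logarithm, because only first moments of the weighted
  exponentials are available. It rests on \<open>1 + x \<le> (1 + sqrt x)\<^sup>2\<close>.\<close>

lemma ln_add_one_sq_le: "x \<ge> 0 \<Longrightarrow> (ln (1 + x))\<^sup>2 \<le> 4 * (x::real)"
proof -
  assume x: "x \<ge> 0"
  have "1 + x \<le> (1 + sqrt x)\<^sup>2" using x by (simp add: power2_eq_square algebra_simps)
  then have "ln (1 + x) \<le> ln ((1 + sqrt x)\<^sup>2)" using x by (subst ln_le_cancel_iff) (auto simp: add_pos_nonneg)
  also have "\<dots> = 2 * ln (1 + sqrt x)" using x by (simp add: ln_realpow add_pos_nonneg)
  also have "\<dots> \<le> 2 * sqrt x" using ln_add_one_self_le_self[of "sqrt x"] x by simp
  finally have "(ln (1 + x))\<^sup>2 \<le> (2 * sqrt x)\<^sup>2" using x by (intro power_mono) auto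
  then show ?thesis using x by (simp add: power_mult_distrib)
qed

text \<open>Jensen's inequality, obtained by averaging the tangent bound
  \<open>ln y \<le> y - 1\<close> at \<open>y = exp (x t) / B\<close>.\<close>

lemma avg_le_ln_avg_exp:
  fixes w x :: "'t \<Rightarrow> real"
  assumes "finite T" and w: "\<And>t. t \<in> T \<Longrightarrow> 0 \<le> w t" and sum_w: "sum w T = 1"
  shows "(\<Sum>t\<in>T. w t * x t) \<le> ln (\<Sum>t\<in>T. w t * exp (x t))"
    and "0 < (\<Sum>t\<in>T. w t * exp (x t))"
proof -
  define B where "B = (\<Sum>t\<in>T. w t * exp (x t))"
  obtain t where t: "t \<in> T" "w t > 0"
    using w sum_w by (metis less_eq_real_def sum.neutral zero_neq_one)
  show B: "0 < (\<Sum>t\<in>T. w t * exp (x t))" by (rule sum_pos2[OF assms(1) t(1)]) (use t w in auto)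
  note B = B[folded B_def]
  have "x t \<le> ln B + exp (x t) / B - 1" for t
  proof -
    have "x t - ln B = ln (exp (x t) / B)" using B by (simp add: ln_div)
    also have "\<dots> \<le> exp (x t) / B - 1" using B by (intro ln_le_minus_one) auto
    finally show ?thesis by simp
  qed
  then have "(\<Sum>t\<in>T. w t * x t) \<le> (\<Sum>t\<in>T. w t * (ln B + exp (x t) / B - 1))"
    using w by (intro sum_mono mult_left_mono) auto
  also have "\<dots> = sum w T * (ln B - 1) + (\<Sum>t\<in>T. w t * exp (x t)) / B"
    by (simp add: algebra_simps sum.distrib sum_subtractf sum_distrib_left sum_divide_distrib)
  finally show "(\<Sum>t\<in>T. w t * x t) \<le> ln (\<Sum>t\<in>T. w t * exp (x t))"
    using B sum_w unfolding B_def[symmetric] by simp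
qed

text \<open>Where \<open>x t\<close> exceeds \<open>ln B\<close>, the square of the excess
  \<open>y\<close> is at most \<open>2 * exp y\<close>, and \<open>exp (x t) / B\<close> has average
  \<open>1\<close>. Where it does not, nonnegativity of \<open>x t\<close> allows squaring the
  comparison.\<close>

lemma avg_square_le_ln_avg_exp:
  fixes w x :: "'t \<Rightarrow> real"
  assumes "finite T" and w: "\<And>t. t \<in> T \<Longrightarrow> 0 \<le> w t" and sum_w: "sum w T = 1"
    and x: "\<And>t. t \<in> T \<Longrightarrow> 0 \<le> x t"
  shows "(\<Sum>t\<in>T. w t * (x t)\<^sup>2) \<le> 2 * (ln (\<Sum>t\<in>T. w t * exp (x t)))\<^sup>2 + 4"
proof -
  define B where "B = (\<Sum>t\<in>T. w t * exp (x t))"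
  have B: "0 < B" using avg_le_ln_avg_exp(2)[OF assms(1-3)] unfolding B_def .
  have "(x t)\<^sup>2 \<le> 2 * (ln B)\<^sup>2 + 4 * (exp (x t) / B)" if "t \<in> T" for t
  proof (cases "x t \<le> ln B")
    case True
    then have "(x t)\<^sup>2 \<le> (ln B)\<^sup>2" using x[OF that] by (intro power_mono) auto
    moreover have "0 \<le> (ln B)\<^sup>2" "0 \<le> exp (x t) / B" using B by auto
    ultimately show ?thesis by linarith
  next
    case False
    define y where "y = x t - ln B"
    have y: "y \<ge> 0" using False by (simp add: y_def)
    have "exp y = exp (x t) / B" using B by (simp add: y_def exp_diff)
    moreover have "y\<^sup>2 \<le> 2 * exp y" using exp_lower_Taylor_quadratic[OF y] y by (simp add: field_simps)
    moreover have "(x t)\<^sup>2 \<le> 2 * (ln B)\<^sup>2 + 2 * y\<^sup>2"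
      using zero_le_power2[of "y - ln B"] by (simp add: y_def power2_eq_square algebra_simps)
    ultimately show ?thesis by linarith
  qed
  then have "(\<Sum>t\<in>T. w t * (x t)\<^sup>2) \<le> (\<Sum>t\<in>T. w t * (2 * (ln B)\<^sup>2 + 4 * (exp (x t) / B)))"
    using w by (intro sum_mono mult_left_mono) auto
  also have "\<dots> = sum w T * (2 * (ln B)\<^sup>2) + 4 * ((\<Sum>t\<in>T. w t * exp (x t)) / B)"
    by (simp add: algebra_simps sum.distrib sum_distrib_left sum_distrib_right sum_divide_distrib)
  finally show ?thesis using B sum_w unfolding B_def[symmetric] by simp
qed

text \<open>The error \<open>h\<^sup>2 * K\<close> disappears in the limit, so \<open>K\<close> (which depends on \<open>N\<close> in the application)
  does not enter the bound.\<close>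
lemma gronwall_one_step:
  fixes a :: "real \<Rightarrow> real"
  assumes step: "\<And>b h. 0 \<le> b \<Longrightarrow> 0 \<le> h \<Longrightarrow> b + h \<le> b0 \<Longrightarrow> a (b + h) \<le> a b + h * (\<alpha> + \<gamma> * a b) + h\<^sup>2 * K"
    and "0 \<le> b0" "0 < \<gamma>" "0 \<le> \<alpha>" "0 \<le> K" "0 \<le> a 0"
  shows "a b0 \<le> exp (\<gamma> * b0) * (a 0 + \<alpha> / \<gamma>)"
proof -
  have *: "a b0 \<le> exp (\<gamma> * b0) * (a 0 + \<alpha> / \<gamma>) + exp (\<gamma> * b0) * (b0 * K / \<gamma>) / real (Suc m)" for m
  proof -
    define h where "h = b0 / real (Suc m)"
    \<comment> \<open>The shift that turns the affine recursion for \<open>a\<close> along the grid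
      of mesh \<open>h\<close> into a geometric one for \<open>a + c\<close>.\<close>
    define c where "c = (\<alpha> + h * K) / \<gamma>"
    have h: "0 \<le> h" "real (Suc m) * h = b0" using assms(2) by (auto simp: h_def)
    have c: "c \<ge> 0" using assms h by (simp add: c_def)
    have "a (real k * h) + c \<le> (1 + h * \<gamma>) ^ k * (a 0 + c)" if "k \<le> Suc m" for k
      using that
    proof (induction k)
      case (Suc k)
      have "real k * h + h \<le> b0"
        using Suc.prems h mult_right_mono[of "real (Suc k)" "real (Suc m)" h] by (simp add: algebra_simps)
      then have "a (real (Suc k) * h) \<le> a (real k * h) + h * (\<alpha> + \<gamma> * a (real k * h)) + h\<^sup>2 * K"
        using step[of "real k * h" h] h by (simp add: algebra_simps)
      moreover have "(1 + h * \<gamma>) * (A + c) = A + c + h * (\<gamma> * A) + h * (\<gamma> * c)" for A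
        by (simp add: algebra_simps)
      moreover have "\<gamma> * c = \<alpha> + h * K" using assms(3) by (simp add: c_def)
      ultimately have "a (real (Suc k) * h) + c \<le> (1 + h * \<gamma>) * (a (real k * h) + c)"
        by (simp add: power2_eq_square algebra_simps)
      also have "\<dots> \<le> (1 + h * \<gamma>) * ((1 + h * \<gamma>) ^ k * (a 0 + c))"
        using Suc h assms(3) by (intro mult_left_mono) auto
      finally show ?case by (simp add: mult_ac)
    qed simp
    from this[of "Suc m"] have "a b0 + c \<le> (1 + h * \<gamma>) ^ Suc m * (a 0 + c)" by (simp only: h(2))
    also have "(1 + h * \<gamma>) ^ Suc m \<le> exp (h * \<gamma>) ^ Suc m"
      using h assms(3) by (intro power_mono exp_ge_add_one_self) auto
    then have "(1 + h * \<gamma>) ^ Suc m * (a 0 + c) \<le> exp (h * \<gamma>) ^ Suc m * (a 0 + c)"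
      using c assms(6) by (intro mult_right_mono) auto
    also have "exp (h * \<gamma>) ^ Suc m = exp (\<gamma> * b0)"
      unfolding h(2)[symmetric] by (simp add: exp_of_nat_mult[symmetric] mult_ac del: power_Suc of_nat_Suc)
    finally have "a b0 \<le> exp (\<gamma> * b0) * (a 0 + c)" using c by linarith
    then show ?thesis by (simp add: c_def h_def add_divide_distrib distrib_left algebra_simps)
  qed
  have "(\<lambda>m. exp (\<gamma> * b0) * (a 0 + \<alpha> / \<gamma>) + exp (\<gamma> * b0) * (b0 * K / \<gamma>) / real (Suc m)) \<longlonglongrightarrow> exp (\<gamma> * b0) * (a 0 + \<alpha> / \<gamma>) + 0"
    by (intro tendsto_add tendsto_const LIMSEQ_Suc[OF lim_const_over_n])
  then show ?thesis using * by (intro LIMSEQ_le_const[of _ _ "a b0"]) auto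
qed

section \<open>The negative part of the normalized log partition function\<close>

context gaussian_gibbs
begin

abbreviation n :: real where "n \<equiv> real (card I)"

lemma sum_delta_S': "\<sigma> \<in> S \<Longrightarrow> (\<Sum>\<tau>\<in>S. f \<tau> * of_bool (\<tau> = \<sigma>)) = (f \<sigma> :: real)"
  using sum_delta_S[of \<sigma> f] by (simp add: eq_commute)

text \<open>The subtracted terms form the logarithm of the expected partition function
  \<open>card S * exp (b\<^sup>2 * n / 2)\<close>, since every energy has variance
  \<open>n\<close>.\<close>

definition L :: "real \<Rightarrow> ('i \<Rightarrow> real) \<Rightarrow> real" where
  "L b g = ln (Z b g) - ln (real (card S)) - b\<^sup>2 * n / 2"

lemma card_S_pos: "real (card S) > 0"
  using finite_S S_nonempty by (simp add: card_gt_0_iff)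

lemma L_measurable [measurable]: "L b \<in> borel_measurable G"
  unfolding L_def[abs_def] by measurable

lemma Z_conv_L: "Z b g = exp (L b g) * (real (card S) * exp (b\<^sup>2 * n / 2))"
  using Z_pos[of b g] card_S_pos by (simp add: L_def exp_diff)

lemma xderiv_L: "xderiv (L b) (\<lambda>\<tau>. b * p b g \<tau>) g"
proof -
  have "xderiv (\<lambda>g. (\<lambda>z. ln z - ln (real (card S)) - b\<^sup>2 * n / 2) (Z b g)) (\<lambda>\<tau>. (1 / Z b g) * (b * exp (b * X g \<tau>))) g"
    using Z_pos[of b g] by (intro xderiv_comp[OF _ xderiv_Z]) (auto intro!: derivative_eq_intros)
  then show ?thesis unfolding L_def[abs_def] by (simp add: p_def)
qed

lemma abs_L_le: assumes "\<bar>b\<bar> \<le> b0" shows "\<bar>L b g\<bar> \<le> (b0 + b0\<^sup>2 * n / 2) * growth g"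
proof -
  have X: "\<bar>b * X g \<sigma>\<bar> \<le> b0 * growth g" if "\<sigma> \<in> S" for \<sigma>
    unfolding abs_mult using assms abs_X_le[OF that, of g] by (intro mult_mono) auto
  then have X: "- (b0 * growth g) \<le> b * X g \<sigma>" "b * X g \<sigma> \<le> b0 * growth g" if "\<sigma> \<in> S" for \<sigma>
    using that by (auto simp: abs_le_iff dest: minus_le_iff[THEN iffD1])
  have "Z b g \<le> (\<Sum>\<sigma>\<in>S. exp (b0 * growth g))"
    unfolding Z_def using X by (intro sum_mono) auto
  then have "ln (Z b g) \<le> ln (real (card S) * exp (b0 * growth g))"
    using Z_pos[of b g] card_S_pos by simp
  moreover have "Z b g \<ge> (\<Sum>\<sigma>\<in>S. exp (- (b0 * growth g)))"
    unfolding Z_def using X by (intro sum_mono) auto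
  then have "ln (Z b g) \<ge> ln (real (card S) * exp (- (b0 * growth g)))"
    using Z_pos[of b g] card_S_pos by simp
  ultimately have "\<bar>ln (Z b g) - ln (real (card S))\<bar> \<le> b0 * growth g"
    using card_S_pos by (simp add: ln_mult abs_le_iff)
  moreover have "b\<^sup>2 * n / 2 \<le> b0\<^sup>2 * n / 2 * growth g"
  proof -
    have "b\<^sup>2 \<le> b0\<^sup>2" using assms by (metis abs_ge_zero power2_abs power_mono)
    then have "b\<^sup>2 * n / 2 \<le> b0\<^sup>2 * n / 2" by (simp add: mult_right_mono)
    also have "\<dots> \<le> b0\<^sup>2 * n / 2 * growth g" using mult_left_mono[OF growth_ge_1[of g], of "b0\<^sup>2 * n / 2"] by simp
    finally show ?thesis .
  qed
  moreover have "0 \<le> b\<^sup>2 * n / 2" by simp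
  ultimately show ?thesis unfolding L_def abs_le_iff by (simp only: algebra_simps) linarith
qed

definition pair_exp :: "real \<Rightarrow> real \<Rightarrow> ('i \<Rightarrow> real) \<Rightarrow> real" where
  "pair_exp \<eta> b g = (\<Sum>\<sigma>\<in>S. \<Sum>\<tau>\<in>S. p b g \<sigma> * p b g \<tau> * exp (\<eta> * q \<sigma> \<tau>))"

definition mean_q :: "real \<Rightarrow> ('i \<Rightarrow> real) \<Rightarrow> real" where
  "mean_q b g = (\<Sum>\<sigma>\<in>S. \<Sum>\<tau>\<in>S. p b g \<sigma> * p b g \<tau> * q \<sigma> \<tau>)"

lemma pair_measurable [measurable]:
  "pair_exp \<eta> b \<in> borel_measurable G" "mean_q b \<in> borel_measurable G"
  unfolding pair_exp_def[abs_def] mean_q_def[abs_def] by measurable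

text \<open>The two replicas are independent given the disorder, so exchanging sums exhibits a sum
  of squares of one-replica averages. In \<open>drift_bound\<close> this makes the majorant
  nonnegative, as \<open>integral_mono'\<close> requires.\<close>

lemma mean_q_nonneg: "0 \<le> mean_q b g"
proof -
  have "mean_q b g = (\<Sum>k\<in>I. (\<Sum>\<sigma>\<in>S. p b g \<sigma> * e \<sigma> k)\<^sup>2)"
    unfolding mean_q_def q_def power2_eq_square
    by (simp add: sum_product sum_distrib_left sum_distrib_right sum.swap[of _ I S] mult_ac)
  then show ?thesis by (simp add: sum_nonneg)
qed

lemma sum_pp: "(\<Sum>\<sigma>\<in>S. \<Sum>\<tau>\<in>S. p b g \<sigma> * p b g \<tau>) = 1"
  by (simp add: sum_distrib_left[symmetric] sum_p)

lemma avg_sum_pairs: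
  "(\<Sum>\<sigma>\<in>S. \<Sum>\<tau>\<in>S. p b g \<sigma> * p b g \<tau> * f \<sigma> \<tau>) = (\<Sum>t\<in>S \<times> S. (p b g (fst t) * p b g (snd t)) * f (fst t) (snd t))"
  by (simp add: sum.cartesian_product case_prod_beta)

lemma mean_q_le_ln: "\<eta> * mean_q b g \<le> ln (pair_exp \<eta> b g)" and pair_exp_pos: "0 < pair_exp \<eta> b g"
proof -
  have 1: "(\<Sum>t\<in>S \<times> S. p b g (fst t) * p b g (snd t)) = 1"
    using sum_pp[of b g] by (simp add: sum.cartesian_product case_prod_beta)
  note * = avg_le_ln_avg_exp[of "S \<times> S" "\<lambda>t. p b g (fst t) * p b g (snd t)" "\<lambda>t. \<eta> * q (fst t) (snd t)", OF _ _ 1]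
  have 2: "pair_exp \<eta> b g = (\<Sum>t\<in>S \<times> S. p b g (fst t) * p b g (snd t) * exp (\<eta> * q (fst t) (snd t)))"
    unfolding pair_exp_def by (rule avg_sum_pairs)
  have 3: "\<eta> * mean_q b g = (\<Sum>t\<in>S \<times> S. p b g (fst t) * p b g (snd t) * (\<eta> * q (fst t) (snd t)))"
    unfolding mean_q_def avg_sum_pairs by (simp add: sum_distrib_left mult_ac)
  show "\<eta> * mean_q b g \<le> ln (pair_exp \<eta> b g)" "0 < pair_exp \<eta> b g"
    unfolding 2 3 using * finite_S p_nonneg by simp_all
qed

lemma G_exp_X: "integrable G (\<lambda>g. exp (a * X g \<sigma>))"
  and G_exp_X': "\<sigma> \<in> S \<Longrightarrow> (\<integral>g. exp (a * X g \<sigma>) \<partial>G) = exp (a\<^sup>2 * n / 2)"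
proof -
  have eq: "exp (a * X g \<sigma>) = exp (\<Sum>k\<in>I. (a * e \<sigma> k) * g k)" for g
    by (simp add: X_def sum_distrib_left mult_ac)
  show "integrable G (\<lambda>g. exp (a * X g \<sigma>))" unfolding eq by (rule G_exp)
  show "(\<integral>g. exp (a * X g \<sigma>) \<partial>G) = exp (a\<^sup>2 * n / 2)" if "\<sigma> \<in> S"
    unfolding eq G_exp(2) using that e_square by (simp add: power_mult_distrib)
qed

lemma G_exp_XX: "integrable G (\<lambda>g. exp (b * X g \<sigma> + b * X g \<tau>))"
  and G_exp_XX': "\<sigma> \<in> S \<Longrightarrow> \<tau> \<in> S \<Longrightarrow> (\<integral>g. exp (b * X g \<sigma> + b * X g \<tau>) \<partial>G) = exp (b\<^sup>2 * n + b\<^sup>2 * q \<sigma> \<tau>)"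
proof -
  have eq: "exp (b * X g \<sigma> + b * X g \<tau>) = exp (\<Sum>k\<in>I. (b * (e \<sigma> k + e \<tau> k)) * g k)" for g
    by (simp add: X_def sum_distrib_left sum.distrib algebra_simps)
  show "integrable G (\<lambda>g. exp (b * X g \<sigma> + b * X g \<tau>))" unfolding eq by (rule G_exp)
  assume "\<sigma> \<in> S" "\<tau> \<in> S"
  moreover have "(b * (e \<sigma> k + e \<tau> k))\<^sup>2 = b\<^sup>2 * ((e \<sigma> k)\<^sup>2 + (e \<tau> k)\<^sup>2 + 2 * (e \<sigma> k * e \<tau> k))" for k
    by (simp add: power2_eq_square algebra_simps)
  ultimately have "(\<Sum>k\<in>I. (b * (e \<sigma> k + e \<tau> k))\<^sup>2) = (\<Sum>k\<in>I. 2 * b\<^sup>2 + 2 * b\<^sup>2 * (e \<sigma> k * e \<tau> k))"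
    by (intro sum.cong) (simp_all add: e_square algebra_simps)
  also have "\<dots> = 2 * (b\<^sup>2 * n + b\<^sup>2 * q \<sigma> \<tau>)"
    by (simp add: sum.distrib q_def sum_distrib_left algebra_simps)
  finally show "(\<integral>g. exp (b * X g \<sigma> + b * X g \<tau>) \<partial>G) = exp (b\<^sup>2 * n + b\<^sup>2 * q \<sigma> \<tau>)"
    unfolding eq G_exp(2) by simp
qed

text \<open>The weight \<open>exp (2 * L b g)\<close> is \<open>Z\<^sup>2\<close> over a constant
  and cancels the denominators of both Gibbs weights. What remains is a sum of exponentials of
  Gaussian variables, whose expectation depends on the replicas only through
  \<open>q\<close>.\<close>

lemma pair_exp_weighted:
  "integrable G (\<lambda>g. exp (2 * L b g) * pair_exp \<eta> b g)"
  "(\<integral>g. exp (2 * L b g) * pair_exp \<eta> b g \<partial>G) = (\<Sum>\<sigma>\<in>S. \<Sum>\<tau>\<in>S. exp ((b\<^sup>2 + \<eta>) * q \<sigma> \<tau>)) / (real (card S))\<^sup>2"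
proof -
  define c where "c = real (card S) * exp (b\<^sup>2 * n / 2)"
  have c: "c > 0" using card_S_pos by (simp add: c_def)
  have eq: "exp (2 * L b g) * pair_exp \<eta> b g =
      (\<Sum>\<sigma>\<in>S. \<Sum>\<tau>\<in>S. exp (\<eta> * q \<sigma> \<tau>) / c\<^sup>2 * exp (b * X g \<sigma> + b * X g \<tau>))" for g
  proof -
    have Lc: "exp (2 * L b g) = (Z b g)\<^sup>2 / c\<^sup>2"
      using Z_conv_L[of b g] c unfolding c_def[symmetric] by (simp add: power_mult_distrib exp_double)
    have "exp (2 * L b g) * (p b g \<sigma> * p b g \<tau> * exp (\<eta> * q \<sigma> \<tau>)) = exp (\<eta> * q \<sigma> \<tau>) / c\<^sup>2 * exp (b * X g \<sigma> + b * X g \<tau>)" for \<sigma> \<tau>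
    proof -
      have "(Z b g)\<^sup>2 * (p b g \<sigma> * p b g \<tau>) = exp (b * X g \<sigma> + b * X g \<tau>)"
        using Z_pos[of b g] by (simp add: p_def power2_eq_square exp_add)
      moreover have "exp (2 * L b g) * (p b g \<sigma> * p b g \<tau> * exp (\<eta> * q \<sigma> \<tau>)) = exp (\<eta> * q \<sigma> \<tau>) / c\<^sup>2 * ((Z b g)\<^sup>2 * (p b g \<sigma> * p b g \<tau>))"
        unfolding Lc by simp
      ultimately show ?thesis by simp
    qed
    then show ?thesis unfolding pair_exp_def sum_distrib_left by simp
  qed
  show "integrable G (\<lambda>g. exp (2 * L b g) * pair_exp \<eta> b g)"
    unfolding eq by (intro Bochner_Integration.integrable_sum integrable_mult_right G_exp_XX)
  have "(\<integral>g. exp (2 * L b g) * pair_exp \<eta> b g \<partial>G) = (\<Sum>\<sigma>\<in>S. \<Sum>\<tau>\<in>S. exp (\<eta> * q \<sigma> \<tau>) / c\<^sup>2 * exp (b\<^sup>2 * n + b\<^sup>2 * q \<sigma> \<tau>))"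
    unfolding eq
    by (simp add: Bochner_Integration.integral_sum Bochner_Integration.integrable_sum G_exp_XX G_exp_XX')
  also have "\<dots> = (\<Sum>\<sigma>\<in>S. \<Sum>\<tau>\<in>S. exp ((b\<^sup>2 + \<eta>) * q \<sigma> \<tau>)) / (real (card S))\<^sup>2"
  proof -
    have "c\<^sup>2 = (real (card S))\<^sup>2 * exp (b\<^sup>2 * n)"
      unfolding c_def by (simp add: power_mult_distrib exp_double[symmetric])
    then have "exp (\<eta> * q \<sigma> \<tau>) / c\<^sup>2 * exp (b\<^sup>2 * n + b\<^sup>2 * q \<sigma> \<tau>) = exp ((b\<^sup>2 + \<eta>) * q \<sigma> \<tau>) / (real (card S))\<^sup>2" for \<sigma> \<tau>
      by (simp add: exp_add distrib_right)
    then show ?thesis by (simp add: sum_divide_distrib)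
  qed
  finally show "(\<integral>g. exp (2 * L b g) * pair_exp \<eta> b g \<partial>G) = (\<Sum>\<sigma>\<in>S. \<Sum>\<tau>\<in>S. exp ((b\<^sup>2 + \<eta>) * q \<sigma> \<tau>)) / (real (card S))\<^sup>2" .
qed

definition mean_X :: "real \<Rightarrow> ('i \<Rightarrow> real) \<Rightarrow> real" where
  "mean_X b g = (\<Sum>\<sigma>\<in>S. p b g \<sigma> * X g \<sigma>)"

lemma mean_X_measurable [measurable]: "mean_X b \<in> borel_measurable G"
  unfolding mean_X_def[abs_def] by measurable

lemma avg_bound:
  assumes "\<And>\<sigma>. \<sigma> \<in> S \<Longrightarrow> \<bar>a \<sigma>\<bar> \<le> c"
  shows "\<bar>\<Sum>\<sigma>\<in>S. p b g \<sigma> * a \<sigma>\<bar> \<le> c"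
proof -
  have "\<bar>\<Sum>\<sigma>\<in>S. p b g \<sigma> * a \<sigma>\<bar> \<le> (\<Sum>\<sigma>\<in>S. p b g \<sigma> * c)"
    using assms p_nonneg by (intro order.trans[OF sum_abs] sum_mono) (auto simp: abs_mult intro!: mult_left_mono)
  then show ?thesis by (simp add: sum_distrib_right[symmetric] sum_p)
qed

lemma abs_mean_X_le: "\<bar>mean_X b g\<bar> \<le> growth g"
  unfolding mean_X_def by (rule avg_bound) (rule abs_X_le)

text \<open>Convexity of \<open>ln Z\<close> in \<open>b\<close> replaces differentiation under the integral sign.\<close>
lemma L_step: "L b g + (h * (mean_X b g - b * n) - h\<^sup>2 * n / 2) \<le> L (b + h) g"
proof -
  have Z: "Z (b + h) g = Z b g * (\<Sum>\<sigma>\<in>S. p b g \<sigma> * exp (h * X g \<sigma>))"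
    unfolding Z_def[of "b + h"] sum_distrib_left
    using Z_pos[of b g] by (intro sum.cong refl) (simp add: p_def exp_add distrib_right)
  have "h * mean_X b g \<le> ln (\<Sum>\<sigma>\<in>S. p b g \<sigma> * exp (h * X g \<sigma>))"
    using avg_le_ln_avg_exp(1)[OF finite_S p_nonneg sum_p, of b g "\<lambda>\<sigma>. h * X g \<sigma>"]
    by (simp add: mean_X_def sum_distrib_left mult_ac)
  moreover have "0 < (\<Sum>\<sigma>\<in>S. p b g \<sigma> * exp (h * X g \<sigma>))"
    using avg_le_ln_avg_exp(2)[OF finite_S p_nonneg sum_p, of b g "\<lambda>\<sigma>. h * X g \<sigma>"] .
  ultimately have "ln (Z b g) + h * mean_X b g \<le> ln (Z (b + h) g)"
    unfolding Z using Z_pos[of b g] by (simp add: ln_mult)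
  then show ?thesis by (simp add: L_def power2_eq_square algebra_simps add_divide_distrib)
qed

text \<open>To first order in \<open>b\<close>, \<open>L\<close> moves by
  \<open>mean_X b g - b * n\<close>, so this is the derivative of the expected
  \<open>softplus\<^sup>2\<close> of \<open>L\<close>. In the integration by parts the diagonal
  \<open>q \<sigma> \<sigma> = n\<close> cancels \<open>b * n\<close>. Differentiating the
  normalization of the Gibbs weight leaves \<open>- softplus_sq_d1\<close>, and differentiating
  along \<open>L\<close> leaves \<open>softplus_sq_d2\<close>, each times
  \<open>mean_q\<close>.\<close>

lemma softplus_sq_d1_ibp:
  "integrable G (\<lambda>g. softplus_sq_d1 (L b g) * (mean_X b g - b * n))"
  "(\<integral>g. softplus_sq_d1 (L b g) * (mean_X b g - b * n) \<partial>G) = b * (\<integral>g. mean_q b g * (softplus_sq_d2 (L b g) - softplus_sq_d1 (L b g)) \<partial>G)"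
proof -
  define cL where "cL = \<bar>b\<bar> + \<bar>b\<bar>\<^sup>2 * n / 2"
  have cL: "cL \<ge> 0" "\<bar>L b g\<bar> \<le> cL * growth g" for g using abs_L_le[of b "\<bar>b\<bar>" g] by (auto simp: cL_def)
  define c where "c = 2 * (1 + cL)"
  have c: "c \<ge> 0" and s1: "\<bar>softplus_sq_d1 (L b g)\<bar> \<le> c * growth g" for g
  proof -
    show "c \<ge> 0" using cL by (simp add: c_def)
    have "\<bar>softplus_sq_d1 (L b g)\<bar> \<le> 2 * softplus (L b g)" using softplus_sq_d1_bounds[of "L b g"] by auto
    also have "\<dots> \<le> 2 * (1 + cL * growth g)" using softplus_le[of "L b g"] cL(2)[of g] by simp
    also have "\<dots> \<le> 2 * (growth g + cL * growth g)" using growth_ge_1[of g] by simp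
    finally show "\<bar>softplus_sq_d1 (L b g)\<bar> \<le> c * growth g" by (simp add: c_def algebra_simps)
  qed
  define K where "K \<sigma> g \<tau> = b * p b g \<sigma> * (of_bool (\<tau> = \<sigma>) - p b g \<tau>) * softplus_sq_d1 (L b g) + p b g \<sigma> * (softplus_sq_d2 (L b g) * (b * p b g \<tau>))" for \<sigma> g \<tau>
  define A where "A = c + \<bar>b\<bar> * c + 4 * \<bar>b\<bar>"
  have ibp: "integrable G (\<lambda>g. X g \<sigma> * (p b g \<sigma> * softplus_sq_d1 (L b g)))"
    "(\<integral>g. X g \<sigma> * (p b g \<sigma> * softplus_sq_d1 (L b g)) \<partial>G) = (\<integral>g. (\<Sum>\<tau>\<in>S. q \<sigma> \<tau> * K \<sigma> g \<tau>) \<partial>G)"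
    and intK: "integrable G (\<lambda>g. (\<Sum>\<tau>\<in>S. q \<sigma> \<tau> * K \<sigma> g \<tau>))"
    if \<sigma>: "\<sigma> \<in> S" for \<sigma>
  proof -
    have Km [measurable]: "(\<lambda>g. K \<sigma> g \<tau>) \<in> borel_measurable G" for \<tau> unfolding K_def by measurable
    have xd: "xderiv (\<lambda>g. p b g \<sigma> * softplus_sq_d1 (L b g)) (K \<sigma> g) g" for g
      unfolding K_def using \<sigma> by (intro xderiv_mult xderiv_p xderiv_comp[OF softplus_sq_d1_deriv] xderiv_L) 
    have b1: "\<bar>p b g \<sigma> * softplus_sq_d1 (L b g)\<bar> \<le> A * growth g" for g
    proof -
      have "\<bar>p b g \<sigma> * softplus_sq_d1 (L b g)\<bar> \<le> 1 * (c * growth g)"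
        unfolding abs_mult using p_le_1[OF \<sigma>, of b g] p_nonneg[of b g \<sigma>] s1[of g] by (intro mult_mono) auto
      also have "\<dots> \<le> A * growth g" unfolding A_def mult_1 using c growth_ge_1[of g] by (intro mult_right_mono) auto
      finally show ?thesis .
    qed
    have b2: "\<bar>K \<sigma> g \<tau>\<bar> \<le> A * growth g" if \<tau>: "\<tau> \<in> S" for g \<tau>
    proof -
      have "\<bar>K \<sigma> g \<tau>\<bar> \<le> \<bar>b\<bar> * (\<bar>p b g \<sigma>\<bar> * (\<bar>of_bool (\<tau> = \<sigma>) - p b g \<tau>\<bar> * \<bar>softplus_sq_d1 (L b g)\<bar>)) + \<bar>p b g \<sigma>\<bar> * (\<bar>softplus_sq_d2 (L b g)\<bar> * (\<bar>b\<bar> * \<bar>p b g \<tau>\<bar>))"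
        unfolding K_def by (rule order.trans[OF abs_triangle_ineq]) (simp add: abs_mult mult_ac)
      also have "\<dots> \<le> \<bar>b\<bar> * (1 * (1 * (c * growth g))) + 1 * (4 * (\<bar>b\<bar> * 1))"
        using p_le_1[OF \<sigma>, of b g] p_nonneg[of b g \<sigma>] p_le_1[OF \<tau>, of b g] p_nonneg[of b g \<tau>] s1[of g] softplus_sq_d2_bounds[of "L b g"] c growth_ge_1[of g]
        by (intro add_mono mult_mono) auto
      also have "\<dots> \<le> \<bar>b\<bar> * c * growth g + 4 * \<bar>b\<bar> * growth g + c * growth g"
        using growth_ge_1[of g] mult_nonneg_nonneg[OF c, of "growth g"] mult_left_mono[OF growth_ge_1[of g], of "4 * \<bar>b\<bar>"] by simp
      finally show ?thesis by (simp add: A_def algebra_simps)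
    qed
    show "integrable G (\<lambda>g. X g \<sigma> * (p b g \<sigma> * softplus_sq_d1 (L b g)))"
      "(\<integral>g. X g \<sigma> * (p b g \<sigma> * softplus_sq_d1 (L b g)) \<partial>G) = (\<integral>g. (\<Sum>\<tau>\<in>S. q \<sigma> \<tau> * K \<sigma> g \<tau>) \<partial>G)"
      by (rule ibp[OF \<sigma> _ Km xd b1 b2]; (measurable | assumption))+
    show "integrable G (\<lambda>g. (\<Sum>\<tau>\<in>S. q \<sigma> \<tau> * K \<sigma> g \<tau>))"
      by (intro Bochner_Integration.integrable_sum integrable_mult_right integrable_growth_bound[OF Km b2])
  qed
  have eq1: "softplus_sq_d1 (L b g) * mean_X b g = (\<Sum>\<sigma>\<in>S. X g \<sigma> * (p b g \<sigma> * softplus_sq_d1 (L b g)))" for g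
    by (simp add: mean_X_def sum_distrib_left mult_ac)
  have int1: "integrable G (\<lambda>g. softplus_sq_d1 (L b g) * mean_X b g)"
    unfolding eq1 by (intro Bochner_Integration.integrable_sum ibp)
  have int2: "integrable G (\<lambda>g. softplus_sq_d1 (L b g))" by (rule integrable_growth_bound[OF _ s1]) simp
  have eq3: "softplus_sq_d1 (L b g) * (mean_X b g - b * n) = softplus_sq_d1 (L b g) * mean_X b g - b * n * softplus_sq_d1 (L b g)" for g
    by (simp add: algebra_simps)
  show "integrable G (\<lambda>g. softplus_sq_d1 (L b g) * (mean_X b g - b * n))"
    using int1 int2 by (simp add: right_diff_distrib)
  have eq2: "(\<Sum>\<sigma>\<in>S. \<Sum>\<tau>\<in>S. q \<sigma> \<tau> * K \<sigma> g \<tau>) = b * n * softplus_sq_d1 (L b g) + b * (mean_q b g * (softplus_sq_d2 (L b g) - softplus_sq_d1 (L b g)))" for g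
  proof -
    have "(\<Sum>\<sigma>\<in>S. \<Sum>\<tau>\<in>S. q \<sigma> \<tau> * K \<sigma> g \<tau>) =
      (\<Sum>\<sigma>\<in>S. \<Sum>\<tau>\<in>S. (b * p b g \<sigma> * softplus_sq_d1 (L b g) * q \<sigma> \<tau>) * of_bool (\<tau> = \<sigma>) + b * (softplus_sq_d2 (L b g) - softplus_sq_d1 (L b g)) * (p b g \<sigma> * p b g \<tau> * q \<sigma> \<tau>))"
      by (intro sum.cong refl) (simp add: K_def algebra_simps)
    also have "\<dots> = (\<Sum>\<sigma>\<in>S. b * p b g \<sigma> * softplus_sq_d1 (L b g) * q \<sigma> \<sigma>) + b * (softplus_sq_d2 (L b g) - softplus_sq_d1 (L b g)) * mean_q b g"
      unfolding sum.distrib mean_q_def sum_distrib_left by (simp only: sum_delta_S' cong: sum.cong)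
    also have "(\<Sum>\<sigma>\<in>S. b * p b g \<sigma> * softplus_sq_d1 (L b g) * q \<sigma> \<sigma>) = (\<Sum>\<sigma>\<in>S. p b g \<sigma>) * (b * softplus_sq_d1 (L b g) * n)"
      unfolding sum_distrib_right by (intro sum.cong refl) (simp add: q_diag)
    finally show ?thesis by (simp add: sum_p algebra_simps)
  qed
  have int3: "integrable G (\<lambda>g. b * (mean_q b g * (softplus_sq_d2 (L b g) - softplus_sq_d1 (L b g))))"
  proof -
    have "integrable G (\<lambda>g. \<Sum>\<sigma>\<in>S. \<Sum>\<tau>\<in>S. q \<sigma> \<tau> * K \<sigma> g \<tau>)" by (rule Bochner_Integration.integrable_sum) (rule intK)
    then have "integrable G (\<lambda>g. (b * n * softplus_sq_d1 (L b g) + b * (mean_q b g * (softplus_sq_d2 (L b g) - softplus_sq_d1 (L b g)))) - b * n * softplus_sq_d1 (L b g))"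
      unfolding eq2 using int2 by (intro Bochner_Integration.integrable_diff integrable_mult_right)
    then show ?thesis by simp
  qed
  have "(\<integral>g. softplus_sq_d1 (L b g) * mean_X b g \<partial>G) = (\<Sum>\<sigma>\<in>S. \<integral>g. (\<Sum>\<tau>\<in>S. q \<sigma> \<tau> * K \<sigma> g \<tau>) \<partial>G)"
    unfolding eq1 using ibp by (subst Bochner_Integration.integral_sum) (auto intro!: sum.cong)
  also have "\<dots> = (\<integral>g. (\<Sum>\<sigma>\<in>S. \<Sum>\<tau>\<in>S. q \<sigma> \<tau> * K \<sigma> g \<tau>) \<partial>G)"
    by (rule Bochner_Integration.integral_sum[symmetric]) (rule intK)
  also have "\<dots> = b * n * (\<integral>g. softplus_sq_d1 (L b g) \<partial>G) + b * (\<integral>g. mean_q b g * (softplus_sq_d2 (L b g) - softplus_sq_d1 (L b g)) \<partial>G)"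
    unfolding eq2 using int2 int3 by simp
  finally show "(\<integral>g. softplus_sq_d1 (L b g) * (mean_X b g - b * n) \<partial>G) = b * (\<integral>g. mean_q b g * (softplus_sq_d2 (L b g) - softplus_sq_d1 (L b g)) \<partial>G)"
    using int1 int2 unfolding eq3 by simp
qed


text \<open>Inserting the weight \<open>exp (j * L b g)\<close> under the logarithm costs
  \<open>- j * L b g\<close>, which is at most \<open>j\<close> times the smoothed negative part.
  The exponent \<open>j\<close> counts replicas: \<open>2\<close> for overlaps, \<open>1\<close> for
  the energy.\<close>

lemma ln_le_ln_weighted:
  assumes "0 < A" "0 \<le> j" "j \<le> 2"
  shows "ln A \<le> ln (1 + exp (j * L b g) * A) + 2 * softplus (L b g)"
proof -
  have "ln A = ln (exp (j * L b g) * A) - j * L b g" using assms(1) by (simp add: ln_mult)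
  moreover have "ln (exp (j * L b g) * A) \<le> ln (1 + exp (j * L b g) * A)"
    using assms(1) by (subst ln_le_cancel_iff) (auto intro: add_pos_pos)
  moreover have "- (j * L b g) \<le> 2 * softplus (L b g)"
  proof -
    have "j * (- L b g) \<le> j * softplus (L b g)" using assms(2) softplus_ge[of "L b g"] by (intro mult_left_mono) auto
    also have "\<dots> \<le> 2 * softplus (L b g)" using assms(3) softplus_pos[of "L b g"] by (intro mult_right_mono) auto
    finally show ?thesis by simp
  qed
  ultimately show ?thesis by linarith
qed

lemma softplus_L_growth: 
  assumes "\<bar>b\<bar> \<le> b0"
  shows "softplus (L b g) \<le> (1 + (b0 + b0\<^sup>2 * n / 2)) * growth g"
  using softplus_le[of "L b g"] abs_L_le[OF assms, of g] growth_ge_1[of g] by (simp add: algebra_simps)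

lemma softplus_L_integrable: "integrable G (\<lambda>g. (softplus (L b g))\<^sup>2)"
proof (rule integrable_growth_square_bound)
  fix g
  have "(softplus (L b g))\<^sup>2 \<le> ((1 + (\<bar>b\<bar> + \<bar>b\<bar>\<^sup>2 * n / 2)) * growth g)\<^sup>2"
    using softplus_L_growth[of b "\<bar>b\<bar>" g] softplus_pos[of "L b g"] by (intro power_mono) auto
  then show "\<bar>(softplus (L b g))\<^sup>2\<bar> \<le> (1 + (\<bar>b\<bar> + \<bar>b\<bar>\<^sup>2 * n / 2))\<^sup>2 * (growth g)\<^sup>2"
    by (simp add: power_mult_distrib)
qed measurable

text \<open>Jensen bounds \<open>\<eta> * mean_q\<close> by \<open>l + 2 * s\<close> and the other
  factor is at most \<open>4 + 2 * s\<close>, where \<open>s\<close> is the smoothed negative part.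
  Their product is quadratic in \<open>s\<close>, so the drift is affine in the very moment that is
  being estimated.\<close>

lemma drift_bound:
  assumes \<eta>: "0 < \<eta>" and C: "(\<integral>g. exp (2 * L b g) * pair_exp \<eta> b g \<partial>G) \<le> C"
  shows "(\<integral>g. mean_q b g * (softplus_sq_d2 (L b g) - softplus_sq_d1 (L b g)) \<partial>G)
    \<le> (6 + 12 * C + 9 * (\<integral>g. (softplus (L b g))\<^sup>2 \<partial>G)) / \<eta>"
proof -
  interpret prob_space G by (rule prob_space_G)
  have pw: "mean_q b g * (softplus_sq_d2 (L b g) - softplus_sq_d1 (L b g))
    \<le> (6 + 12 * (exp (2 * L b g) * pair_exp \<eta> b g) + 9 * (softplus (L b g))\<^sup>2) / \<eta>" for g
  proof -
    define D where "D = exp (2 * L b g) * pair_exp \<eta> b g"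
    define l where "l = ln (1 + D)"
    define s where "s = softplus (L b g)"
    have D: "D \<ge> 0" using pair_exp_pos[of \<eta> b g] by (simp add: D_def)
    have s: "s > 0" using softplus_pos by (simp add: s_def)
    have l: "l \<ge> 0" "l\<^sup>2 \<le> 4 * D" using D ln_add_one_sq_le[OF D] by (auto simp: l_def)
    have "\<eta> * mean_q b g \<le> l + 2 * s"
      using mean_q_le_ln[of \<eta> b g] ln_le_ln_weighted[OF pair_exp_pos, of 2 \<eta> b g b g]
      by (simp add: l_def s_def D_def)
    moreover have "softplus_sq_d2 (L b g) - softplus_sq_d1 (L b g) \<le> 4 + 2 * s" "0 \<le> softplus_sq_d2 (L b g) - softplus_sq_d1 (L b g)"
      using softplus_sq_d2_bounds[of "L b g"] softplus_sq_d1_bounds[of "L b g"] by (auto simp: s_def)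
    ultimately have "(\<eta> * mean_q b g) * (softplus_sq_d2 (L b g) - softplus_sq_d1 (L b g)) \<le> (l + 2 * s) * (4 + 2 * s)"
      using l s by (intro mult_mono) auto
    also have "\<dots> \<le> 6 + 3 * l\<^sup>2 + 9 * s\<^sup>2"
    proof -
      \<comment> \<open>This sum of squares is the origin of \<open>6\<close>, \<open>3\<close> and
        \<open>9\<close>; the bound \<open>l\<^sup>2 \<le> 4 * D\<close> then turns \<open>3\<close>
        into \<open>12\<close>.\<close>
      have "6 + 3 * l\<^sup>2 + 9 * s\<^sup>2 - (l + 2 * s) * (4 + 2 * s) = (l - s)\<^sup>2 + 2 * (l - 1)\<^sup>2 + 4 * (s - 1)\<^sup>2"
        by (simp add: power2_eq_square algebra_simps)
      moreover have "0 \<le> (l - s)\<^sup>2 + 2 * (l - 1)\<^sup>2 + 4 * (s - 1)\<^sup>2" by simp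
      ultimately show ?thesis by linarith
    qed
    also have "\<dots> \<le> 6 + 12 * D + 9 * s\<^sup>2" using l by simp
    finally show ?thesis using \<eta> by (simp add: D_def s_def field_simps)
  qed
  have int: "integrable G (\<lambda>g. (6 + 12 * (exp (2 * L b g) * pair_exp \<eta> b g) + 9 * (softplus (L b g))\<^sup>2) / \<eta>)"
    using pair_exp_weighted(1)[of b \<eta>] softplus_L_integrable[of b] by simp
  have "(\<integral>g. mean_q b g * (softplus_sq_d2 (L b g) - softplus_sq_d1 (L b g)) \<partial>G)
    \<le> (\<integral>g. (6 + 12 * (exp (2 * L b g) * pair_exp \<eta> b g) + 9 * (softplus (L b g))\<^sup>2) / \<eta> \<partial>G)"
  proof (rule integral_mono'[OF int pw])
    fix g
    have "0 \<le> mean_q b g * (softplus_sq_d2 (L b g) - softplus_sq_d1 (L b g))"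
      using mean_q_nonneg[of b g] softplus_sq_d1_bounds(2)[of "L b g"] softplus_sq_d2_bounds(1)[of "L b g"] by (intro mult_nonneg_nonneg) auto
    then show "0 \<le> (6 + 12 * (exp (2 * L b g) * pair_exp \<eta> b g) + 9 * (softplus (L b g))\<^sup>2) / \<eta>"
      using pw[of g] by linarith
  qed
  also have "\<dots> = (6 + 12 * (\<integral>g. exp (2 * L b g) * pair_exp \<eta> b g \<partial>G) + 9 * (\<integral>g. (softplus (L b g))\<^sup>2 \<partial>G)) / \<eta>"
    using pair_exp_weighted(1)[of b \<eta>] softplus_L_integrable[of b] by (simp add: prob_space)
  also have "\<dots> \<le> (6 + 12 * C + 9 * (\<integral>g. (softplus (L b g))\<^sup>2 \<partial>G)) / \<eta>"
    using C \<eta> by (intro divide_right_mono) auto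
  finally show ?thesis .
qed

text \<open>\<open>softplus\<close> is decreasing, so the lower bound \<open>L_step\<close> on
  \<open>L\<close> gives an upper bound here, and Taylor's formula isolates the drift to first order
  in \<open>h\<close>. The second-order term is crude and depends on \<open>N\<close>, which
  \<open>gronwall_one_step\<close> tolerates.\<close>

lemma softplus_L_step:
  assumes b: "0 \<le> b" "0 \<le> h" "b + h \<le> b0"
  shows "(softplus (L (b + h) g))\<^sup>2 \<le> (softplus (L b g))\<^sup>2 + h * (softplus_sq_d1 (L b g) * (mean_X b g - b * n))
    + h\<^sup>2 * ((n * (1 + (b0 + b0\<^sup>2 * n / 2)) + 4 * (1 + 2 * b0 * n)\<^sup>2) * (growth g)\<^sup>2)"
proof -
  define Y where "Y = mean_X b g - b * n"
  define y where "y = h * Y - h\<^sup>2 * n / 2"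
  define c where "c = 1 + (b0 + b0\<^sup>2 * n / 2)"
  have b0: "b0 \<ge> 0" using b by simp
  have c: "c \<ge> 0" unfolding c_def using b0 by simp
  have "softplus (L (b + h) g) \<le> softplus (L b g + y)"
    using L_step[of b g h] by (intro softplus_antimono) (simp add: y_def Y_def)
  then have "(softplus (L (b + h) g))\<^sup>2 \<le> (softplus (L b g + y))\<^sup>2"
    using softplus_pos[of "L (b + h) g"] by (intro power_mono) auto
  also have "\<dots> \<le> (softplus (L b g))\<^sup>2 + softplus_sq_d1 (L b g) * y + 4 * y\<^sup>2" by (rule softplus_sq_taylor)
  also have "softplus_sq_d1 (L b g) * y \<le> h * (softplus_sq_d1 (L b g) * Y) + h\<^sup>2 * (n * c * (growth g)\<^sup>2)"
  proof -
    have "- softplus_sq_d1 (L b g) \<le> 2 * (c * growth g)"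
      using softplus_sq_d1_bounds(1)[of "L b g"] softplus_L_growth[of b b0 g] b by (simp add: c_def)
    also have "\<dots> \<le> 2 * (c * (growth g)\<^sup>2)" using c growth_le_square[of g] by (simp add: mult_left_mono)
    finally have "(h\<^sup>2 * n / 2) * (- softplus_sq_d1 (L b g)) \<le> (h\<^sup>2 * n / 2) * (2 * (c * (growth g)\<^sup>2))"
      by (intro mult_left_mono) auto
    then show ?thesis by (simp add: y_def algebra_simps)
  qed
  also have "4 * y\<^sup>2 \<le> h\<^sup>2 * (4 * (1 + 2 * b0 * n)\<^sup>2 * (growth g)\<^sup>2)"
  proof -
    have "\<bar>Y\<bar> \<le> growth g + b0 * n"
    proof -
      have "\<bar>b * n\<bar> \<le> b0 * n" using b by (simp add: abs_mult mult_right_mono)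
      then show ?thesis using abs_mean_X_le[of b g] by (auto simp: Y_def)
    qed
    moreover have "h * n / 2 \<le> b0 * n" using b mult_right_mono[of h "2 * b0" n] b0 by simp
    ultimately have "\<bar>Y\<bar> + h * n / 2 \<le> growth g + 2 * b0 * n" by simp
    also have "\<dots> \<le> (1 + 2 * b0 * n) * growth g"
      using mult_left_mono[OF growth_ge_1[of g], of "2 * b0 * n"] b0 by (simp add: algebra_simps)
    finally have "h * (\<bar>Y\<bar> + h * n / 2) \<le> h * ((1 + 2 * b0 * n) * growth g)" using b by (intro mult_left_mono)
    moreover have "\<bar>y\<bar> \<le> h * (\<bar>Y\<bar> + h * n / 2)"
    proof -
      have "\<bar>y\<bar> \<le> \<bar>h * Y\<bar> + \<bar>h\<^sup>2 * n / 2\<bar>" unfolding y_def by (rule abs_triangle_ineq4)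
      then show ?thesis using b by (simp add: abs_mult power2_eq_square algebra_simps)
    qed
    ultimately have "\<bar>y\<bar> \<le> h * ((1 + 2 * b0 * n) * growth g)" by linarith
    then have "\<bar>y\<bar>\<^sup>2 \<le> (h * ((1 + 2 * b0 * n) * growth g))\<^sup>2" by (intro power_mono) auto
    then show ?thesis by (simp add: power_mult_distrib mult_ac)
  qed
  finally show ?thesis unfolding Y_def c_def by (simp add: algebra_simps)
qed

text \<open>Gronwall with slope \<open>9 * b0 / \<eta>\<close>, taken from
  \<open>drift_bound\<close> with \<open>b \<le> b0\<close>, over an interval of length
  \<open>b0\<close>. If \<open>b0\<^sup>2\<close> and \<open>\<eta>\<close> are both of order
  \<open>1 / N\<close>, the bound does not depend on \<open>N\<close>.\<close>

theorem neg_log_partition_moment: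
  assumes \<eta>: "0 < \<eta>" and b0: "0 < b0"
    and C: "\<And>b. 0 \<le> b \<Longrightarrow> b \<le> b0 \<Longrightarrow> (\<integral>g. exp (2 * L b g) * pair_exp \<eta> b g \<partial>G) \<le> C"
  shows "(\<integral>g. (softplus (L b0 g))\<^sup>2 \<partial>G) \<le> exp (9 * b0\<^sup>2 / \<eta>) * (2 + 2 * C)"
proof -
  interpret prob_space G by (rule prob_space_G)
  define a where "a b = (\<integral>g. (softplus (L b g))\<^sup>2 \<partial>G)" for b
  define K0 where "K0 = n * (1 + (b0 + b0\<^sup>2 * n / 2)) + 4 * (1 + 2 * b0 * n)\<^sup>2"
  have a: "a b \<ge> 0" for b unfolding a_def by simp
  have K0: "K0 \<ge> 0" unfolding K0_def using b0 by simp
  have C0: "C \<ge> 0"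
  proof -
    have "0 \<le> (\<integral>g. exp (2 * L 0 g) * pair_exp \<eta> 0 g \<partial>G)"
      using pair_exp_pos[of \<eta> 0] by (intro Bochner_Integration.integral_nonneg) (simp add: less_imp_le)
    then show ?thesis using C[of 0] b0 by simp
  qed
  have "a b0 \<le> exp ((9 * b0 / \<eta>) * b0) * (a 0 + (b0 / \<eta> * (6 + 12 * C)) / (9 * b0 / \<eta>))"
  proof (rule gronwall_one_step[where K="K0 * (\<integral>g. (growth g)\<^sup>2 \<partial>G)"])
    fix b h :: real assume b: "0 \<le> b" "0 \<le> h" "b + h \<le> b0"
    have int: "integrable G (\<lambda>g. (softplus (L b g))\<^sup>2 + h * (softplus_sq_d1 (L b g) * (mean_X b g - b * n)) + h\<^sup>2 * (K0 * (growth g)\<^sup>2))"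
      using softplus_L_integrable softplus_sq_d1_ibp(1) integrable_growth_square
      by (intro Bochner_Integration.integrable_add integrable_mult_right) auto
    have "a (b + h) \<le> (\<integral>g. (softplus (L b g))\<^sup>2 + h * (softplus_sq_d1 (L b g) * (mean_X b g - b * n)) + h\<^sup>2 * (K0 * (growth g)\<^sup>2) \<partial>G)"
      unfolding a_def using softplus_L_step[OF b] softplus_L_integrable int
      by (intro integral_mono) (auto simp: K0_def)
    also have "\<dots> = a b + h * (\<integral>g. softplus_sq_d1 (L b g) * (mean_X b g - b * n) \<partial>G) + h\<^sup>2 * (K0 * (\<integral>g. (growth g)\<^sup>2 \<partial>G))"
      unfolding a_def using softplus_L_integrable softplus_sq_d1_ibp(1) integrable_growth_square
      by (simp add: Bochner_Integration.integral_add Bochner_Integration.integrable_add)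
    also have "(\<integral>g. softplus_sq_d1 (L b g) * (mean_X b g - b * n) \<partial>G) \<le> b0 / \<eta> * (6 + 12 * C) + 9 * b0 / \<eta> * a b"
    proof -
      have "b * (\<integral>g. mean_q b g * (softplus_sq_d2 (L b g) - softplus_sq_d1 (L b g)) \<partial>G) \<le> b * ((6 + 12 * C + 9 * a b) / \<eta>)"
        unfolding a_def using b C[of b] by (intro mult_left_mono drift_bound \<eta>) auto
      also have "\<dots> \<le> b0 * ((6 + 12 * C + 9 * a b) / \<eta>)"
        using b a[of b] C0 \<eta> by (intro mult_right_mono) auto
      finally show ?thesis unfolding softplus_sq_d1_ibp(2) by (simp add: field_simps add_divide_distrib)
    qed
    finally show "a (b + h) \<le> a b + h * (b0 / \<eta> * (6 + 12 * C) + 9 * b0 / \<eta> * a b) + h\<^sup>2 * (K0 * (\<integral>g. (growth g)\<^sup>2 \<partial>G))"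
      using b by (simp add: mult_left_mono)
  qed (use b0 \<eta> C0 K0 a in auto)
  also have "\<dots> = exp (9 * b0\<^sup>2 / \<eta>) * (a 0 + (6 + 12 * C) / 9)"
    using b0 \<eta> by (simp add: power2_eq_square)
  also have "a 0 \<le> 1"
  proof -
    have "L 0 g = 0" for g by (simp add: L_def Z_def)
    then have "a 0 = (softplus 0)\<^sup>2" by (simp add: a_def prob_space)
    moreover have "softplus 0 \<le> 1" using softplus_le[of 0] by simp
    ultimately show ?thesis using softplus_pos[of 0] by (simp add: power_le_one)
  qed
  then have "exp (9 * b0\<^sup>2 / \<eta>) * (a 0 + (6 + 12 * C) / 9) \<le> exp (9 * b0\<^sup>2 / \<eta>) * (2 + 2 * C)"
  proof (intro mult_left_mono)
    have "(6 + 12 * C) / 9 \<le> 1 + 2 * C" using C0 by (simp add: divide_le_eq)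
    then show "a 0 + (6 + 12 * C) / 9 \<le> 2 + 2 * C" using \<open>a 0 \<le> 1\<close> by linarith
  qed simp
  finally show ?thesis by (simp add: a_def)
qed

text \<open>Only logarithms of \<open>Z\<close> enter, so no negative moments of \<open>Z\<close> are needed.\<close>
lemma avg_square_moment:
  fixes w x :: "('i \<Rightarrow> real) \<Rightarrow> 't \<Rightarrow> real"
  assumes T: "finite T" and w: "\<And>g t. t \<in> T \<Longrightarrow> 0 \<le> w g t" "\<And>g. (\<Sum>t\<in>T. w g t) = 1"
    and x: "\<And>g t. t \<in> T \<Longrightarrow> 0 \<le> x g t" and j: "0 \<le> j" "j \<le> 2"
    and int: "integrable G (\<lambda>g. exp (j * L b g) * (\<Sum>t\<in>T. w g t * exp (x g t)))"
    and C: "(\<integral>g. exp (j * L b g) * (\<Sum>t\<in>T. w g t * exp (x g t)) \<partial>G) \<le> C"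
  shows "(\<integral>g. (\<Sum>t\<in>T. w g t * (x g t)\<^sup>2) \<partial>G) \<le> 4 + 16 * C + 16 * (\<integral>g. (softplus (L b g))\<^sup>2 \<partial>G)"
proof -
  interpret prob_space G by (rule prob_space_G)
  define D where "D g = exp (j * L b g) * (\<Sum>t\<in>T. w g t * exp (x g t))" for g
  have pw: "(\<Sum>t\<in>T. w g t * (x g t)\<^sup>2) \<le> 4 + 16 * D g + 16 * (softplus (L b g))\<^sup>2" for g
  proof -
    let ?A = "\<Sum>t\<in>T. w g t * exp (x g t)"
    have A: "0 < ?A" using avg_le_ln_avg_exp(2)[OF T w] .
    \<comment> \<open>Nonnegative exponents give \<open>?A \<ge> 1\<close>, so \<open>ln ?A\<close>
      is nonnegative and its upper bound may be squared.\<close>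
    have "(\<Sum>t\<in>T. w g t) \<le> ?A"
      using w(1)[of _ g] x[of _ g] mult_left_mono[of 1 "exp (x g _)" "w g _"] by (intro sum_mono) auto
    then have A1: "0 \<le> ln ?A" using w(2) by simp
    have D0: "D g \<ge> 0" using A by (simp add: D_def)
    have "ln ?A \<le> ln (1 + D g) + 2 * softplus (L b g)"
      unfolding D_def by (rule ln_le_ln_weighted[OF A j])
    then have "(ln ?A)\<^sup>2 \<le> (ln (1 + D g) + 2 * softplus (L b g))\<^sup>2" using A1 by (intro power_mono)
    also have "\<dots> \<le> 2 * (ln (1 + D g))\<^sup>2 + 8 * (softplus (L b g))\<^sup>2"
      using zero_le_power2[of "ln (1 + D g) - 2 * softplus (L b g)"] by (simp add: power2_eq_square algebra_simps)
    also have "\<dots> \<le> 8 * D g + 8 * (softplus (L b g))\<^sup>2" using ln_add_one_sq_le[OF D0] by simp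
    finally show ?thesis
      using avg_square_le_ln_avg_exp[of T "w g" "x g", OF T w(1) w(2) x] by simp
  qed
  have intD: "integrable G D" using int by (simp add: D_def[abs_def])
  have "(\<integral>g. (\<Sum>t\<in>T. w g t * (x g t)\<^sup>2) \<partial>G) \<le> (\<integral>g. 4 + 16 * D g + 16 * (softplus (L b g))\<^sup>2 \<partial>G)"
  proof (rule integral_mono'[OF _ pw])
    show "integrable G (\<lambda>g. 4 + 16 * D g + 16 * (softplus (L b g))\<^sup>2)"
      using intD softplus_L_integrable by simp
    show "0 \<le> (4 + 16 * D g + 16 * (softplus (L b g))\<^sup>2)" for g
      using w(1) by (intro order.trans[OF _ pw[of g]] sum_nonneg) auto
  qed
  also have "\<dots> = 4 + 16 * (\<integral>g. D g \<partial>G) + 16 * (\<integral>g. (softplus (L b g))\<^sup>2 \<partial>G)"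
    using intD softplus_L_integrable by (simp add: prob_space)
  finally show ?thesis using C by (simp add: D_def[abs_def])
qed


section \<open>Integration by parts for Gibbs averages of bounded observables\<close>

definition bounded_rv :: "(('i \<Rightarrow> real) \<Rightarrow> real) \<Rightarrow> bool" where
  "bounded_rv \<Psi> \<longleftrightarrow> \<Psi> \<in> borel_measurable G \<and> (\<exists>A. \<forall>g. \<bar>\<Psi> g\<bar> \<le> A)"

lemma bounded_rvI: "\<Psi> \<in> borel_measurable G \<Longrightarrow> (\<And>g. \<bar>\<Psi> g\<bar> \<le> A) \<Longrightarrow> bounded_rv \<Psi>"
  unfolding bounded_rv_def by blast

lemma bounded_rv_measurable [measurable_dest]: "bounded_rv \<Psi> \<Longrightarrow> \<Psi> \<in> borel_measurable G"
  by (simp add: bounded_rv_def)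

lemma bounded_rv_integrable: "bounded_rv \<Psi> \<Longrightarrow> integrable G \<Psi>"
  unfolding bounded_rv_def using integrable_bounded by blast

lemma bounded_rv_const: "bounded_rv (\<lambda>g. c)"
  by (rule bounded_rvI) auto

lemma bounded_rv_p: "\<sigma> \<in> S \<Longrightarrow> bounded_rv (\<lambda>g. p b g \<sigma>)"
  by (rule bounded_rvI[where A=1]) (auto simp: p_nonneg p_le_1)

lemma bounded_rv_add: "bounded_rv \<Psi> \<Longrightarrow> bounded_rv \<Phi> \<Longrightarrow> bounded_rv (\<lambda>g. \<Psi> g + \<Phi> g)"
  unfolding bounded_rv_def by (auto, meson abs_triangle_ineq add_mono order_trans)

lemma bounded_rv_mult: "bounded_rv \<Psi> \<Longrightarrow> bounded_rv \<Phi> \<Longrightarrow> bounded_rv (\<lambda>g. \<Psi> g * \<Phi> g)"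
proof -
  assume "bounded_rv \<Psi>" "bounded_rv \<Phi>"
  then obtain A B where *: "\<And>g. \<bar>\<Psi> g\<bar> \<le> A" "\<And>g. \<bar>\<Phi> g\<bar> \<le> B" "\<Psi> \<in> borel_measurable G" "\<Phi> \<in> borel_measurable G"
    unfolding bounded_rv_def by blast
  have "\<bar>\<Psi> g * \<Phi> g\<bar> \<le> A * B" for g
    unfolding abs_mult using *(1,2)[of g] by (intro mult_mono) auto
  then show ?thesis using *(3,4) by (intro bounded_rvI) auto
qed

lemma bounded_rv_uminus: "bounded_rv \<Psi> \<Longrightarrow> bounded_rv (\<lambda>g. - \<Psi> g)"
  using bounded_rv_mult[OF bounded_rv_const[of "-1"]] by simp

lemma bounded_rv_diff: "bounded_rv \<Psi> \<Longrightarrow> bounded_rv \<Phi> \<Longrightarrow> bounded_rv (\<lambda>g. \<Psi> g - \<Phi> g)"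
  using bounded_rv_add[OF _ bounded_rv_uminus] by simp

lemma bounded_rv_sum: "finite T \<Longrightarrow> (\<And>t. t \<in> T \<Longrightarrow> bounded_rv (\<Psi> t)) \<Longrightarrow> bounded_rv (\<lambda>g. \<Sum>t\<in>T. \<Psi> t g)"
  by (induction T rule: finite_induct) (auto intro: bounded_rv_const bounded_rv_add)

lemma bounded_rv_sum_S: "(\<And>t. t \<in> S \<Longrightarrow> bounded_rv (\<Psi> t)) \<Longrightarrow> bounded_rv (\<lambda>g. \<Sum>t\<in>S. \<Psi> t g)"
  by (rule bounded_rv_sum[OF finite_S])

lemma bounded_rv_fun_X:
  assumes [measurable]: "f \<in> borel_measurable borel" and "\<And>x. \<bar>f x\<bar> \<le> A"
  shows "bounded_rv (\<lambda>g. f (c * X g \<sigma> - d))"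
  using assms(2) by (intro bounded_rvI) auto

lemmas bounded_rv_intros = bounded_rv_const bounded_rv_p bounded_rv_add bounded_rv_mult bounded_rv_diff bounded_rv_sum_S

lemma ibp_bounded:
  assumes "\<sigma> \<in> S" "bounded_rv \<Psi>" "\<And>\<tau>. \<tau> \<in> S \<Longrightarrow> bounded_rv (\<lambda>g. K g \<tau>)" "\<And>g. xderiv \<Psi> (K g) g"
  shows "integrable G (\<lambda>g. X g \<sigma> * \<Psi> g)"
    "(\<integral>g. X g \<sigma> * \<Psi> g \<partial>G) = (\<integral>g. (\<Sum>\<tau>\<in>S. q \<sigma> \<tau> * K g \<tau>) \<partial>G)"
proof -
  obtain A where A: "\<And>g. \<bar>\<Psi> g\<bar> \<le> A" using assms(2) by (auto simp: bounded_rv_def)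
  have "\<forall>\<tau>\<in>S. \<exists>A. \<forall>g. \<bar>K g \<tau>\<bar> \<le> A" using assms(3) by (auto simp: bounded_rv_def)
  then obtain B where B: "\<And>\<tau> g. \<tau> \<in> S \<Longrightarrow> \<bar>K g \<tau>\<bar> \<le> B \<tau>" by metis
  have A0: "A \<ge> 0" using A[of undefined] by linarith
  have B0: "B \<tau> \<ge> 0" if "\<tau> \<in> S" for \<tau> using B[OF that, of undefined] by linarith
  define C where "C = A + sum B S"
  have C0: "C \<ge> 0" unfolding C_def using A0 B0 by (simp add: sum_nonneg)
  have "\<bar>\<Psi> g\<bar> \<le> C * growth g" for g
    using A[of g] mult_left_mono[OF growth_ge_1[of g] C0] B0 sum_nonneg[of S B] by (simp add: C_def)
  moreover have "\<bar>K g \<tau>\<bar> \<le> C * growth g" if "\<tau> \<in> S" for g \<tau>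
    using B[OF that, of g] member_le_sum[of \<tau> S B] that B0 finite_S mult_left_mono[OF growth_ge_1[of g] C0] A0
    by (simp add: C_def)
  ultimately show "integrable G (\<lambda>g. X g \<sigma> * \<Psi> g)"
    "(\<integral>g. X g \<sigma> * \<Psi> g \<partial>G) = (\<integral>g. (\<Sum>\<tau>\<in>S. q \<sigma> \<tau> * K g \<tau>) \<partial>G)"
    using ibp[OF assms(1) bounded_rv_measurable[OF assms(2)] bounded_rv_measurable[OF assms(3)] assms(4)] by blast+
qed

text \<open>Besides the direct derivative \<open>h'\<close>, the change of the Gibbs weights
  contributes \<open>b\<close> times the deviation of \<open>h\<close> from its own average.\<close>

lemma xderiv_avg:
  assumes "\<And>\<rho>. \<rho> \<in> S \<Longrightarrow> (h \<rho> has_real_derivative h' \<rho>) (at (X g \<rho>))"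
  shows "xderiv (\<lambda>g. \<Sum>\<rho>\<in>S. p b g \<rho> * h \<rho> (X g \<rho>))
    (\<lambda>\<tau>. p b g \<tau> * (h' \<tau> + b * (h \<tau> (X g \<tau>) - (\<Sum>\<rho>\<in>S. p b g \<rho> * h \<rho> (X g \<rho>))))) g"
proof (rule xderiv_cong)
  show "xderiv (\<lambda>g. \<Sum>\<rho>\<in>S. p b g \<rho> * h \<rho> (X g \<rho>))
    (\<lambda>\<tau>. \<Sum>\<rho>\<in>S. (b * p b g \<rho> * (of_bool (\<tau> = \<rho>) - p b g \<tau>)) * h \<rho> (X g \<rho>) + p b g \<rho> * (h' \<rho> * of_bool (\<tau> = \<rho>))) g"
    using assms by (intro xderiv_sum finite_S xderiv_mult xderiv_p xderiv_fun_X)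
  fix \<tau> assume \<tau>: "\<tau> \<in> S"
  have "(\<Sum>\<rho>\<in>S. (b * p b g \<rho> * (of_bool (\<tau> = \<rho>) - p b g \<tau>)) * h \<rho> (X g \<rho>) + p b g \<rho> * (h' \<rho> * of_bool (\<tau> = \<rho>)))
    = (\<Sum>\<rho>\<in>S. (p b g \<rho> * (h' \<rho> + b * h \<rho> (X g \<rho>))) * of_bool (\<tau> = \<rho>) - p b g \<tau> * b * (p b g \<rho> * h \<rho> (X g \<rho>)))"
    by (intro sum.cong refl) (simp add: algebra_simps)
  also have "\<dots> = p b g \<tau> * (h' \<tau> + b * (h \<tau> (X g \<tau>) - (\<Sum>\<rho>\<in>S. p b g \<rho> * h \<rho> (X g \<rho>))))"
    using \<tau> unfolding sum_subtractf sum_delta_S[OF \<tau>] sum_distrib_left[symmetric] by (simp add: algebra_simps)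
  finally show "(\<Sum>\<rho>\<in>S. (b * p b g \<rho> * (of_bool (\<tau> = \<rho>) - p b g \<tau>)) * h \<rho> (X g \<rho>) + p b g \<rho> * (h' \<rho> * of_bool (\<tau> = \<rho>)))
    = p b g \<tau> * (h' \<tau> + b * (h \<tau> (X g \<tau>) - (\<Sum>\<rho>\<in>S. p b g \<rho> * h \<rho> (X g \<rho>))))" .
qed

text \<open>The three summands come from differentiating \<open>f\<close>, the Gibbs weight and
  \<open>\<psi>\<close>. The weight contributes the diagonal covariance \<open>n\<close> minus an
  average of \<open>q\<close> over one more replica.\<close>

lemma gibbs_ibp:
  assumes f: "\<And>x. (f has_real_derivative f' x) (at x)" and [measurable]: "f' \<in> borel_measurable borel"
    and fb: "\<And>x. \<bar>f x\<bar> \<le> B" "\<And>x. \<bar>f' x\<bar> \<le> B'"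
    and \<psi>: "\<And>\<sigma>. \<sigma> \<in> S \<Longrightarrow> bounded_rv (\<psi> \<sigma>)" and D: "\<And>\<sigma> \<tau>. \<sigma> \<in> S \<Longrightarrow> \<tau> \<in> S \<Longrightarrow> bounded_rv (\<lambda>g. D \<sigma> g \<tau>)"
    and xd: "\<And>\<sigma> g. \<sigma> \<in> S \<Longrightarrow> xderiv (\<psi> \<sigma>) (D \<sigma> g) g"
  shows "integrable G (\<lambda>g. \<Sum>\<sigma>\<in>S. p b g \<sigma> * (X g \<sigma> * f (c * X g \<sigma> - d) * \<psi> \<sigma> g))"
    "(\<integral>g. (\<Sum>\<sigma>\<in>S. p b g \<sigma> * (X g \<sigma> * f (c * X g \<sigma> - d) * \<psi> \<sigma> g)) \<partial>G) =
     (\<integral>g. (\<Sum>\<sigma>\<in>S. p b g \<sigma> * (n * c * f' (c * X g \<sigma> - d) * \<psi> \<sigma> g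
        + b * f (c * X g \<sigma> - d) * \<psi> \<sigma> g * (n - (\<Sum>\<tau>\<in>S. p b g \<tau> * q \<sigma> \<tau>))
        + f (c * X g \<sigma> - d) * (\<Sum>\<tau>\<in>S. q \<sigma> \<tau> * D \<sigma> g \<tau>))) \<partial>G)" (is "?lhs = ?rhs")
proof -
  have [measurable]: "f \<in> borel_measurable borel" by (rule has_derivative_everywhere(2)[OF f])
  note bmf = bounded_rv_fun_X[of f, OF _ fb(1)] bounded_rv_fun_X[of f', OF _ fb(2)]
  define K where "K \<sigma> g \<tau> = (b * p b g \<sigma> * (of_bool (\<tau> = \<sigma>) - p b g \<tau>)) * (f (c * X g \<sigma> - d) * \<psi> \<sigma> g)
    + p b g \<sigma> * ((c * f' (c * X g \<sigma> - d)) * of_bool (\<tau> = \<sigma>) * \<psi> \<sigma> g + f (c * X g \<sigma> - d) * D \<sigma> g \<tau>)" for \<sigma> g \<tau>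
  have bK: "bounded_rv (\<lambda>g. K \<sigma> g \<tau>)" if "\<sigma> \<in> S" "\<tau> \<in> S" for \<sigma> \<tau>
    unfolding K_def using that by (intro bounded_rv_intros bmf \<psi> D) auto
  have df: "((\<lambda>x. f (c * x - d)) has_real_derivative c * f' (c * y - d)) (at y)" for y
  proof -
    have "((\<lambda>x. c * x - d) has_real_derivative c) (at y)" by (auto intro!: derivative_eq_intros)
    from DERIV_chain'[OF this f] show ?thesis by (simp add: mult.commute)
  qed
  have ibp: "integrable G (\<lambda>g. X g \<sigma> * (p b g \<sigma> * (f (c * X g \<sigma> - d) * \<psi> \<sigma> g)))"
    "(\<integral>g. X g \<sigma> * (p b g \<sigma> * (f (c * X g \<sigma> - d) * \<psi> \<sigma> g)) \<partial>G) = (\<integral>g. (\<Sum>\<tau>\<in>S. q \<sigma> \<tau> * K \<sigma> g \<tau>) \<partial>G)"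
    if \<sigma>: "\<sigma> \<in> S" for \<sigma>
  proof -
    have xdP: "xderiv (\<lambda>g. p b g \<sigma> * (f (c * X g \<sigma> - d) * \<psi> \<sigma> g)) (K \<sigma> g) g" for g
      unfolding K_def using \<sigma>
      by (intro xderiv_mult xderiv_p xd xderiv_fun_X[of \<sigma> "\<lambda>x. f (c * x - d)"] df)
    have bP: "bounded_rv (\<lambda>g. p b g \<sigma> * (f (c * X g \<sigma> - d) * \<psi> \<sigma> g))"
      using \<sigma> by (intro bounded_rv_intros bmf \<psi>) auto
    show "integrable G (\<lambda>g. X g \<sigma> * (p b g \<sigma> * (f (c * X g \<sigma> - d) * \<psi> \<sigma> g)))"
      "(\<integral>g. X g \<sigma> * (p b g \<sigma> * (f (c * X g \<sigma> - d) * \<psi> \<sigma> g)) \<partial>G) = (\<integral>g. (\<Sum>\<tau>\<in>S. q \<sigma> \<tau> * K \<sigma> g \<tau>) \<partial>G)"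
      by (rule ibp_bounded[where K="K \<sigma>", OF \<sigma> bP bK[OF \<sigma>] xdP]; assumption)+
  qed
  have eq: "(\<Sum>\<sigma>\<in>S. p b g \<sigma> * (X g \<sigma> * f (c * X g \<sigma> - d) * \<psi> \<sigma> g)) = (\<Sum>\<sigma>\<in>S. X g \<sigma> * (p b g \<sigma> * (f (c * X g \<sigma> - d) * \<psi> \<sigma> g)))" for g
    by (simp add: mult_ac)
  show "integrable G (\<lambda>g. \<Sum>\<sigma>\<in>S. p b g \<sigma> * (X g \<sigma> * f (c * X g \<sigma> - d) * \<psi> \<sigma> g))"
    unfolding eq by (rule Bochner_Integration.integrable_sum) (rule ibp)
  have "?lhs = (\<Sum>\<sigma>\<in>S. \<integral>g. (\<Sum>\<tau>\<in>S. q \<sigma> \<tau> * K \<sigma> g \<tau>) \<partial>G)"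
    unfolding eq using ibp by (subst Bochner_Integration.integral_sum) (auto intro!: sum.cong)
  also have "\<dots> = (\<integral>g. (\<Sum>\<sigma>\<in>S. \<Sum>\<tau>\<in>S. q \<sigma> \<tau> * K \<sigma> g \<tau>) \<partial>G)"
    by (rule Bochner_Integration.integral_sum[symmetric]) (intro bounded_rv_integrable bounded_rv_intros bK)
  also have "\<dots> = ?rhs"
  proof (intro Bochner_Integration.integral_cong refl sum.cong)
    fix g \<sigma> assume \<sigma>: "\<sigma> \<in> S"
    define F F' P where "F = f (c * X g \<sigma> - d)" and "F' = f' (c * X g \<sigma> - d)" and "P = \<psi> \<sigma> g"
    have "(\<Sum>\<tau>\<in>S. q \<sigma> \<tau> * K \<sigma> g \<tau>) =
      (\<Sum>\<tau>\<in>S. (q \<sigma> \<tau> * p b g \<sigma> * (b * F * P + c * F' * P)) * of_bool (\<tau> = \<sigma>)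
         - (p b g \<sigma> * b * F * P) * (p b g \<tau> * q \<sigma> \<tau>) + (p b g \<sigma> * F) * (q \<sigma> \<tau> * D \<sigma> g \<tau>))"
      by (intro sum.cong refl) (simp add: K_def F_def F'_def P_def algebra_simps)
    also have "\<dots> = q \<sigma> \<sigma> * p b g \<sigma> * (b * F * P + c * F' * P) - (p b g \<sigma> * b * F * P) * (\<Sum>\<tau>\<in>S. p b g \<tau> * q \<sigma> \<tau>)
        + (p b g \<sigma> * F) * (\<Sum>\<tau>\<in>S. q \<sigma> \<tau> * D \<sigma> g \<tau>)"
      using \<sigma> by (simp only: sum.distrib sum_subtractf sum_delta_S' sum_distrib_left)
    also have "\<dots> = p b g \<sigma> * (n * c * F' * P + b * F * P * (n - (\<Sum>\<tau>\<in>S. p b g \<tau> * q \<sigma> \<tau>)) + F * (\<Sum>\<tau>\<in>S. q \<sigma> \<tau> * D \<sigma> g \<tau>))"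
      unfolding q_diag[OF \<sigma>] by algebra
    finally show "(\<Sum>\<tau>\<in>S. q \<sigma> \<tau> * K \<sigma> g \<tau>) = p b g \<sigma> * (n * c * f' (c * X g \<sigma> - d) * \<psi> \<sigma> g
        + b * f (c * X g \<sigma> - d) * \<psi> \<sigma> g * (n - (\<Sum>\<tau>\<in>S. p b g \<tau> * q \<sigma> \<tau>))
        + f (c * X g \<sigma> - d) * (\<Sum>\<tau>\<in>S. q \<sigma> \<tau> * D \<sigma> g \<tau>))"
      unfolding F_def F'_def P_def .
  qed
  finally show "?lhs = ?rhs" .
qed

end

section \<open>The Stein identity and the variance bound\<close>

text \<open>\<open>N\<close> is a real parameter tied to the model by \<open>card I\<close>. The
  condition \<open>2 \<le> N\<close> gives \<open>1 - 1 / N \<ge> 1 / 2\<close>, used in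
  \<open>variance_bound\<close> to absorb a term.\<close>

locale sk_gibbs = gaussian_gibbs I S e for I :: "'i set" and S :: "'s set" and e +
  fixes N :: real and \<beta> :: real
  assumes N2: "2 \<le> N" and card_I: "real (card I) = N * (N - 1) / 2"
    and beta: "0 < \<beta>" "\<beta> < 1"
begin

definition b0 :: real where "b0 = \<beta> / sqrt N"

abbreviation w :: "('i \<Rightarrow> real) \<Rightarrow> 's \<Rightarrow> real" where "w \<equiv> p b0"

definition H :: "('i \<Rightarrow> real) \<Rightarrow> 's \<Rightarrow> real" where
  "H g \<sigma> = 1 / N * X g \<sigma> - sqrt N * \<beta> / 2"

text \<open>For spins \<open>q\<close> equals \<open>(N\<^sup>2 R\<^sup>2 - N) / 2\<close> with
  \<open>R\<close> the overlap, which makes this \<open>N R\<^sup>2 - 1\<close>.\<close>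

definition Q :: "'s \<Rightarrow> 's \<Rightarrow> real" where
  "Q \<sigma> \<tau> = 2 / N * q \<sigma> \<tau>"

definition avg_abs_Q :: "('i \<Rightarrow> real) \<Rightarrow> 's \<Rightarrow> real" where
  "avg_abs_Q g \<sigma> = (\<Sum>\<rho>\<in>S. w g \<rho> * \<bar>Q \<rho> \<sigma>\<bar>)"

definition avg_Q_sq :: "('i \<Rightarrow> real) \<Rightarrow> 's \<Rightarrow> real" where
  "avg_Q_sq g \<sigma> = (\<Sum>\<rho>\<in>S. w g \<rho> * (Q \<rho> \<sigma>)\<^sup>2)"

definition mean_Q_sq :: "('i \<Rightarrow> real) \<Rightarrow> real" where
  "mean_Q_sq g = (\<Sum>\<sigma>\<in>S. w g \<sigma> * avg_Q_sq g \<sigma>)"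

lemma N_pos: "N > 0" "N \<ge> 2" "N \<noteq> 0"
  using N2 by auto

lemma b0_N: "b0 * N = sqrt N * \<beta>"
  using N_pos real_sqrt_mult_self[of "N"] by (simp add: b0_def field_simps)

lemma b0_bounds: "0 < b0" "b0 \<le> 1 / sqrt N" "b0 \<le> 1" "b0\<^sup>2 \<le> 1 / N"
proof -
  show "0 < b0" "b0 \<le> 1 / sqrt N" using beta N_pos by (auto simp: b0_def divide_right_mono)
  then have "b0\<^sup>2 \<le> (1 / sqrt N)\<^sup>2" by (intro power_mono) auto
  then show "b0\<^sup>2 \<le> 1 / N" using N_pos by (simp add: power_divide)
  have "1 / sqrt N \<le> 1" using N_pos by simp
  then show "b0 \<le> 1" using \<open>b0 \<le> 1 / sqrt N\<close> by linarith
qed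

lemma N_sqrt: "1 / N \<le> 1 / sqrt N"
proof -
  have "sqrt N * 1 \<le> sqrt N * sqrt N" using N_pos by (intro mult_left_mono) auto
  then show ?thesis using N_pos by (intro divide_left_mono) auto
qed

lemma Q_sym: "Q \<sigma> \<tau> = Q \<tau> \<sigma>"
  by (simp add: Q_def q_sym)

text \<open>Two cancellations leave only small terms. The variance of \<open>X / N\<close> is
  \<open>(N - 1) / (2 N)\<close>, so the derivative terms agree up to \<open>1 / N\<close>. The
  Gibbs tilt shifts the energy by \<open>b0 * (N - 1)\<close> against the centering
  \<open>sqrt N * \<beta> = b0 * N\<close>, which leaves \<open>b0\<close> times \<open>1\<close>
  plus the averaged overlap term.\<close>

lemma stein_ibp:
  assumes f: "\<And>x. (f has_real_derivative f' x) (at x)" and [measurable]: "f' \<in> borel_measurable borel"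
    and fb: "\<And>x. \<bar>f x\<bar> \<le> B" "\<And>x. \<bar>f' x\<bar> \<le> B'"
    and \<psi>: "\<And>\<sigma>. \<sigma> \<in> S \<Longrightarrow> bounded_rv (\<psi> \<sigma>)" and D: "\<And>\<sigma> \<tau>. \<sigma> \<in> S \<Longrightarrow> \<tau> \<in> S \<Longrightarrow> bounded_rv (\<lambda>g. D \<sigma> g \<tau>)"
    and xd: "\<And>\<sigma> g. \<sigma> \<in> S \<Longrightarrow> xderiv (\<psi> \<sigma>) (D \<sigma> g) g"
  shows "integrable G (\<lambda>g. \<Sum>\<sigma>\<in>S. w g \<sigma> * ((f' (H g \<sigma>) - 2 * H g \<sigma> * f (H g \<sigma>)) * \<psi> \<sigma> g))" (is "integrable G ?F")
    "(\<integral>g. (\<Sum>\<sigma>\<in>S. w g \<sigma> * ((f' (H g \<sigma>) - 2 * H g \<sigma> * f (H g \<sigma>)) * \<psi> \<sigma> g)) \<partial>G) =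
     (\<integral>g. (\<Sum>\<sigma>\<in>S. w g \<sigma> * (1 / N * (f' (H g \<sigma>) * \<psi> \<sigma> g)
        + b0 * (f (H g \<sigma>) * \<psi> \<sigma> g * (1 + (\<Sum>\<tau>\<in>S. w g \<tau> * Q \<sigma> \<tau>)))
        - f (H g \<sigma>) * (\<Sum>\<tau>\<in>S. Q \<sigma> \<tau> * D \<sigma> g \<tau>))) \<partial>G)" (is "?lhs = ?rhs")
proof -
  have [measurable]: "f \<in> borel_measurable borel" by (rule has_derivative_everywhere(2)[OF f])
  have bmf: "bounded_rv (\<lambda>g. f (H g \<sigma>))" "bounded_rv (\<lambda>g. f' (H g \<sigma>))" for \<sigma>
    unfolding H_def by (intro bounded_rv_fun_X[of f, OF _ fb(1)] bounded_rv_fun_X[of f', OF _ fb(2)]; measurable)+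
  note ibp = gibbs_ibp[where \<psi>=\<psi> and D=D and c="1 / N" and d="sqrt N * \<beta> / 2" and b=b0, OF f assms(2) fb \<psi> D xd, folded H_def]
  define R where "R g = (\<Sum>\<sigma>\<in>S. w g \<sigma> * (n * (1 / N) * f' (H g \<sigma>) * \<psi> \<sigma> g
        + b0 * f (H g \<sigma>) * \<psi> \<sigma> g * (n - (\<Sum>\<tau>\<in>S. w g \<tau> * q \<sigma> \<tau>))
        + f (H g \<sigma>) * (\<Sum>\<tau>\<in>S. q \<sigma> \<tau> * D \<sigma> g \<tau>)))" for g
  define T where "T g = (\<Sum>\<sigma>\<in>S. w g \<sigma> * (f' (H g \<sigma>) * \<psi> \<sigma> g + sqrt N * \<beta> * (f (H g \<sigma>) * \<psi> \<sigma> g)))" for g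
  define U where "U g = (\<Sum>\<sigma>\<in>S. w g \<sigma> * (X g \<sigma> * f (H g \<sigma>) * \<psi> \<sigma> g))" for g
  have bR: "bounded_rv R" unfolding R_def by (intro bounded_rv_intros bmf \<psi> D)
  have bT: "bounded_rv T" unfolding T_def by (intro bounded_rv_intros bmf \<psi> D)
  have U: "integrable G U" "integral\<^sup>L G U = integral\<^sup>L G R"
    unfolding U_def[abs_def] R_def[abs_def] by (rule ibp; assumption)+
  have eq: "(\<Sum>\<sigma>\<in>S. w g \<sigma> * ((f' (H g \<sigma>) - 2 * H g \<sigma> * f (H g \<sigma>)) * \<psi> \<sigma> g)) = T g - 2 / N * U g" for g
    unfolding T_def U_def sum_distrib_left sum_subtractf[symmetric]
    by (intro sum.cong refl) (simp add: H_def algebra_simps)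
  show "integrable G ?F"
    unfolding eq by (intro Bochner_Integration.integrable_diff integrable_mult_right U bounded_rv_integrable bT)
  have "(\<integral>g. T g - 2 / N * U g \<partial>G) = (\<integral>g. T g - 2 / N * R g \<partial>G)"
    using U bounded_rv_integrable[OF bR] bounded_rv_integrable[OF bT] by simp
  also have "\<dots> = ?rhs"
  proof (rule Bochner_Integration.integral_cong[OF refl])
    fix g
    have *: "(F' * P + sqrt N * \<beta> * (F * P)) - 2 / N * (n * (1 / N) * F' * P + b0 * F * P * (n - s) + F * t)
      = 1 / N * (F' * P) + b0 * (F * P * (1 + 2 / N * s)) - F * (2 / N * t)" for F F' P s t
    proof -
      have 1: "2 / N * n = N - 1" using N_pos by (simp add: card_I)
      have "(F' * P + sqrt N * \<beta> * (F * P)) - 2 / N * (n * (1 / N) * F' * P + b0 * F * P * (n - s) + F * t)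
        = F' * P + b0 * N * (F * P) - ((2 / N * n) * (1 / N) * F' * P + b0 * F * P * (2 / N * n - 2 / N * s) + F * (2 / N * t))"
        unfolding b0_N[symmetric] by (simp add: algebra_simps)
      also have "\<dots> = 1 / N * (F' * P) + b0 * (F * P * (1 + 2 / N * s)) - F * (2 / N * t)"
        unfolding 1 using N_pos by (simp add: field_simps)
      finally show ?thesis .
    qed
    show "T g - 2 / N * R g = (\<Sum>\<sigma>\<in>S. w g \<sigma> * (1 / N * (f' (H g \<sigma>) * \<psi> \<sigma> g)
        + b0 * (f (H g \<sigma>) * \<psi> \<sigma> g * (1 + (\<Sum>\<tau>\<in>S. w g \<tau> * Q \<sigma> \<tau>)))
        - f (H g \<sigma>) * (\<Sum>\<tau>\<in>S. Q \<sigma> \<tau> * D \<sigma> g \<tau>)))"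
      unfolding T_def R_def sum_distrib_left[of "2 / N"] sum_subtractf[symmetric]
    proof (intro sum.cong refl)
      fix \<sigma>
      have s: "(\<Sum>\<tau>\<in>S. w g \<tau> * Q \<sigma> \<tau>) = 2 / N * (\<Sum>\<tau>\<in>S. w g \<tau> * q \<sigma> \<tau>)"
        "(\<Sum>\<tau>\<in>S. Q \<sigma> \<tau> * D \<sigma> g \<tau>) = 2 / N * (\<Sum>\<tau>\<in>S. q \<sigma> \<tau> * D \<sigma> g \<tau>)"
        by (simp_all add: Q_def sum_distrib_left mult_ac)
      show "w g \<sigma> * (f' (H g \<sigma>) * \<psi> \<sigma> g + sqrt N * \<beta> * (f (H g \<sigma>) * \<psi> \<sigma> g)) -
         2 / N * (w g \<sigma> * (n * (1 / N) * f' (H g \<sigma>) * \<psi> \<sigma> g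
        + b0 * f (H g \<sigma>) * \<psi> \<sigma> g * (n - (\<Sum>\<tau>\<in>S. w g \<tau> * q \<sigma> \<tau>))
        + f (H g \<sigma>) * (\<Sum>\<tau>\<in>S. q \<sigma> \<tau> * D \<sigma> g \<tau>))) =
        w g \<sigma> * (1 / N * (f' (H g \<sigma>) * \<psi> \<sigma> g)
        + b0 * (f (H g \<sigma>) * \<psi> \<sigma> g * (1 + (\<Sum>\<tau>\<in>S. w g \<tau> * Q \<sigma> \<tau>)))
        - f (H g \<sigma>) * (\<Sum>\<tau>\<in>S. Q \<sigma> \<tau> * D \<sigma> g \<tau>))"
        unfolding s *[symmetric] by (simp only: right_diff_distrib mult.left_commute)
    qed
  qed
  finally show "?lhs = ?rhs"
    unfolding eq .
qed

section \<open>Gibbs averages of the overlap variable\<close>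

lemma avg_mono: "(\<And>\<sigma>. \<sigma> \<in> S \<Longrightarrow> x \<sigma> \<le> y \<sigma>) \<Longrightarrow> (\<Sum>\<sigma>\<in>S. w g \<sigma> * x \<sigma>) \<le> (\<Sum>\<sigma>\<in>S. w g \<sigma> * y \<sigma>)"
  by (intro sum_mono mult_left_mono p_nonneg)

lemma avg_abs: "(\<And>\<sigma>. \<sigma> \<in> S \<Longrightarrow> \<bar>x \<sigma>\<bar> \<le> y \<sigma>) \<Longrightarrow> \<bar>\<Sum>\<sigma>\<in>S. w g \<sigma> * x \<sigma>\<bar> \<le> (\<Sum>\<sigma>\<in>S. w g \<sigma> * y \<sigma>)"
  by (intro order.trans[OF sum_abs] sum_mono) (simp add: abs_mult p_nonneg mult_left_mono)

lemma avg_const: "(\<Sum>\<sigma>\<in>S. w g \<sigma> * c) = c"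
  by (simp add: sum_distrib_right[symmetric] sum_p)

lemma avg_lin: "(\<Sum>\<sigma>\<in>S. w g \<sigma> * (c + d * x \<sigma>)) = c + d * (\<Sum>\<sigma>\<in>S. w g \<sigma> * x \<sigma>)"
proof -
  have "(\<Sum>\<sigma>\<in>S. w g \<sigma> * (c + d * x \<sigma>)) = (\<Sum>\<sigma>\<in>S. w g \<sigma> * c) + d * (\<Sum>\<sigma>\<in>S. w g \<sigma> * x \<sigma>)"
    unfolding sum_distrib_left sum.distrib[symmetric] by (intro sum.cong refl) (simp add: algebra_simps)
  then show ?thesis by (simp add: avg_const)
qed

lemma avg_square_le: "(\<Sum>\<sigma>\<in>S. w g \<sigma> * x \<sigma>)\<^sup>2 \<le> (\<Sum>\<sigma>\<in>S. w g \<sigma> * (x \<sigma>)\<^sup>2)"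
proof -
  define m where "m = (\<Sum>\<sigma>\<in>S. w g \<sigma> * x \<sigma>)"
  have "(\<Sum>\<sigma>\<in>S. w g \<sigma> * (- m\<^sup>2 + 2 * m * x \<sigma>)) \<le> (\<Sum>\<sigma>\<in>S. w g \<sigma> * (x \<sigma>)\<^sup>2)"
  proof (rule avg_mono)
    fix \<sigma> show "- m\<^sup>2 + 2 * m * x \<sigma> \<le> (x \<sigma>)\<^sup>2"
      using zero_le_power2[of "x \<sigma> - m"] by (simp add: power2_eq_square algebra_simps)
  qed
  then show ?thesis unfolding avg_lin m_def[symmetric] by (simp add: power2_eq_square)
qed

lemma avg_abs_Q_nonneg: "0 \<le> avg_abs_Q g \<sigma>"
  unfolding avg_abs_Q_def by (intro sum_nonneg mult_nonneg_nonneg p_nonneg) auto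

lemma avg_abs_Q_square: "(avg_abs_Q g \<sigma>)\<^sup>2 \<le> avg_Q_sq g \<sigma>"
  unfolding avg_abs_Q_def avg_Q_sq_def using avg_square_le[of g "\<lambda>\<rho>. \<bar>Q \<rho> \<sigma>\<bar>"] by simp

lemma abs_avg_Q_le: "\<bar>\<Sum>\<tau>\<in>S. w g \<tau> * Q \<sigma> \<tau>\<bar> \<le> avg_abs_Q g \<sigma>"
  unfolding avg_abs_Q_def by (rule avg_abs) (simp add: Q_sym)

lemma avg_avg_abs_Q_square: "(\<Sum>\<sigma>\<in>S. w g \<sigma> * (avg_abs_Q g \<sigma>)\<^sup>2) \<le> mean_Q_sq g"
  unfolding mean_Q_sq_def by (rule avg_mono) (rule avg_abs_Q_square)

lemma avg_avg_abs_Q: "(\<Sum>\<sigma>\<in>S. w g \<sigma> * avg_abs_Q g \<sigma>)\<^sup>2 \<le> mean_Q_sq g"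
  by (rule order.trans[OF avg_square_le avg_avg_abs_Q_square])

lemma avg_avg_abs_Q_le: "(\<Sum>\<sigma>\<in>S. w g \<sigma> * avg_abs_Q g \<sigma>) \<le> 1 + mean_Q_sq g"
proof -
  let ?x = "\<Sum>\<sigma>\<in>S. w g \<sigma> * avg_abs_Q g \<sigma>"
  have "2 * ?x \<le> 1 + ?x\<^sup>2" using zero_le_power2[of "?x - 1"] by (simp add: power2_eq_square algebra_simps)
  moreover have "0 \<le> ?x\<^sup>2" by simp
  ultimately show ?thesis using avg_avg_abs_Q[of g] by linarith
qed

lemma mean_Q_sq_nonneg: "0 \<le> mean_Q_sq g"
  using avg_avg_abs_Q[of g] zero_le_power2 order_trans by blast

lemma bounded_rv_mean_Q_sq: "bounded_rv mean_Q_sq"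
  unfolding mean_Q_sq_def[abs_def] avg_Q_sq_def by (intro bounded_rv_intros)


text \<open>\<open>\<psi>\<close> carries one factor \<open>Q\<close>, and the replica average in
  the first term or the kernel in the second supplies at most one more; hence
  \<open>mean_Q_sq\<close> controls everything. Every term also carries \<open>1 / N\<close> or
  \<open>b0\<close>. In \<open>variance_bound\<close>, \<open>h\<close> is first \<open>f\<close>
  and then \<open>v\<close>.\<close>

lemma remainder_bound:
  fixes f' :: "real \<Rightarrow> real"
  assumes fb: "\<And>x. \<bar>f x\<bar> \<le> B" "\<And>x. \<bar>f' x\<bar> \<le> B" and hb: "\<And>x. \<bar>h x\<bar> \<le> B"
    and \<psi>: "\<And>\<tau>. \<psi> \<tau> = (\<Sum>\<rho>\<in>S. w g \<rho> * (f (H g \<rho>) * Q \<rho> \<tau>))"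
  shows "\<bar>\<psi> \<sigma>\<bar> \<le> B * avg_abs_Q g \<sigma>"
    "\<bar>\<Sum>\<sigma>\<in>S. w g \<sigma> * (b0 * (h (H g \<sigma>) * \<psi> \<sigma> * (1 + (\<Sum>\<tau>\<in>S. w g \<tau> * Q \<sigma> \<tau>)))
      - h (H g \<sigma>) * (\<Sum>\<tau>\<in>S. Q \<sigma> \<tau> * (w g \<tau> * (1 / N * f' (H g \<tau>) * Q \<tau> \<sigma> + b0 * (f (H g \<tau>) * Q \<tau> \<sigma> - \<psi> \<sigma>)))))\<bar>
     \<le> B\<^sup>2 * (1 + mean_Q_sq g) * (1 / N + 4 * b0)" (is "?lhs \<le> ?rhs")
proof -
  have B: "B \<ge> 0" using hb[of 0] by linarith
  note b0 = b0_bounds(1)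
  note a0 = avg_abs_Q_nonneg[of g]
  show \<psi>b: "\<bar>\<psi> \<sigma>\<bar> \<le> B * avg_abs_Q g \<sigma>" for \<sigma>
  proof -
    have "\<bar>\<psi> \<sigma>\<bar> \<le> (\<Sum>\<rho>\<in>S. w g \<rho> * (B * \<bar>Q \<rho> \<sigma>\<bar>))"
      unfolding \<psi> by (rule avg_abs) (simp add: abs_mult fb mult_right_mono)
    then show ?thesis by (simp add: avg_abs_Q_def sum_distrib_left mult_ac)
  qed
  have "?lhs
     \<le> (\<Sum>\<sigma>\<in>S. w g \<sigma> * (b0 * (B * (B * avg_abs_Q g \<sigma>) * (1 + avg_abs_Q g \<sigma>))
        + B * (B * (1 / N + b0) * avg_Q_sq g \<sigma> + b0 * B * (avg_abs_Q g \<sigma>)\<^sup>2)))"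
  proof (rule avg_abs)
    fix \<sigma>
    have "\<bar>b0 * (h (H g \<sigma>) * \<psi> \<sigma> * (1 + (\<Sum>\<tau>\<in>S. w g \<tau> * Q \<sigma> \<tau>)))\<bar> \<le> b0 * (B * (B * avg_abs_Q g \<sigma>) * (1 + avg_abs_Q g \<sigma>))"
    proof -
      have "\<bar>1 + (\<Sum>\<tau>\<in>S. w g \<tau> * Q \<sigma> \<tau>)\<bar> \<le> 1 + avg_abs_Q g \<sigma>" using abs_avg_Q_le[of g \<sigma>] by linarith
      then show ?thesis unfolding abs_mult using b0 B a0[of \<sigma>] hb[of "H g \<sigma>"] \<psi>b[of \<sigma>]
        by (intro mult_mono mult_nonneg_nonneg) auto
    qed
    moreover have "\<bar>h (H g \<sigma>) * (\<Sum>\<tau>\<in>S. Q \<sigma> \<tau> * (w g \<tau> * (1 / N * f' (H g \<tau>) * Q \<tau> \<sigma> + b0 * (f (H g \<tau>) * Q \<tau> \<sigma> - \<psi> \<sigma>))))\<bar>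
      \<le> B * (B * (1 / N + b0) * avg_Q_sq g \<sigma> + b0 * B * (avg_abs_Q g \<sigma>)\<^sup>2)"
    proof -
      have "\<bar>\<Sum>\<tau>\<in>S. w g \<tau> * (Q \<sigma> \<tau> * (1 / N * f' (H g \<tau>) * Q \<tau> \<sigma> + b0 * (f (H g \<tau>) * Q \<tau> \<sigma> - \<psi> \<sigma>)))\<bar>
        \<le> (\<Sum>\<tau>\<in>S. w g \<tau> * (B * (1 / N + b0) * (Q \<tau> \<sigma>)\<^sup>2 + b0 * (B * avg_abs_Q g \<sigma>) * \<bar>Q \<tau> \<sigma>\<bar>))"
      proof (rule avg_abs)
        fix \<tau>
        have "\<bar>1 / N * f' (H g \<tau>) * Q \<tau> \<sigma> + b0 * (f (H g \<tau>) * Q \<tau> \<sigma> - \<psi> \<sigma>)\<bar>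
          \<le> 1 / N * B * \<bar>Q \<tau> \<sigma>\<bar> + b0 * (B * \<bar>Q \<tau> \<sigma>\<bar> + B * avg_abs_Q g \<sigma>)"
        proof -
          have "\<bar>1 / N * f' (H g \<tau>) * Q \<tau> \<sigma>\<bar> \<le> 1 / N * B * \<bar>Q \<tau> \<sigma>\<bar>"
            unfolding abs_mult using fb(2)[of "H g \<tau>"] N_pos by (intro mult_right_mono mult_mono) auto
          moreover have "\<bar>f (H g \<tau>) * Q \<tau> \<sigma> - \<psi> \<sigma>\<bar> \<le> B * \<bar>Q \<tau> \<sigma>\<bar> + B * avg_abs_Q g \<sigma>"
            using \<psi>b[of \<sigma>] mult_right_mono[OF fb(1)[of "H g \<tau>"], of "\<bar>Q \<tau> \<sigma>\<bar>"]
            by (intro order.trans[OF abs_triangle_ineq4]) (simp add: abs_mult)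
          then have "\<bar>b0 * (f (H g \<tau>) * Q \<tau> \<sigma> - \<psi> \<sigma>)\<bar> \<le> b0 * (B * \<bar>Q \<tau> \<sigma>\<bar> + B * avg_abs_Q g \<sigma>)"
            using b0 by (simp add: abs_mult mult_left_mono)
          ultimately show ?thesis by linarith
        qed
        then have "\<bar>Q \<tau> \<sigma>\<bar> * \<bar>1 / N * f' (H g \<tau>) * Q \<tau> \<sigma> + b0 * (f (H g \<tau>) * Q \<tau> \<sigma> - \<psi> \<sigma>)\<bar>
          \<le> \<bar>Q \<tau> \<sigma>\<bar> * (1 / N * B * \<bar>Q \<tau> \<sigma>\<bar> + b0 * (B * \<bar>Q \<tau> \<sigma>\<bar> + B * avg_abs_Q g \<sigma>))"
          by (intro mult_left_mono) auto
        also have "\<dots> = B * (1 / N + b0) * (Q \<tau> \<sigma>)\<^sup>2 + b0 * (B * avg_abs_Q g \<sigma>) * \<bar>Q \<tau> \<sigma>\<bar>"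
          unfolding power2_abs[of "Q \<tau> \<sigma>", symmetric] power2_eq_square by (simp add: algebra_simps)
        finally show "\<bar>Q \<sigma> \<tau> * (1 / N * f' (H g \<tau>) * Q \<tau> \<sigma> + b0 * (f (H g \<tau>) * Q \<tau> \<sigma> - \<psi> \<sigma>))\<bar>
          \<le> B * (1 / N + b0) * (Q \<tau> \<sigma>)\<^sup>2 + b0 * (B * avg_abs_Q g \<sigma>) * \<bar>Q \<tau> \<sigma>\<bar>"
          unfolding abs_mult Q_sym[of \<sigma> \<tau>] .
      qed
      also have "\<dots> = (\<Sum>\<tau>\<in>S. B * (1 / N + b0) * (w g \<tau> * (Q \<tau> \<sigma>)\<^sup>2) + b0 * (B * avg_abs_Q g \<sigma>) * (w g \<tau> * \<bar>Q \<tau> \<sigma>\<bar>))"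
        by (intro sum.cong refl) (simp add: distrib_left mult_ac)
      also have "\<dots> = B * (1 / N + b0) * avg_Q_sq g \<sigma> + b0 * (B * avg_abs_Q g \<sigma>) * avg_abs_Q g \<sigma>"
        unfolding avg_Q_sq_def avg_abs_Q_def[of g \<sigma>] sum.distrib sum_distrib_left[symmetric] ..
      finally have "\<bar>\<Sum>\<tau>\<in>S. Q \<sigma> \<tau> * (w g \<tau> * (1 / N * f' (H g \<tau>) * Q \<tau> \<sigma> + b0 * (f (H g \<tau>) * Q \<tau> \<sigma> - \<psi> \<sigma>)))\<bar>
        \<le> B * (1 / N + b0) * avg_Q_sq g \<sigma> + b0 * B * (avg_abs_Q g \<sigma>)\<^sup>2"
        by (simp only: mult.left_commute[of "Q _ _"]) (simp add: power2_eq_square mult_ac)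
      then show ?thesis unfolding abs_mult[of "h _"] using hb[of "H g \<sigma>"] B by (intro mult_mono) auto
    qed
    ultimately show "\<bar>b0 * (h (H g \<sigma>) * \<psi> \<sigma> * (1 + (\<Sum>\<tau>\<in>S. w g \<tau> * Q \<sigma> \<tau>)))
      - h (H g \<sigma>) * (\<Sum>\<tau>\<in>S. Q \<sigma> \<tau> * (w g \<tau> * (1 / N * f' (H g \<tau>) * Q \<tau> \<sigma> + b0 * (f (H g \<tau>) * Q \<tau> \<sigma> - \<psi> \<sigma>))))\<bar>
      \<le> b0 * (B * (B * avg_abs_Q g \<sigma>) * (1 + avg_abs_Q g \<sigma>))
        + B * (B * (1 / N + b0) * avg_Q_sq g \<sigma> + b0 * B * (avg_abs_Q g \<sigma>)\<^sup>2)" by linarith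
  qed
  also have "\<dots> = (\<Sum>\<sigma>\<in>S. B\<^sup>2 * b0 * (w g \<sigma> * avg_abs_Q g \<sigma>) + 2 * B\<^sup>2 * b0 * (w g \<sigma> * (avg_abs_Q g \<sigma>)\<^sup>2) + B\<^sup>2 * (1 / N + b0) * (w g \<sigma> * avg_Q_sq g \<sigma>))"
    by (intro sum.cong refl) (simp add: power2_eq_square algebra_simps)
  also have "\<dots> = B\<^sup>2 * b0 * (\<Sum>\<sigma>\<in>S. w g \<sigma> * avg_abs_Q g \<sigma>) + 2 * B\<^sup>2 * b0 * (\<Sum>\<sigma>\<in>S. w g \<sigma> * (avg_abs_Q g \<sigma>)\<^sup>2) + B\<^sup>2 * (1 / N + b0) * mean_Q_sq g"
    unfolding mean_Q_sq_def sum.distrib sum_distrib_left[symmetric] ..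
  also have "\<dots> \<le> B\<^sup>2 * b0 * (1 + mean_Q_sq g) + 2 * B\<^sup>2 * b0 * (1 + mean_Q_sq g) + B\<^sup>2 * (1 / N + b0) * (1 + mean_Q_sq g)"
    using avg_avg_abs_Q_le[of g] avg_avg_abs_Q_square[of g] b0 N_pos by (intro add_mono mult_left_mono) auto
  also have "\<dots> = B\<^sup>2 * (1 + mean_Q_sq g) * (1 / N + 4 * b0)" by (simp add: algebra_simps)
  finally show "?lhs \<le> ?rhs" .
qed

text \<open>In the proof, \<open>stein_ibp\<close> is applied to \<open>(f, \<phi>)\<close>, \<open>(f, \<psi>)\<close> and \<open>(v, \<psi>)\<close>; the last one removes
  the derivative \<open>v'\<close>, whose size \<open>B'\<close> must not enter the bound.\<close>
theorem variance_bound: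
  fixes f f' v v' :: "real \<Rightarrow> real"
  assumes f: "\<And>x. (f has_real_derivative f' x) (at x)" and stein: "\<And>x. f' x - 2 * x * f x = v x"
    and v: "\<And>x. (v has_real_derivative v' x) (at x)" and v'm[measurable]: "v' \<in> borel_measurable borel"
    and bounds: "\<And>x. \<bar>f x\<bar> \<le> B" "\<And>x. \<bar>f' x\<bar> \<le> B" "\<And>x. \<bar>v x\<bar> \<le> B" "\<And>x. \<bar>v' x\<bar> \<le> B'"
    and KW: "(\<integral>g. mean_Q_sq g \<partial>G) \<le> KW" and KH: "(\<integral>g. (\<Sum>\<sigma>\<in>S. w g \<sigma> * (H g \<sigma>)\<^sup>2) \<partial>G) \<le> KH"
  shows "(\<integral>g. (\<Sum>\<sigma>\<in>S. w g \<sigma> * v (H g \<sigma>))\<^sup>2 \<partial>G) \<le> 2 * B\<^sup>2 * (20 + 22 * KW + 2 * KH) / N"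
proof -
  interpret prob_space G by (rule prob_space_G)
  have B: "B \<ge> 0" using bounds(1)[of 0] by linarith
  note b0 = b0_bounds
  note fm[measurable] = has_derivative_everywhere(2)[OF f] and vm[measurable] = has_derivative_everywhere(2)[OF v]
  have "f' = (\<lambda>x. v x + 2 * x * f x)" using stein by (auto simp: fun_eq_iff algebra_simps)
  then have f'm[measurable]: "f' \<in> borel_measurable borel" by simp
  have bmH: "bounded_rv (\<lambda>g. f (H g \<sigma>))" "bounded_rv (\<lambda>g. f' (H g \<sigma>))" "bounded_rv (\<lambda>g. v (H g \<sigma>))" "bounded_rv (\<lambda>g. v' (H g \<sigma>))" for \<sigma>
    unfolding H_def using bounded_rv_fun_X[OF fm bounds(1)] bounded_rv_fun_X[OF f'm bounds(2)] bounded_rv_fun_X[OF vm bounds(3)] bounded_rv_fun_X[OF v'm bounds(4)] by blast+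
  have dH: "((\<lambda>x. F (1 / N * x - sqrt N * \<beta> / 2)) has_real_derivative 1 / N * F' (H g \<rho>)) (at (X g \<rho>))"
    if F: "\<And>x. (F has_real_derivative F' x) (at x)" for F F' g \<rho>
  proof -
    have "((\<lambda>x. 1 / N * x - sqrt N * \<beta> / 2) has_real_derivative 1 / N) (at (X g \<rho>))"
      using N_pos by (auto intro!: derivative_eq_intros)
    from DERIV_chain'[OF this F] show ?thesis using N_pos by (simp add: H_def mult.commute)
  qed
  define \<phi> where "\<phi> g = (\<Sum>\<sigma>\<in>S. w g \<sigma> * v (H g \<sigma>))" for g
  define D\<phi> where "D\<phi> g \<tau> = w g \<tau> * (1 / N * v' (H g \<tau>) + b0 * (v (H g \<tau>) - \<phi> g))" for g \<tau>
  define \<psi> where "\<psi> \<tau> g = (\<Sum>\<rho>\<in>S. w g \<rho> * (f (H g \<rho>) * Q \<rho> \<tau>))" for \<tau> g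
  define D\<psi> where "D\<psi> \<tau> g \<sigma> = w g \<sigma> * (1 / N * f' (H g \<sigma>) * Q \<sigma> \<tau> + b0 * (f (H g \<sigma>) * Q \<sigma> \<tau> - \<psi> \<tau> g))" for \<tau> g \<sigma>
  have bounded_rv\<phi>: "bounded_rv \<phi>" unfolding \<phi>_def[abs_def] by (intro bounded_rv_intros bmH)
  have bounded_rv\<psi>: "bounded_rv (\<psi> \<tau>)" for \<tau> unfolding \<psi>_def[abs_def] by (intro bounded_rv_intros bmH)
  have bmD\<phi>: "bounded_rv (\<lambda>g. D\<phi> g \<tau>)" if "\<tau> \<in> S" for \<tau> unfolding D\<phi>_def using that by (intro bounded_rv_intros bmH bounded_rv\<phi>)
  have bmD\<psi>: "bounded_rv (\<lambda>g. D\<psi> \<tau> g \<sigma>)" if "\<sigma> \<in> S" for \<sigma> \<tau> unfolding D\<psi>_def using that by (intro bounded_rv_intros bmH bounded_rv\<psi>)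
  have xd\<phi>: "xderiv \<phi> (D\<phi> g) g" for g
    using xderiv_avg[of "\<lambda>\<rho> x. v (1 / N * x - sqrt N * \<beta> / 2)" "\<lambda>\<rho>. 1 / N * v' (H g \<rho>)" g b0, OF dH[OF v]]
    unfolding D\<phi>_def[abs_def] \<phi>_def[abs_def] H_def[symmetric] by simp
  have xd\<psi>: "xderiv (\<psi> \<tau>) (D\<psi> \<tau> g) g" for \<tau> g
    using xderiv_avg[of "\<lambda>\<rho> x. f (1 / N * x - sqrt N * \<beta> / 2) * Q \<rho> \<tau>" "\<lambda>\<rho>. 1 / N * f' (H g \<rho>) * Q \<rho> \<tau>" g b0, OF DERIV_cmult_right[OF dH[OF f]]]
    unfolding D\<psi>_def[abs_def] \<psi>_def[abs_def] H_def[symmetric] by simp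

  define V1 where "V1 g = (\<Sum>\<sigma>\<in>S. w g \<sigma> * (v' (H g \<sigma>) * \<psi> \<sigma> g))" for g
  define V2 where "V2 g = (\<Sum>\<sigma>\<in>S. w g \<sigma> * (v (H g \<sigma>) * \<psi> \<sigma> g))" for g
  define A1 where "A1 g = (\<Sum>\<sigma>\<in>S. w g \<sigma> * f' (H g \<sigma>))" for g
  define A2 where "A2 g = (\<Sum>\<sigma>\<in>S. w g \<sigma> * (f (H g \<sigma>) * (1 + 2 * (\<Sum>\<tau>\<in>S. w g \<tau> * Q \<sigma> \<tau>))))" for g
  define E where "E h g = (\<Sum>\<sigma>\<in>S. w g \<sigma> * (b0 * (h (H g \<sigma>) * \<psi> \<sigma> g * (1 + (\<Sum>\<tau>\<in>S. w g \<tau> * Q \<sigma> \<tau>)))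
      - h (H g \<sigma>) * (\<Sum>\<tau>\<in>S. Q \<sigma> \<tau> * D\<psi> \<sigma> g \<tau>)))" for h :: "real \<Rightarrow> real" and g
  have bmV: "bounded_rv V1" "bounded_rv V2" "bounded_rv A1" "bounded_rv A2" "bounded_rv (E f)" "bounded_rv (E v)"
    unfolding V1_def[abs_def] V2_def[abs_def] A1_def[abs_def] A2_def[abs_def] E_def[abs_def]
    by (intro bounded_rv_intros bmH bounded_rv\<psi> bmD\<psi>; assumption)+
  note int = bounded_rv_integrable[OF bmV(1)] bounded_rv_integrable[OF bmV(2)] bounded_rv_integrable[OF bmV(5)] bounded_rv_integrable[OF bmV(6)]
    bounded_rv_integrable[OF bounded_rv_mean_Q_sq]
  have Eb: "\<bar>E h g\<bar> \<le> B\<^sup>2 * (1 + mean_Q_sq g) * (1 / N + 4 * b0)" if "\<And>x. \<bar>h x\<bar> \<le> B" for h g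
    unfolding E_def D\<psi>_def by (rule remainder_bound(2)[OF bounds(1,2) that]) (simp add: \<psi>_def)
  have \<psi>b: "\<bar>\<psi> \<sigma> g\<bar> \<le> B * avg_abs_Q g \<sigma>" for \<sigma> g
    by (rule remainder_bound(1)[OF bounds(1,2) bounds(1), where g=g and \<psi>="\<lambda>\<tau>. \<psi> \<tau> g"]) (simp add: \<psi>_def)
  have KW0: "0 \<le> KW" using mean_Q_sq_nonneg by (intro order.trans[OF _ KW] Bochner_Integration.integral_nonneg)
  have KH0: "0 \<le> KH" using p_nonneg
    by (intro order.trans[OF _ KH] Bochner_Integration.integral_nonneg sum_nonneg) auto
  have intE: "\<bar>\<integral>g. E h g \<partial>G\<bar> \<le> B\<^sup>2 * (1 + KW) * (1 / N + 4 * b0)"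
    if h: "\<And>x. \<bar>h x\<bar> \<le> B" and bE: "bounded_rv (E h)" for h
  proof -
    have "\<bar>\<integral>g. E h g \<partial>G\<bar> \<le> (\<integral>g. B\<^sup>2 * (1 + mean_Q_sq g) * (1 / N + 4 * b0) \<partial>G)"
      using bounded_rv_integrable[OF bE] bounded_rv_integrable[OF bounded_rv_mean_Q_sq] Eb[OF h]
      by (intro order.trans[OF integral_abs_bound] integral_mono) auto
    also have "\<dots> = B\<^sup>2 * (1 + (\<integral>g. mean_Q_sq g \<partial>G)) * (1 / N + 4 * b0)"
      using bounded_rv_integrable[OF bounded_rv_mean_Q_sq] by (simp add: prob_space)
    also have "\<dots> \<le> B\<^sup>2 * (1 + KW) * (1 / N + 4 * b0)"
      using KW b0 N_pos by (intro mult_right_mono mult_left_mono) auto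
    finally show ?thesis .
  qed

  \<comment> \<open>Stein's equation rewrites one factor of \<open>(\<phi> g)\<^sup>2\<close>; the
    other factor, constant in \<open>\<sigma>\<close>, is the test function.\<close>
  have eq1: "(\<integral>g. (\<phi> g)\<^sup>2 \<partial>G) = (\<integral>g. 1 / N * (A1 g * \<phi> g) + b0 * (\<phi> g * A2 g) - 1 / N * V1 g - b0 * V2 g \<partial>G)"
  proof -
    have "(\<phi> g)\<^sup>2 = (\<Sum>\<sigma>\<in>S. w g \<sigma> * ((f' (H g \<sigma>) - 2 * H g \<sigma> * f (H g \<sigma>)) * \<phi> g))" for g
      unfolding stein power2_eq_square by (simp add: \<phi>_def sum_distrib_right mult_ac)
    then have "(\<integral>g. (\<phi> g)\<^sup>2 \<partial>G) = (\<integral>g. (\<Sum>\<sigma>\<in>S. w g \<sigma> * (1 / N * (f' (H g \<sigma>) * \<phi> g)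
        + b0 * (f (H g \<sigma>) * \<phi> g * (1 + (\<Sum>\<tau>\<in>S. w g \<tau> * Q \<sigma> \<tau>)))
        - f (H g \<sigma>) * (\<Sum>\<tau>\<in>S. Q \<sigma> \<tau> * D\<phi> g \<tau>))) \<partial>G)"
      using stein_ibp(2)[where f=f and f'=f' and \<psi>="\<lambda>_. \<phi>" and D="\<lambda>_. D\<phi>", OF f f'm bounds(1,2) bounded_rv\<phi> bmD\<phi> xd\<phi>] by simp
    also have "\<dots> = (\<integral>g. 1 / N * (A1 g * \<phi> g) + b0 * (\<phi> g * A2 g) - 1 / N * V1 g - b0 * V2 g \<partial>G)"
    proof (rule Bochner_Integration.integral_cong[OF refl])
      fix g
      define qb where "qb \<sigma> = (\<Sum>\<tau>\<in>S. w g \<tau> * Q \<sigma> \<tau>)" for \<sigma>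
      \<comment> \<open>Exchanging the sums gathers
        \<open>f (H g \<sigma>) * Q \<sigma> \<tau>\<close> into \<open>\<psi>\<close>, so the
        derivative of \<open>\<phi>\<close> is tested against \<open>\<psi>\<close>. Its
        \<open>v'\<close> part becomes \<open>V1\<close>, its \<open>v\<close> part
        \<open>V2\<close>, and the centering by \<open>\<phi>\<close> doubles the overlap term in
        \<open>A2\<close>.\<close>
      have sw: "(\<Sum>\<sigma>\<in>S. w g \<sigma> * (f (H g \<sigma>) * (\<Sum>\<tau>\<in>S. Q \<sigma> \<tau> * x \<tau>))) = (\<Sum>\<tau>\<in>S. x \<tau> * \<psi> \<tau> g)" for x
        unfolding \<psi>_def sum_distrib_left by (subst sum.swap) (simp add: mult_ac)
      have 1: "(\<Sum>\<sigma>\<in>S. w g \<sigma> * (f (H g \<sigma>) * (\<Sum>\<tau>\<in>S. Q \<sigma> \<tau> * D\<phi> g \<tau>))) = 1 / N * V1 g + b0 * V2 g - b0 * \<phi> g * (\<Sum>\<tau>\<in>S. w g \<tau> * \<psi> \<tau> g)"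
      proof -
        have "(\<Sum>\<sigma>\<in>S. w g \<sigma> * (f (H g \<sigma>) * (\<Sum>\<tau>\<in>S. Q \<sigma> \<tau> * D\<phi> g \<tau>))) = (\<Sum>\<tau>\<in>S. D\<phi> g \<tau> * \<psi> \<tau> g)" by (rule sw)
        also have "\<dots> = (\<Sum>\<tau>\<in>S. 1 / N * (w g \<tau> * (v' (H g \<tau>) * \<psi> \<tau> g)) + b0 * (w g \<tau> * (v (H g \<tau>) * \<psi> \<tau> g)) - b0 * \<phi> g * (w g \<tau> * \<psi> \<tau> g))"
          by (intro sum.cong refl) (simp add: D\<phi>_def algebra_simps)
        finally show ?thesis unfolding V1_def V2_def by (simp only: sum.distrib sum_subtractf sum_distrib_left)
      qed
      have 2: "(\<Sum>\<tau>\<in>S. w g \<tau> * \<psi> \<tau> g) = (\<Sum>\<sigma>\<in>S. w g \<sigma> * (f (H g \<sigma>) * qb \<sigma>))"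
        unfolding sw[of "w g", symmetric] qb_def by (simp add: mult.commute)
      define t where "t \<sigma> = (\<Sum>\<tau>\<in>S. Q \<sigma> \<tau> * D\<phi> g \<tau>)" for \<sigma>
      have "(\<Sum>\<sigma>\<in>S. w g \<sigma> * (1 / N * (f' (H g \<sigma>) * \<phi> g)
        + b0 * (f (H g \<sigma>) * \<phi> g * (1 + qb \<sigma>)) - f (H g \<sigma>) * (\<Sum>\<tau>\<in>S. Q \<sigma> \<tau> * D\<phi> g \<tau>)))
        = 1 / N * (A1 g * \<phi> g) + b0 * (\<phi> g * (\<Sum>\<sigma>\<in>S. w g \<sigma> * (f (H g \<sigma>) * (1 + qb \<sigma>))))
          - (\<Sum>\<sigma>\<in>S. w g \<sigma> * (f (H g \<sigma>) * (\<Sum>\<tau>\<in>S. Q \<sigma> \<tau> * D\<phi> g \<tau>)))"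
        unfolding t_def[symmetric] A1_def sum_distrib_left sum_distrib_right sum.distrib[symmetric] sum_subtractf[symmetric]
        by (intro sum.cong refl) (simp only: distrib_left right_diff_distrib mult_ac)
      also have "\<dots> = 1 / N * (A1 g * \<phi> g) + b0 * (\<phi> g * ((\<Sum>\<sigma>\<in>S. w g \<sigma> * (f (H g \<sigma>) * (1 + qb \<sigma>))) + (\<Sum>\<sigma>\<in>S. w g \<sigma> * (f (H g \<sigma>) * qb \<sigma>))))
          - 1 / N * V1 g - b0 * V2 g"
        unfolding 1 2 by (simp only: algebra_simps)
      also have "(\<Sum>\<sigma>\<in>S. w g \<sigma> * (f (H g \<sigma>) * (1 + qb \<sigma>))) + (\<Sum>\<sigma>\<in>S. w g \<sigma> * (f (H g \<sigma>) * qb \<sigma>)) = A2 g"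
        unfolding A2_def qb_def[symmetric] sum.distrib[symmetric] by (intro sum.cong refl) (simp add: algebra_simps)
      finally show "(\<Sum>\<sigma>\<in>S. w g \<sigma> * (1 / N * (f' (H g \<sigma>) * \<phi> g)
        + b0 * (f (H g \<sigma>) * \<phi> g * (1 + (\<Sum>\<tau>\<in>S. w g \<tau> * Q \<sigma> \<tau>)))
        - f (H g \<sigma>) * (\<Sum>\<tau>\<in>S. Q \<sigma> \<tau> * D\<phi> g \<tau>))) = 1 / N * (A1 g * \<phi> g) + b0 * (\<phi> g * A2 g) - 1 / N * V1 g - b0 * V2 g"
        unfolding qb_def .
    qed
    finally show ?thesis .
  qed

  \<comment> \<open>Writing \<open>v\<close> as \<open>f' - 2 H f\<close> once more gains a factor
    of order \<open>1 / sqrt N\<close>, so that \<open>b0\<close> times this integral has order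
    \<open>1 / N\<close>.\<close>
  have V2: "\<bar>\<integral>g. V2 g \<partial>G\<bar> \<le> B\<^sup>2 * (1 + KW) * (2 / N + 4 * b0)"
  proof -
    define F where "F g = (\<Sum>\<sigma>\<in>S. w g \<sigma> * (f' (H g \<sigma>) * \<psi> \<sigma> g))" for g
    have bmF: "bounded_rv F" unfolding F_def[abs_def] by (intro bounded_rv_intros bmH bounded_rv\<psi>)
    have Fb: "\<bar>F g\<bar> \<le> B\<^sup>2 * (1 + mean_Q_sq g)" for g
    proof -
      have "\<bar>F g\<bar> \<le> (\<Sum>\<sigma>\<in>S. w g \<sigma> * (B * (B * avg_abs_Q g \<sigma>)))"
        unfolding F_def using bounds(2) \<psi>b B avg_abs_Q_nonneg by (intro avg_abs) (auto simp: abs_mult intro!: mult_mono)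
      also have "\<dots> = B\<^sup>2 * (\<Sum>\<sigma>\<in>S. w g \<sigma> * avg_abs_Q g \<sigma>)" by (simp add: sum_distrib_left power2_eq_square mult_ac)
      also have "\<dots> \<le> B\<^sup>2 * (1 + mean_Q_sq g)" using avg_avg_abs_Q_le by (intro mult_left_mono) auto
      finally show ?thesis .
    qed
    have "\<bar>\<integral>g. F g \<partial>G\<bar> \<le> (\<integral>g. B\<^sup>2 * (1 + mean_Q_sq g) \<partial>G)"
      using bounded_rv_integrable[OF bmF] int(5) Fb by (intro order.trans[OF integral_abs_bound] integral_mono) auto
    also have "\<dots> = B\<^sup>2 * (1 + (\<integral>g. mean_Q_sq g \<partial>G))" using int(5) by (simp add: prob_space)
    also have "\<dots> \<le> B\<^sup>2 * (1 + KW)" using KW by (intro mult_left_mono) auto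
    finally have F1: "\<bar>\<integral>g. F g \<partial>G\<bar> \<le> B\<^sup>2 * (1 + KW)" .
    have "(\<integral>g. V2 g \<partial>G) = (\<integral>g. 1 / N * F g + E f g \<partial>G)"
      using stein_ibp(2)[where f=f and f'=f' and \<psi>=\<psi> and D=D\<psi>, OF f f'm bounds(1,2) bounded_rv\<psi> bmD\<psi> xd\<psi>]
      unfolding V2_def F_def E_def stein by (simp add: sum_distrib_left sum.distrib[symmetric] algebra_simps)
    also have "\<dots> = 1 / N * (\<integral>g. F g \<partial>G) + (\<integral>g. E f g \<partial>G)"
      using bounded_rv_integrable[OF bmF] int(3) by simp
    finally have "\<bar>\<integral>g. V2 g \<partial>G\<bar> \<le> \<bar>1 / N * (\<integral>g. F g \<partial>G)\<bar> + \<bar>\<integral>g. E f g \<partial>G\<bar>" by linarith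
    also have "\<dots> \<le> 1 / N * (B\<^sup>2 * (1 + KW)) + B\<^sup>2 * (1 + KW) * (1 / N + 4 * b0)"
      using F1 intE[OF bounds(1) bmV(5)] N_pos by (intro add_mono) (auto simp: abs_mult divide_right_mono)
    finally show ?thesis by (simp add: algebra_simps)
  qed

  \<comment> \<open>With \<open>v\<close> in the role of \<open>f\<close>, the identity has
    \<open>v' - 2 H v\<close> on the left and only \<open>1 / N\<close> times \<open>v'\<close> on
    the right. Solving for \<open>V1\<close> eliminates \<open>B'\<close>. A bound of order
    \<open>1\<close> is enough, because \<open>V1\<close> enters with the factor
    \<open>1 / N\<close>.\<close>
  have V1: "\<bar>\<integral>g. V1 g \<partial>G\<bar> \<le> 2 * B\<^sup>2 * (KH + KW + 5 * (1 + KW))"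
  proof -
    define F where "F g = (\<Sum>\<sigma>\<in>S. w g \<sigma> * (2 * H g \<sigma> * v (H g \<sigma>) * \<psi> \<sigma> g))" for g
    define HH where "HH g = (\<Sum>\<sigma>\<in>S. w g \<sigma> * (H g \<sigma>)\<^sup>2)" for g
    note st = stein_ibp[where f=v and f'=v' and \<psi>=\<psi> and D=D\<psi>, OF v v'm bounds(3,4) bounded_rv\<psi> bmD\<psi> xd\<psi>]
    have Fe: "(\<Sum>\<sigma>\<in>S. w g \<sigma> * ((v' (H g \<sigma>) - 2 * H g \<sigma> * v (H g \<sigma>)) * \<psi> \<sigma> g)) = V1 g - F g" for g
      unfolding V1_def F_def sum_subtractf[symmetric] by (intro sum.cong refl) (simp add: algebra_simps)
    have intF: "integrable G F"
      using Bochner_Integration.integrable_diff[OF int(1) st(1)] unfolding Fe by simp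
    have "(\<integral>g. V1 g - F g \<partial>G) = (\<integral>g. 1 / N * V1 g + E v g \<partial>G)"
      using st(2) unfolding Fe unfolding V1_def E_def by (simp add: sum_distrib_left sum.distrib[symmetric] algebra_simps)
    then have "(1 - 1 / N) * (\<integral>g. V1 g \<partial>G) = (\<integral>g. F g \<partial>G) + (\<integral>g. E v g \<partial>G)"
      using int intF by (simp add: algebra_simps)
    moreover have Nh: "1 / 2 \<le> 1 - 1 / N" using N_pos by (simp add: field_simps)
    moreover have "1 / 2 * \<bar>\<integral>g. V1 g \<partial>G\<bar> \<le> \<bar>(1 - 1 / N) * (\<integral>g. V1 g \<partial>G)\<bar>"
      unfolding abs_mult using Nh by (intro mult_right_mono) auto
    moreover have "\<bar>\<integral>g. F g \<partial>G\<bar> \<le> B\<^sup>2 * (KH + KW)"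
    proof -
      have Hm: "HH \<in> borel_measurable G" unfolding HH_def[abs_def] H_def by measurable
      have "integrable G HH"
      proof (rule integrable_growth_square_bound[OF Hm])
        fix g
        have Hb: "\<bar>H g \<sigma>\<bar> \<le> (1 + sqrt N) * growth g" if "\<sigma> \<in> S" for \<sigma>
        proof -
          have "\<bar>1 / N * X g \<sigma>\<bar> \<le> 1 * growth g"
            unfolding abs_mult using N_pos abs_X_le[OF that, of g] by (intro mult_mono) auto
          moreover have "\<bar>sqrt N * \<beta> / 2\<bar> \<le> sqrt N * growth g"
          proof -
            have "\<beta> / 2 \<le> growth g" using beta growth_ge_1[of g] by linarith
            then have "sqrt N * (\<beta> / 2) \<le> sqrt N * growth g" using N_pos by (intro mult_left_mono) auto
            then show ?thesis using beta N_pos by (simp add: abs_mult)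
          qed
          moreover have "\<bar>H g \<sigma>\<bar> \<le> \<bar>1 / N * X g \<sigma>\<bar> + \<bar>sqrt N * \<beta> / 2\<bar>"
            unfolding H_def by (rule abs_triangle_ineq4)
          moreover have "(1 + sqrt N) * growth g = 1 * growth g + sqrt N * growth g" by (simp add: distrib_right)
          ultimately show ?thesis by linarith
        qed
        have "\<bar>(H g \<sigma>)\<^sup>2\<bar> \<le> ((1 + sqrt N) * growth g)\<^sup>2" if "\<sigma> \<in> S" for \<sigma>
          using power_mono[OF Hb[OF that], of 2] by simp
        then have "\<bar>HH g\<bar> \<le> ((1 + sqrt N) * growth g)\<^sup>2" unfolding HH_def by (rule avg_bound)
        then show "\<bar>HH g\<bar> \<le> (1 + sqrt N)\<^sup>2 * (growth g)\<^sup>2" by (simp add: power_mult_distrib)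
      qed
      moreover have "\<bar>F g\<bar> \<le> B\<^sup>2 * (HH g + mean_Q_sq g)" for g
      proof -
        have "\<bar>F g\<bar> \<le> (\<Sum>\<sigma>\<in>S. w g \<sigma> * (B\<^sup>2 * ((H g \<sigma>)\<^sup>2 + (avg_abs_Q g \<sigma>)\<^sup>2)))"
          unfolding F_def
        proof (rule avg_abs)
          fix \<sigma>
          have "\<bar>2 * H g \<sigma> * v (H g \<sigma>) * \<psi> \<sigma> g\<bar> \<le> 2 * \<bar>H g \<sigma>\<bar> * B * (B * avg_abs_Q g \<sigma>)"
            unfolding abs_mult using bounds(3)[of "H g \<sigma>"] \<psi>b[of \<sigma> g] B by (intro mult_mono) auto
          also have "\<dots> = B\<^sup>2 * (2 * \<bar>H g \<sigma>\<bar> * avg_abs_Q g \<sigma>)" by (simp add: power2_eq_square)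
          also have "\<dots> \<le> B\<^sup>2 * ((H g \<sigma>)\<^sup>2 + (avg_abs_Q g \<sigma>)\<^sup>2)"
            using sum_squares_bound[of "\<bar>H g \<sigma>\<bar>" "avg_abs_Q g \<sigma>"] by (intro mult_left_mono) auto
          finally show "\<bar>2 * H g \<sigma> * v (H g \<sigma>) * \<psi> \<sigma> g\<bar> \<le> B\<^sup>2 * ((H g \<sigma>)\<^sup>2 + (avg_abs_Q g \<sigma>)\<^sup>2)" .
        qed
        also have "\<dots> = B\<^sup>2 * (HH g + (\<Sum>\<sigma>\<in>S. w g \<sigma> * (avg_abs_Q g \<sigma>)\<^sup>2))"
          unfolding HH_def sum.distrib[symmetric] sum_distrib_left by (intro sum.cong refl) (simp add: algebra_simps)
        also have "\<dots> \<le> B\<^sup>2 * (HH g + mean_Q_sq g)" using avg_avg_abs_Q_square[of g] by (intro mult_left_mono) auto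
        finally show ?thesis .
      qed
      ultimately have "\<bar>\<integral>g. F g \<partial>G\<bar> \<le> (\<integral>g. B\<^sup>2 * (HH g + mean_Q_sq g) \<partial>G)"
        using intF int(5) by (intro order.trans[OF integral_abs_bound] integral_mono) auto
      also have "\<dots> = B\<^sup>2 * ((\<integral>g. HH g \<partial>G) + (\<integral>g. mean_Q_sq g \<partial>G))" using \<open>integrable G HH\<close> int(5) by simp
      also have "\<dots> \<le> B\<^sup>2 * (KH + KW)" using KW KH unfolding HH_def by (intro mult_left_mono add_mono) auto
      finally show ?thesis .
    qed
    moreover have "\<bar>\<integral>g. E v g \<partial>G\<bar> \<le> B\<^sup>2 * (5 * (1 + KW))"
    proof -
      have "1 / N \<le> 1" using N_pos by simp
      then have "1 / N + 4 * b0 \<le> 5" using b0 by linarith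
      then have "B\<^sup>2 * (1 + KW) * (1 / N + 4 * b0) \<le> B\<^sup>2 * (1 + KW) * 5" using KW0 by (intro mult_left_mono) auto
      then show ?thesis using intE[OF bounds(3) bmV(6)] by (simp add: algebra_simps)
    qed
    ultimately have "1 / 2 * \<bar>\<integral>g. V1 g \<partial>G\<bar> \<le> B\<^sup>2 * (KH + KW) + B\<^sup>2 * (5 * (1 + KW))" by linarith
    then show ?thesis by (simp add: algebra_simps)
  qed

  have pw: "1 / N * (A1 g * \<phi> g) + b0 * (\<phi> g * A2 g) \<le> B\<^sup>2 / N + (\<phi> g)\<^sup>2 / 2 + B\<^sup>2 / N * (1 + 4 * mean_Q_sq g)" for g
  proof -
    have "\<bar>A1 g\<bar> \<le> B" "\<bar>\<phi> g\<bar> \<le> B" unfolding A1_def \<phi>_def using bounds by (auto intro: avg_bound)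
    then have "\<bar>A1 g * \<phi> g\<bar> \<le> B * B" unfolding abs_mult by (intro mult_mono) auto
    then have 1: "1 / N * (A1 g * \<phi> g) \<le> B\<^sup>2 / N" using N_pos by (simp add: power2_eq_square divide_right_mono)
    define a where "a = (\<Sum>\<sigma>\<in>S. w g \<sigma> * avg_abs_Q g \<sigma>)"
    have a: "a\<^sup>2 \<le> mean_Q_sq g" using avg_avg_abs_Q by (simp add: a_def)
    have "\<bar>A2 g\<bar> \<le> (\<Sum>\<sigma>\<in>S. w g \<sigma> * (B + 2 * B * avg_abs_Q g \<sigma>))"
      unfolding A2_def
    proof (rule avg_abs)
      fix \<sigma>
      have "\<bar>1 + 2 * (\<Sum>\<tau>\<in>S. w g \<tau> * Q \<sigma> \<tau>)\<bar> \<le> 1 + 2 * avg_abs_Q g \<sigma>" using abs_avg_Q_le[of g \<sigma>] by linarith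
      then have "\<bar>f (H g \<sigma>) * (1 + 2 * (\<Sum>\<tau>\<in>S. w g \<tau> * Q \<sigma> \<tau>))\<bar> \<le> B * (1 + 2 * avg_abs_Q g \<sigma>)"
        unfolding abs_mult using bounds(1)[of "H g \<sigma>"] B by (intro mult_mono) auto
      then show "\<bar>f (H g \<sigma>) * (1 + 2 * (\<Sum>\<tau>\<in>S. w g \<tau> * Q \<sigma> \<tau>))\<bar> \<le> B + 2 * B * avg_abs_Q g \<sigma>" by (simp add: algebra_simps)
    qed
    also have "\<dots> = B * (1 + 2 * a)" unfolding avg_lin a_def by (simp add: algebra_simps)
    finally have "(A2 g)\<^sup>2 \<le> (B * (1 + 2 * a))\<^sup>2" by (metis abs_ge_zero power2_abs power_mono)
    also have "\<dots> \<le> B\<^sup>2 * (2 * (1 + 4 * a\<^sup>2))"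
      unfolding power_mult_distrib
    proof (intro mult_left_mono)
      show "(1 + 2 * a)\<^sup>2 \<le> 2 * (1 + 4 * a\<^sup>2)"
        using zero_le_power2[of "1 - 2 * a"] by (simp add: power2_eq_square algebra_simps)
    qed simp
    also have "\<dots> \<le> B\<^sup>2 * (2 * (1 + 4 * mean_Q_sq g))" using a by (intro mult_left_mono) auto
    finally have A2: "(A2 g)\<^sup>2 \<le> B\<^sup>2 * (2 * (1 + 4 * mean_Q_sq g))" .
    \<comment> \<open>Half of \<open>(\<phi> g)\<^sup>2\<close> is given up here and moved to the
      left side at the end, whence the overall factor \<open>2\<close>.\<close>
    have "b0 * (\<phi> g * A2 g) \<le> (\<phi> g)\<^sup>2 / 2 + b0\<^sup>2 * (A2 g)\<^sup>2 / 2"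
      using zero_le_power2[of "\<phi> g - b0 * A2 g"] by (simp add: power2_eq_square algebra_simps)
    also have "b0\<^sup>2 * (A2 g)\<^sup>2 \<le> 1 / N * (B\<^sup>2 * (2 * (1 + 4 * mean_Q_sq g)))"
      using b0(4) A2 N_pos by (intro mult_mono) auto
    also have "1 / N * (B\<^sup>2 * (2 * (1 + 4 * mean_Q_sq g))) / 2 = B\<^sup>2 / N * (1 + 4 * mean_Q_sq g)" using N_pos by (simp add: divide_simps algebra_simps)
    finally have 2: "b0 * (\<phi> g * A2 g) \<le> (\<phi> g)\<^sup>2 / 2 + B\<^sup>2 / N * (1 + 4 * mean_Q_sq g)" by simp
    show ?thesis using 1 2 by linarith
  qed
  have bounded_rv\<phi>2: "bounded_rv (\<lambda>g. (\<phi> g)\<^sup>2)" unfolding power2_eq_square by (intro bounded_rv_intros bounded_rv\<phi>)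
  have "(\<integral>g. (\<phi> g)\<^sup>2 \<partial>G) \<le> (\<integral>g. (B\<^sup>2 / N + (\<phi> g)\<^sup>2 / 2 + B\<^sup>2 / N * (1 + 4 * mean_Q_sq g)) - 1 / N * V1 g - b0 * V2 g \<partial>G)"
    unfolding eq1
  proof (rule integral_mono)
    show "integrable G (\<lambda>g. 1 / N * (A1 g * \<phi> g) + b0 * (\<phi> g * A2 g) - 1 / N * V1 g - b0 * V2 g)"
      by (intro bounded_rv_integrable bounded_rv_intros bounded_rv\<phi> bmV)
    show "integrable G (\<lambda>g. (B\<^sup>2 / N + (\<phi> g)\<^sup>2 / 2 + B\<^sup>2 / N * (1 + 4 * mean_Q_sq g)) - 1 / N * V1 g - b0 * V2 g)"
      using int bounded_rv_integrable[OF bounded_rv\<phi>2] by simp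
  qed (intro diff_right_mono pw)
  also have "\<dots> = B\<^sup>2 / N + (\<integral>g. (\<phi> g)\<^sup>2 \<partial>G) / 2 + B\<^sup>2 / N * (1 + 4 * (\<integral>g. mean_Q_sq g \<partial>G)) - 1 / N * (\<integral>g. V1 g \<partial>G) - b0 * (\<integral>g. V2 g \<partial>G)"
    using int bounded_rv_integrable[OF bounded_rv\<phi>2] by (simp add: prob_space)
  finally have main: "(\<integral>g. (\<phi> g)\<^sup>2 \<partial>G) / 2 \<le> B\<^sup>2 / N + B\<^sup>2 / N * (1 + 4 * (\<integral>g. mean_Q_sq g \<partial>G)) - 1 / N * (\<integral>g. V1 g \<partial>G) - b0 * (\<integral>g. V2 g \<partial>G)"
    by linarith
  have "- (1 / N * (\<integral>g. V1 g \<partial>G)) \<le> B\<^sup>2 / N * (2 * (KH + KW + 5 * (1 + KW)))"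
  proof -
    have "1 / N * - (\<integral>g. V1 g \<partial>G) \<le> 1 / N * (2 * B\<^sup>2 * (KH + KW + 5 * (1 + KW)))"
      using V1 N_pos by (intro mult_left_mono) auto
    then show ?thesis by (simp add: field_simps)
  qed
  moreover have "- (b0 * (\<integral>g. V2 g \<partial>G)) \<le> B\<^sup>2 / N * (6 * (1 + KW))"
  proof -
    have "2 / N + 4 * b0 \<le> 6 * (1 / sqrt N)" using N_sqrt b0(2) by simp
    then have "B\<^sup>2 * (1 + KW) * (2 / N + 4 * b0) \<le> B\<^sup>2 * (1 + KW) * (6 * (1 / sqrt N))"
      using KW0 by (intro mult_left_mono) auto
    then have "b0 * - (\<integral>g. V2 g \<partial>G) \<le> b0 * (B\<^sup>2 * (1 + KW) * (6 * (1 / sqrt N)))"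
      using V2 b0 by (intro mult_left_mono) auto
    also have "\<dots> \<le> 1 / sqrt N * (B\<^sup>2 * (1 + KW) * (6 * (1 / sqrt N)))"
      using b0 KW0 N_pos by (intro mult_right_mono) auto
    also have "\<dots> = B\<^sup>2 / (sqrt N * sqrt N) * (6 * (1 + KW))" by (simp add: field_simps)
    finally show ?thesis using N_pos by simp
  qed
  moreover have "B\<^sup>2 / N * (1 + 4 * (\<integral>g. mean_Q_sq g \<partial>G)) \<le> B\<^sup>2 / N * (1 + 4 * KW)"
    using KW N_pos by (intro mult_left_mono) auto
  ultimately have "(\<integral>g. (\<phi> g)\<^sup>2 \<partial>G) / 2 \<le> B\<^sup>2 / N + B\<^sup>2 / N * (1 + 4 * KW) + B\<^sup>2 / N * (2 * (KH + KW + 5 * (1 + KW))) + B\<^sup>2 / N * (6 * (1 + KW))"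
    using main by linarith
  also have "\<dots> = B\<^sup>2 / N * (18 + 22 * KW + 2 * KH)" by (simp add: algebra_simps add_divide_distrib)
  also have "\<dots> \<le> B\<^sup>2 / N * (20 + 22 * KW + 2 * KH)" using N_pos by (intro mult_left_mono) auto
  finally show ?thesis unfolding \<phi>_def by (simp add: field_simps)
qed

end

section \<open>Stein's equation\<close>

lemma phi_half_conv_normal: "phi_half = normal_density 0 (1 / sqrt 2)"
  by (auto simp: fun_eq_iff phi_half_def normal_density_def power_divide real_sqrt_mult[symmetric])

lemma phi_half_integrable: "integrable lborel phi_half" "(\<integral>t. phi_half t \<partial>lborel) = 1"
  unfolding phi_half_conv_normal by simp_all

lemma exp_neg_square_integrable: "integrable lborel (\<lambda>t::real. exp (- t\<^sup>2))"
  "(\<integral>t. exp (- t\<^sup>2) \<partial>lborel) = sqrt pi"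
proof -
  have eq: "exp (- t\<^sup>2) = sqrt pi * phi_half t" for t by (simp add: phi_half_def)
  show "integrable lborel (\<lambda>t::real. exp (- t\<^sup>2))" "(\<integral>t. exp (- t\<^sup>2) \<partial>lborel) = sqrt pi"
    unfolding eq using phi_half_integrable by simp_all
qed

text \<open>The complementary error function multiplied by \<open>sqrt pi / 2\<close>.\<close>

definition gauss_tail :: "real \<Rightarrow> real" where
  "gauss_tail x = (\<integral>t. indicator {x..} t * exp (- t\<^sup>2) \<partial>lborel)"

lemma gauss_tail_integrable: "integrable lborel (\<lambda>t. indicator {x..} t * exp (- t\<^sup>2) :: real)"
  using integrable_mult_indicator[OF _ exp_neg_square_integrable(1), of "{x..}"] by simp

text \<open>For \<open>t \<ge> x \<ge> 0\<close> one has
  \<open>t\<^sup>2 \<ge> x\<^sup>2 + (t - x)\<^sup>2\<close>. This bounds the Stein solution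
  itself.\<close>

lemma gauss_tail_bound1:
  assumes "0 \<le> x"
  shows "exp (x\<^sup>2) * gauss_tail x \<le> sqrt pi"
proof -
  have i: "integrable lborel (\<lambda>t. exp (- x\<^sup>2) * exp (- (t - x)\<^sup>2))"
    using lborel_integrable_real_affine[OF exp_neg_square_integrable(1), of 1 "- x"] by (simp add: add.commute)
  have "gauss_tail x \<le> (\<integral>t. exp (- x\<^sup>2) * exp (- (t - x)\<^sup>2) \<partial>lborel)"
    unfolding gauss_tail_def
  proof (rule integral_mono[OF gauss_tail_integrable i])
    fix t
    have "x * x \<le> x * t" if "x \<le> t" using that assms by (rule mult_left_mono)
    then have "- t\<^sup>2 \<le> - x\<^sup>2 + - (t - x)\<^sup>2" if "x \<le> t" using that by (simp add: power2_eq_square algebra_simps)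
    then show "indicator {x..} t * exp (- t\<^sup>2) \<le> exp (- x\<^sup>2) * exp (- (t - x)\<^sup>2)"
      by (simp add: indicator_def flip: exp_add)
  qed
  also have "\<dots> = exp (- x\<^sup>2) * sqrt pi"
    using lborel_integral_real_affine[of 1 "\<lambda>t. exp (- t\<^sup>2)" "- x"] exp_neg_square_integrable(2)
    by (simp add: add.commute)
  finally have "exp (x\<^sup>2) * gauss_tail x \<le> exp (x\<^sup>2) * (exp (- x\<^sup>2) * sqrt pi)" by (intro mult_left_mono) auto
  then show ?thesis by (simp add: mult.assoc[symmetric] flip: exp_add)
qed

text \<open>The Mills ratio bound: on \<open>t \<ge> x\<close> the factor \<open>2 * x\<close> is at
  most \<open>2 * t\<close>, which makes the integrand an exact derivative. It controls the
  unbounded coefficient in Stein's equation.\<close>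

lemma gauss_tail_bound2:
  assumes "0 \<le> x"
  shows "exp (x\<^sup>2) * (2 * x * gauss_tail x) \<le> 1"
proof -
  have nn: "(\<integral>\<^sup>+t. ennreal (2 * t * exp (- t\<^sup>2)) * indicator {x..} t \<partial>lborel) = ennreal (0 - - exp (- x\<^sup>2))"
  proof (rule nn_integral_FTC_atLeast)
    fix t assume "x \<le> t"
    show "((\<lambda>t. - exp (- t\<^sup>2)) has_real_derivative 2 * t * exp (- t\<^sup>2)) (at t)"
      by (auto intro!: derivative_eq_intros)
    show "0 \<le> 2 * t * exp (- t\<^sup>2)" using \<open>x \<le> t\<close> assms by simp
  next
    have "filterlim (\<lambda>t::real. t\<^sup>2) at_top at_top" by (intro filterlim_pow_at_top filterlim_ident) auto
    then have "((\<lambda>t::real. exp (- t\<^sup>2)) \<longlongrightarrow> 0) at_top"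
      by (intro filterlim_compose[OF exp_at_bot]) (simp add: filterlim_uminus_at_bot)
    from tendsto_minus[OF this] show "((\<lambda>t::real. - exp (- t\<^sup>2)) \<longlongrightarrow> 0) at_top" by simp
  qed simp
  have "ennreal (2 * x * gauss_tail x) = (\<integral>\<^sup>+t. ennreal (2 * x * (indicator {x..} t * exp (- t\<^sup>2))) \<partial>lborel)"
    unfolding gauss_tail_def using gauss_tail_integrable[of x] assms
    by (subst nn_integral_eq_integral) auto
  also have "\<dots> \<le> (\<integral>\<^sup>+t. ennreal (2 * t * exp (- t\<^sup>2)) * indicator {x..} t \<partial>lborel)"
    using assms by (intro nn_integral_mono) (auto simp: indicator_def)
  finally have "2 * x * gauss_tail x \<le> exp (- x\<^sup>2)" unfolding nn by simp
  then have "exp (x\<^sup>2) * (2 * x * gauss_tail x) \<le> exp (x\<^sup>2) * exp (- x\<^sup>2)" by (intro mult_left_mono) auto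
  then show ?thesis by (simp flip: exp_add)
qed

text \<open>Variation of constants: \<open>f x\<close> is \<open>exp (x\<^sup>2)\<close> times the
  integral of \<open>v t * exp (- t\<^sup>2)\<close> up to \<open>x\<close>. The first tail bound
  with \<open>sqrt pi < 2\<close> controls \<open>f\<close>; the second controls
  \<open>2 x f\<close> by \<open>M\<close>, and the equation then bounds \<open>f'\<close> by
  \<open>2 M\<close>.\<close>

lemma stein_solution:
  fixes v :: "real \<Rightarrow> real"
  assumes cont: "continuous_on UNIV v" and bnd: "\<And>x. \<bar>v x\<bar> \<le> M" and zero: "(\<integral>t. v t * phi_half t \<partial>lborel) = 0"
  obtains f f' where "\<And>x. (f has_real_derivative f' x) (at x)" "\<And>x. f' x - 2 * x * f x = v x"
    "\<And>x. \<bar>f x\<bar> \<le> 2 * M" "\<And>x. \<bar>f' x\<bar> \<le> 2 * M"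
proof -
  have M: "M \<ge> 0" using bnd[of 0] by linarith
  have vm[measurable]: "v \<in> borel_measurable borel" by (rule borel_measurable_continuous_onI[OF cont])
  define w where "w t = v t * exp (- t\<^sup>2)" for t
  have wm[measurable]: "w \<in> borel_measurable borel" unfolding w_def by measurable
  have wb: "\<bar>w t\<bar> \<le> M * exp (- t\<^sup>2)" for t using bnd[of t] by (simp add: w_def abs_mult)
  have wi: "integrable lborel w"
    by (rule Bochner_Integration.integrable_bound[of _ "\<lambda>t. M * exp (- t\<^sup>2)"])
       (use exp_neg_square_integrable wb M in \<open>auto simp: abs_mult\<close>)
  have w0: "integral\<^sup>L lborel w = 0"
  proof -
    have "w = (\<lambda>t. sqrt pi * (v t * phi_half t))" by (simp add: fun_eq_iff w_def phi_half_def)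
    then show ?thesis using zero by simp
  qed
  have ii: "integrable lborel (\<lambda>t. indicator A t * w t)" if "A \<in> sets borel" for A
    using integrable_mult_indicator[OF _ wi, of A] that by simp
  define F where "F x = (\<integral>t. indicator {..x} t * w t \<partial>lborel)" for x
  have wc: "continuous_on A w" for A unfolding w_def by (intro continuous_intros continuous_on_subset[OF cont]) auto
  have dF: "(F has_real_derivative w x) (at x)" for x
  proof -
    \<comment> \<open>Near \<open>x\<close> the improper integral is a constant plus an integral
      over a compact interval, to which the fundamental theorem for continuous integrands
      applies.\<close>
    have F: "F y = F (x - 1) + integral {x - 1..y} w" if "y \<in> {x - 1..x + 1}" for y
    proof -
      have "F y = (\<integral>t. indicator {..x - 1} t * w t + indicator {x - 1<..y} t * w t \<partial>lborel)"
        unfolding F_def by (rule Bochner_Integration.integral_cong) (use that in \<open>auto simp: indicator_def\<close>)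
      also have "\<dots> = F (x - 1) + (\<integral>t. indicator {x - 1<..y} t * w t \<partial>lborel)"
        unfolding F_def by (intro Bochner_Integration.integral_add ii) auto
      also have "(\<integral>t. indicator {x - 1<..y} t * w t \<partial>lborel) = (\<integral>t. indicator {x - 1..y} t * w t \<partial>lborel)"
        by (intro integral_cong_AE) (auto intro!: eventually_mono[OF AE_lborel_singleton[of "x - 1"]] simp: indicator_def)
      also have "\<dots> = integral {x - 1..y} w"
        using set_borel_integral_eq_integral(2)[of "{x - 1..y}" w] ii[of "{x - 1..y}"]
        by (simp add: set_lebesgue_integral_def set_integrable_def)
      finally show ?thesis .
    qed
    have "((\<lambda>y. integral {x - 1..y} w) has_real_derivative w x) (at x within {x - 1..x + 1})"
      by (rule integral_has_real_derivative[OF wc]) auto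
    then have "((\<lambda>y. F (x - 1) + integral {x - 1..y} w) has_real_derivative w x) (at x within {x - 1..x + 1})"
      by (auto intro!: derivative_eq_intros)
    then have "(F has_real_derivative w x) (at x within {x - 1..x + 1})"
      by (rule has_field_derivative_transform_within[where d=1]) (auto intro!: F[symmetric])
    moreover have "at x within {x - 1..x + 1} = at x" by (rule at_within_interior) auto
    ultimately show ?thesis by simp
  qed
  have tail: "\<bar>F x\<bar> \<le> M * gauss_tail \<bar>x\<bar>" for x
  proof (cases "x \<ge> 0")
    case True
    \<comment> \<open>The vanishing mean replaces the integral up to \<open>x\<close> by minus the
      integral beyond \<open>x\<close>, which is small enough to offset the factor
      \<open>exp (x\<^sup>2)\<close> in \<open>f\<close>.\<close>
    have "(\<integral>t. indicator {..x} t * w t + indicator {x<..} t * w t \<partial>lborel) = integral\<^sup>L lborel w"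
      by (rule Bochner_Integration.integral_cong) (auto simp: indicator_def)
    then have "F x + (\<integral>t. indicator {x<..} t * w t \<partial>lborel) = 0"
      unfolding F_def w0 by (subst (asm) Bochner_Integration.integral_add) (auto intro!: ii)
    then have "\<bar>F x\<bar> = \<bar>\<integral>t. indicator {x<..} t * w t \<partial>lborel\<bar>" by linarith
    also have "\<dots> \<le> (\<integral>t. M * (indicator {x..} t * exp (- t\<^sup>2)) \<partial>lborel)"
      using wb M gauss_tail_integrable[of x]
      by (intro order.trans[OF integral_abs_bound] integral_mono integrable_abs ii) (auto simp: indicator_def)
    finally show ?thesis using True by (simp add: gauss_tail_def)
  next
    case False
    have "\<bar>F x\<bar> \<le> (\<integral>t. M * (indicator {..x} t * exp (- t\<^sup>2)) \<partial>lborel)"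
      unfolding F_def using wb M integrable_mult_indicator[OF _ exp_neg_square_integrable(1), of "{..x}"]
      by (intro order.trans[OF integral_abs_bound] integral_mono integrable_abs ii) (auto simp: indicator_def)
    also have "(\<integral>t. M * (indicator {..x} t * exp (- t\<^sup>2)) \<partial>lborel) = M * gauss_tail (- x)"
    proof -
      have "gauss_tail (- x) = (\<integral>t. indicator {- x..} (0 + (- 1) * t) * exp (- (0 + (- 1) * t)\<^sup>2) \<partial>lborel)"
        unfolding gauss_tail_def by (subst lborel_integral_real_affine[of "-1" _ 0]) auto
      also have "\<dots> = (\<integral>t. indicator {..x} t * exp (- t\<^sup>2) \<partial>lborel)"
        by (rule Bochner_Integration.integral_cong) (auto simp: indicator_def)
      finally show ?thesis by simp
    qed
    finally show ?thesis using False by simp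
  qed
  define f where "f x = exp (x\<^sup>2) * F x" for x
  define f' where "f' x = 2 * x * f x + v x" for x
  show ?thesis
  proof (rule that[of f f'])
    fix x :: real
    have "exp (x\<^sup>2) * w x = v x * (exp (x\<^sup>2) * exp (- x\<^sup>2))" by (simp add: w_def)
    also have "exp (x\<^sup>2) * exp (- x\<^sup>2) = 1" by (simp flip: exp_add)
    finally have "exp (x\<^sup>2) * w x = v x" by simp
    then show "(f has_real_derivative f' x) (at x)"
      unfolding f_def[abs_def] f'_def by (auto intro!: derivative_eq_intros dF simp: mult_ac)
    show "f' x - 2 * x * f x = v x" by (simp add: f'_def)
    have fa: "\<bar>f x\<bar> \<le> M * (exp (\<bar>x\<bar>\<^sup>2) * gauss_tail \<bar>x\<bar>)"
      unfolding f_def abs_mult using tail[of x] by (simp add: mult.left_commute)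
    also have "\<dots> \<le> M * sqrt pi" using gauss_tail_bound1[of "\<bar>x\<bar>"] M by (intro mult_left_mono) auto
    also have "\<dots> \<le> M * 2" using M pi_less_4 real_sqrt_less_mono[of pi 4] by (intro mult_left_mono) auto
    finally show "\<bar>f x\<bar> \<le> 2 * M" by simp
    have "\<bar>2 * x * f x\<bar> = 2 * \<bar>x\<bar> * \<bar>f x\<bar>" by (simp add: abs_mult)
    also have "\<dots> \<le> 2 * \<bar>x\<bar> * (M * (exp (\<bar>x\<bar>\<^sup>2) * gauss_tail \<bar>x\<bar>))" using fa by (intro mult_left_mono) auto
    also have "\<dots> = M * (exp (\<bar>x\<bar>\<^sup>2) * (2 * \<bar>x\<bar> * gauss_tail \<bar>x\<bar>))" by simp
    also have "\<dots> \<le> M * 1" using gauss_tail_bound2[of "\<bar>x\<bar>"] M by (intro mult_left_mono) auto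
    finally show "\<bar>f' x\<bar> \<le> 2 * M" unfolding f'_def using bnd[of x] by linarith
  qed
qed

text \<open>With all couplings but one frozen, the argument of \<open>P\<close> is an affine
  function of a Gaussian variable with slope \<open>c * e \<sigma> i\<close>, which is nonzero; so
  it avoids a Lebesgue null set almost surely, and Fubini concludes. At least one coupling is
  needed.\<close>

lemma (in gaussian_gibbs) AE_X:
  assumes \<sigma>: "\<sigma> \<in> S" and I: "I \<noteq> {}" and c: "c \<noteq> 0" and P: "AE x in lborel. P x"
  shows "AE g in G. P (c * X g \<sigma> - d)"
proof -
  obtain A where A': "{x \<in> space lborel. \<not> P x} \<subseteq> A" "emeasure lborel A = 0" "A \<in> sets lborel"
    using P by (rule AE_E)
  then have A: "{x. \<not> P x} \<subseteq> A" "A \<in> sets borel" "emeasure lborel A = 0" by simp_all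
  have [measurable]: "A \<in> sets borel" by (rule A)
  have PA: "AE x in lborel. x \<notin> A" using A by (intro AE_not_in null_setsI) auto
  obtain i where i: "i \<in> I" using I by auto
  interpret product_sigma_finite "\<lambda>_::'i. std_gauss" by (rule product_sigma_finite_std_gauss)
  interpret G: prob_space G by (rule prob_space_G)
  define J where "J = I - {i}"
  have J: "I = insert i J" "finite J" "i \<notin> J" using i finite_I by (auto simp: J_def)
  define \<Psi> where "\<Psi> g = (indicator A (c * X g \<sigma> - d) :: real)" for g
  have \<Psi>m: "\<Psi> \<in> borel_measurable G" unfolding \<Psi>_def by measurable
  have \<Psi>i: "integrable G \<Psi>" by (rule integrable_bounded[OF \<Psi>m, of 1]) (auto simp: \<Psi>_def indicator_def)
  have "(\<integral>g. \<Psi> g \<partial>G) = (\<integral>x. (\<integral>y. \<Psi> (x(i := y)) \<partial>std_gauss) \<partial>PiM J (\<lambda>_. std_gauss))"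
    using product_integral_insert[OF J(2,3), of \<Psi>] \<Psi>i unfolding G_def by (simp add: J(1)[symmetric])
  also have "\<dots> = (\<integral>x. 0 \<partial>PiM J (\<lambda>_. std_gauss))"
  proof (rule Bochner_Integration.integral_cong[OF refl])
    fix x
    define r where "r = c * (\<Sum>k\<in>J. e \<sigma> k * x k) - d"
    have X: "c * X (x(i := y)) \<sigma> - d = r + (c * e \<sigma> i) * y" for y
    proof -
      have "(\<Sum>k\<in>J. e \<sigma> k * (x(i := y)) k) = (\<Sum>k\<in>J. e \<sigma> k * x k)" using J(3) by (intro sum.cong) auto
      then have "(\<Sum>k\<in>I. e \<sigma> k * (x(i := y)) k) = e \<sigma> i * y + (\<Sum>k\<in>J. e \<sigma> k * x k)" using J(2,3) by (subst J(1)) simp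
      then show ?thesis by (simp add: X_def r_def algebra_simps)
    qed
    have "c * e \<sigma> i \<noteq> 0" using c abs_e[OF \<sigma> i] by auto
    then have "AE y in lborel. r + (c * e \<sigma> i) * y \<notin> A" using PA by (intro AE_borel_affine) auto
    then have "AE y in std_gauss. \<Psi> (x(i := y)) = 0"
      unfolding \<Psi>_def X by (subst AE_density) (auto elim: eventually_mono)
    then show "(\<integral>y. \<Psi> (x(i := y)) \<partial>std_gauss) = 0" by (rule integral_eq_zero_AE)
  qed
  finally have "(\<integral>g. \<Psi> g \<partial>G) = 0" by simp
  then have "AE g in G. \<Psi> g = 0"
    using integral_nonneg_eq_0_iff_AE[OF \<Psi>i] by (simp add: \<Psi>_def[abs_def])
  then show ?thesis by (rule eventually_mono) (use A(1) in \<open>auto simp: \<Psi>_def indicator_def split: if_splits\<close>)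
qed

section \<open>Second moments of overlap and energy, uniform in the size\<close>

context sk_gibbs
begin

text \<open>The bound of \<open>neg_log_partition_moment\<close> at
  \<open>\<eta> = 2 * \<kappa> / N\<close> and \<open>b0\<^sup>2 = \<beta>\<^sup>2 / N\<close>,
  where \<open>N\<close> cancels.\<close>

definition moment_const :: "real \<Rightarrow> real \<Rightarrow> real" where
  "moment_const \<kappa> C = exp (9 * \<beta>\<^sup>2 / (2 * \<kappa>)) * (2 + 2 * C)"

text \<open>Both moments come from \<open>avg_square_moment\<close>: two replicas with weight
  \<open>exp (2 L)\<close> for the overlap, one replica with weight \<open>exp L\<close> for the
  energy. With these weights the disorder averages of the exponentials are computable, and
  \<open>neg_log_partition_moment\<close> supplies the rest.\<close>

lemma overlap_energy_moments:
  assumes \<kappa>: "0 < \<kappa>" "\<kappa> \<le> 1" and Q1: "\<And>\<sigma> \<tau>. \<sigma> \<in> S \<Longrightarrow> \<tau> \<in> S \<Longrightarrow> - 1 \<le> Q \<sigma> \<tau>"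
    and C: "\<And>b. 0 \<le> b \<Longrightarrow> b \<le> b0 \<Longrightarrow>
      (\<Sum>\<sigma>\<in>S. \<Sum>\<tau>\<in>S. exp ((b\<^sup>2 + 2 * \<kappa> / N) * q \<sigma> \<tau>)) / (real (card S))\<^sup>2 \<le> C"
  shows "(\<integral>g. mean_Q_sq g \<partial>G) \<le> 1 + (4 + 48 * C + 16 * moment_const \<kappa> C) / \<kappa>\<^sup>2"
    and "(\<integral>g. (\<Sum>\<sigma>\<in>S. w g \<sigma> * (H g \<sigma>)\<^sup>2) \<partial>G) \<le> 100 + 16 * moment_const \<kappa> C"
proof -
  interpret prob_space G by (rule prob_space_G)
  define \<eta> where "\<eta> = 2 * \<kappa> / N"
  have \<eta>: "\<eta> > 0" using \<kappa> N_pos by (simp add: \<eta>_def)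
  have D: "(\<integral>g. exp (2 * L b g) * pair_exp \<eta> b g \<partial>G) \<le> C" if "0 \<le> b" "b \<le> b0" for b
    unfolding pair_exp_weighted(2) \<eta>_def using C[OF that] .
  have "9 * b0\<^sup>2 / \<eta> = 9 * \<beta>\<^sup>2 / (2 * \<kappa>)"
    using N_pos \<kappa> by (simp add: b0_def \<eta>_def power_divide field_simps)
  then have M: "(\<integral>g. (softplus (L b0 g))\<^sup>2 \<partial>G) \<le> moment_const \<kappa> C"
    using neg_log_partition_moment[OF \<eta> b0_bounds(1) D] unfolding moment_const_def by simp

  \<comment> \<open>\<open>avg_square_moment\<close> asks for nonnegative variables. The shift by
    \<open>1\<close> achieves this and costs the factor \<open>exp \<kappa> \<le> 3\<close>.\<close>
  define y where "y t = \<kappa> * (Q (fst t) (snd t) + 1)" for t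
  have y0: "0 \<le> y t" if "t \<in> S \<times> S" for t
    using Q1[of "fst t" "snd t"] that \<kappa> by (auto simp: y_def)
  have ey: "(\<Sum>t\<in>S \<times> S. w g (fst t) * w g (snd t) * exp (y t)) = exp \<kappa> * pair_exp \<eta> b0 g" for g
    unfolding pair_exp_def avg_sum_pairs sum_distrib_left
  proof (intro sum.cong refl)
    fix t :: "'s \<times> 's"
    have "y t = \<kappa> + \<eta> * q (fst t) (snd t)" by (simp add: y_def \<eta>_def Q_def algebra_simps)
    then show "w g (fst t) * w g (snd t) * exp (y t) = exp \<kappa> * (w g (fst t) * w g (snd t) * exp (\<eta> * q (fst t) (snd t)))"
      by (simp add: exp_add)
  qed
  have C0: "C \<ge> 0"
    using order.trans[OF _ C[of 0]] b0_bounds(1) by (simp add: sum_nonneg)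
  have e3: "exp \<kappa> \<le> 3" using \<kappa> exp_le order.trans[of "exp \<kappa>" "exp 1" 3] by simp
  have "(\<integral>g. (\<Sum>t\<in>S \<times> S. w g (fst t) * w g (snd t) * (y t)\<^sup>2) \<partial>G) \<le> 4 + 16 * (3 * C) + 16 * (\<integral>g. (softplus (L b0 g))\<^sup>2 \<partial>G)"
  proof (rule avg_square_moment[where j=2])
    show "integrable G (\<lambda>g. exp (2 * L b0 g) * (\<Sum>t\<in>S \<times> S. w g (fst t) * w g (snd t) * exp (y t)))"
      unfolding ey using integrable_mult_right[OF pair_exp_weighted(1)[of b0 \<eta>], of "exp \<kappa>"] by (simp add: mult_ac)
    have "(\<integral>g. exp (2 * L b0 g) * (\<Sum>t\<in>S \<times> S. w g (fst t) * w g (snd t) * exp (y t)) \<partial>G) = exp \<kappa> * (\<integral>g. exp (2 * L b0 g) * pair_exp \<eta> b0 g \<partial>G)"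
      unfolding ey by (simp add: mult.left_commute)
    also have "\<dots> \<le> exp \<kappa> * C" using D[of b0] b0_bounds(1) by (intro mult_left_mono) auto
    also have "\<dots> \<le> 3 * C" using e3 C0 by (rule mult_right_mono)
    finally show "(\<integral>g. exp (2 * L b0 g) * (\<Sum>t\<in>S \<times> S. w g (fst t) * w g (snd t) * exp (y t)) \<partial>G) \<le> 3 * C" .
    show "(\<Sum>t\<in>S \<times> S. w g (fst t) * w g (snd t)) = 1" for g
      using sum_pp[of b0 g] by (simp add: sum.cartesian_product case_prod_beta)
  qed (use finite_S p_nonneg y0 in auto)
  then have Y: "(\<integral>g. (\<Sum>t\<in>S \<times> S. w g (fst t) * w g (snd t) * (y t)\<^sup>2) \<partial>G) \<le> 4 + 48 * C + 16 * moment_const \<kappa> C"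
    using M by linarith
  have WY: "mean_Q_sq g \<le> 1 + (\<Sum>t\<in>S \<times> S. w g (fst t) * w g (snd t) * (y t)\<^sup>2) / \<kappa>\<^sup>2" for g
  proof -
    have "mean_Q_sq g = (\<Sum>\<sigma>\<in>S. \<Sum>\<rho>\<in>S. w g \<sigma> * w g \<rho> * (Q \<sigma> \<rho>)\<^sup>2)"
      unfolding mean_Q_sq_def avg_Q_sq_def sum_distrib_left by (simp add: mult.assoc Q_sym)
    also have "\<dots> = (\<Sum>t\<in>S \<times> S. w g (fst t) * w g (snd t) * (Q (fst t) (snd t))\<^sup>2)" by (rule avg_sum_pairs)
    also have "\<dots> \<le> (\<Sum>t\<in>S \<times> S. w g (fst t) * w g (snd t) * (1 + (y t)\<^sup>2 / \<kappa>\<^sup>2))"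
    proof (intro sum_mono mult_left_mono)
      fix t assume t: "t \<in> S \<times> S"
      have "(y t)\<^sup>2 / \<kappa>\<^sup>2 = (Q (fst t) (snd t) + 1)\<^sup>2" using \<kappa> by (simp add: y_def power_mult_distrib)
      \<comment> \<open>The difference of the two sides is \<open>2 * (Q + 1)\<close>.\<close>
      moreover have "(Q (fst t) (snd t))\<^sup>2 \<le> 1 + (Q (fst t) (snd t) + 1)\<^sup>2"
        using Q1[of "fst t" "snd t"] t by (auto simp: power2_eq_square algebra_simps)
      ultimately show "(Q (fst t) (snd t))\<^sup>2 \<le> 1 + (y t)\<^sup>2 / \<kappa>\<^sup>2" by simp
    qed (auto intro!: mult_nonneg_nonneg p_nonneg)
    also have "\<dots> = (\<Sum>t\<in>S \<times> S. w g (fst t) * w g (snd t)) + (\<Sum>t\<in>S \<times> S. w g (fst t) * w g (snd t) * (y t)\<^sup>2) / \<kappa>\<^sup>2"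
      by (simp add: distrib_left sum.distrib sum_divide_distrib)
    also have "(\<Sum>t\<in>S \<times> S. w g (fst t) * w g (snd t)) = 1"
      using sum_pp[of b0 g] by (simp add: sum.cartesian_product case_prod_beta)
    finally show ?thesis .
  qed
  have bY: "bounded_rv (\<lambda>g. \<Sum>t\<in>S \<times> S. w g (fst t) * w g (snd t) * (y t)\<^sup>2)"
    using finite_S by (intro bounded_rv_sum bounded_rv_mult bounded_rv_const bounded_rv_p) auto
  have "(\<integral>g. mean_Q_sq g \<partial>G) \<le> (\<integral>g. 1 + (\<Sum>t\<in>S \<times> S. w g (fst t) * w g (snd t) * (y t)\<^sup>2) / \<kappa>\<^sup>2 \<partial>G)"
    using bounded_rv_integrable[OF bY] by (intro integral_mono WY bounded_rv_integrable[OF bounded_rv_mean_Q_sq]) auto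
  also have "\<dots> = 1 + (\<integral>g. (\<Sum>t\<in>S \<times> S. w g (fst t) * w g (snd t) * (y t)\<^sup>2) \<partial>G) / \<kappa>\<^sup>2"
    using bounded_rv_integrable[OF bY] by (simp add: prob_space)
  also have "\<dots> \<le> 1 + (4 + 48 * C + 16 * moment_const \<kappa> C) / \<kappa>\<^sup>2"
    using Y by (intro add_left_mono divide_right_mono) auto
  finally show "(\<integral>g. mean_Q_sq g \<partial>G) \<le> 1 + (4 + 48 * C + 16 * moment_const \<kappa> C) / \<kappa>\<^sup>2" .

  define c where "c = real (card S) * exp (b0\<^sup>2 * n / 2)"
  have c: "c > 0" using card_S_pos by (simp add: c_def)
  have Lw: "exp (L b0 g) * w g \<sigma> = exp (b0 * X g \<sigma>) / c" for g \<sigma>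
    using Z_conv_L[of b0 g] c Z_pos[of b0 g] unfolding c_def[symmetric] p_def by (simp add: field_simps)
  \<comment> \<open>An exponential moment of \<open>H\<close> in which the weight
    \<open>exp L\<close> cancels the partition function. The signs \<open>s = 1\<close> and
    \<open>s = -1\<close> together dominate the exponential of the absolute value.\<close>
  define T where "T s g = (\<Sum>\<sigma>\<in>S. exp (L b0 g) * w g \<sigma> * exp (s * H g \<sigma>))" for s g
  have Te: "T s g = (\<Sum>\<sigma>\<in>S. (exp (- (s * (sqrt N * \<beta> / 2))) / c) * exp ((b0 + s / N) * X g \<sigma>))" for s g
  proof -
    have "exp (b0 * X g \<sigma>) * exp (s * H g \<sigma>) = exp (- (s * (sqrt N * \<beta> / 2))) * exp ((b0 + s / N) * X g \<sigma>)" for \<sigma>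
      unfolding exp_add[symmetric] by (simp add: H_def algebra_simps)
    then show ?thesis unfolding T_def Lw by (intro sum.cong refl) simp
  qed
  have Ti: "integrable G (T s)" for s
    unfolding Te[abs_def] by (intro Bochner_Integration.integrable_sum integrable_mult_right G_exp_X)
  have Tb: "(\<integral>g. T s g \<partial>G) \<le> 3" if s: "\<bar>s\<bar> = 1" for s
  proof -
    have "(\<integral>g. T s g \<partial>G) = (\<Sum>\<sigma>\<in>S. (exp (- (s * (sqrt N * \<beta> / 2))) / c) * exp ((b0 + s / N)\<^sup>2 * n / 2))"
      unfolding Te by (subst Bochner_Integration.integral_sum) (auto intro!: integrable_mult_right G_exp_X sum.cong simp: G_exp_X')
    also have "\<dots> = exp (- (s * (sqrt N * \<beta> / 2))) * exp ((b0 + s / N)\<^sup>2 * n / 2) / exp (b0\<^sup>2 * n / 2)"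
      using card_S_pos by (simp add: c_def)
    also have "\<dots> = exp (- (s * (sqrt N * \<beta> / 2)) + (b0 + s / N)\<^sup>2 * n / 2 - b0\<^sup>2 * n / 2)"
      by (simp only: exp_add exp_diff)
    \<comment> \<open>The centering of \<open>H\<close> cancels the cross term of the square up to
      \<open>s * b0 / 2\<close>, so the exponent stays bounded in \<open>N\<close>.\<close>
    also have "- (s * (sqrt N * \<beta> / 2)) + (b0 + s / N)\<^sup>2 * n / 2 - b0\<^sup>2 * n / 2 = (N - 1) / (4 * N) - s * b0 / 2"
    proof -
      have s2: "s * s = 1" using s by (metis abs_mult_self_eq mult_1)
      have "(b0 + s / N)\<^sup>2 * n / 2 - b0\<^sup>2 * n / 2 = (2 * b0 * s / N + (s * s) / (N * N)) * n / 2"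
        by (simp add: power2_eq_square algebra_simps add_divide_distrib)
      also have "\<dots> = b0 * s * (N - 1) / 2 + (N - 1) / (4 * N)"
        unfolding s2 card_I using N_pos by (simp add: field_simps)
      finally show ?thesis unfolding b0_N[symmetric] using N_pos by (simp add: field_simps)
    qed
    also have "exp \<dots> \<le> exp 1"
    proof -
      have "(N - 1) / (4 * N) \<le> 1 / 4" using N_pos by (simp add: field_simps)
      moreover have "\<bar>s * b0 / 2\<bar> \<le> 1 / 2" using s b0_bounds by (simp add: abs_mult)
      ultimately show ?thesis by (simp only: exp_le_cancel_iff abs_le_iff) linarith
    qed
    also have "\<dots> \<le> 3" by (rule exp_le)
    finally show ?thesis .
  qed
  have dom: "exp (1 * L b0 g) * (\<Sum>\<sigma>\<in>S. w g \<sigma> * exp \<bar>H g \<sigma>\<bar>) \<le> T 1 g + T (- 1) g" for g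
  proof -
    have "exp (1 * L b0 g) * (\<Sum>\<sigma>\<in>S. w g \<sigma> * exp \<bar>H g \<sigma>\<bar>) = (\<Sum>\<sigma>\<in>S. exp (L b0 g) * w g \<sigma> * exp \<bar>H g \<sigma>\<bar>)"
      by (simp add: sum_distrib_left mult_ac)
    also have "\<dots> \<le> (\<Sum>\<sigma>\<in>S. exp (L b0 g) * w g \<sigma> * (exp (1 * H g \<sigma>) + exp (- 1 * H g \<sigma>)))"
    proof (intro sum_mono mult_left_mono)
      fix \<sigma>
      show "exp \<bar>H g \<sigma>\<bar> \<le> exp (1 * H g \<sigma>) + exp (- 1 * H g \<sigma>)"
        by (cases "H g \<sigma> \<ge> 0") auto
    qed (auto simp: p_nonneg)
    also have "\<dots> = T 1 g + T (- 1) g" by (simp add: T_def distrib_left sum.distrib)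
    finally show ?thesis .
  qed
  have Hm [measurable]: "(\<lambda>g. H g \<sigma>) \<in> borel_measurable G" for \<sigma> unfolding H_def by measurable
  have i: "integrable G (\<lambda>g. exp (1 * L b0 g) * (\<Sum>\<sigma>\<in>S. w g \<sigma> * exp \<bar>H g \<sigma>\<bar>))"
  proof (rule Bochner_Integration.integrable_bound[OF Bochner_Integration.integrable_add[OF Ti[of 1] Ti[of "-1"]]])
    have "0 \<le> exp (1 * L b0 g) * (\<Sum>\<sigma>\<in>S. w g \<sigma> * exp \<bar>H g \<sigma>\<bar>)" for g
      by (intro mult_nonneg_nonneg sum_nonneg) (auto simp: p_nonneg)
    then show "AE g in G. norm (exp (1 * L b0 g) * (\<Sum>\<sigma>\<in>S. w g \<sigma> * exp \<bar>H g \<sigma>\<bar>)) \<le> norm (T 1 g + T (- 1) g)"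
      using dom by (intro AE_I2) (smt (verit) real_norm_def)
  qed measurable
  have "(\<integral>g. (\<Sum>\<sigma>\<in>S. w g \<sigma> * \<bar>H g \<sigma>\<bar>\<^sup>2) \<partial>G) \<le> 4 + 16 * 6 + 16 * (\<integral>g. (softplus (L b0 g))\<^sup>2 \<partial>G)"
  proof (rule avg_square_moment[where j=1, OF finite_S _ _ _ _ _ i])
    have "(\<integral>g. exp (1 * L b0 g) * (\<Sum>\<sigma>\<in>S. w g \<sigma> * exp \<bar>H g \<sigma>\<bar>) \<partial>G) \<le> (\<integral>g. T 1 g + T (- 1) g \<partial>G)"
      using Ti by (intro integral_mono i dom Bochner_Integration.integrable_add)
    also have "\<dots> = (\<integral>g. T 1 g \<partial>G) + (\<integral>g. T (- 1) g \<partial>G)"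
      using Ti by (intro Bochner_Integration.integral_add)
    also have "\<dots> \<le> 6" using Tb[of 1] Tb[of "-1"] by simp
    finally show "(\<integral>g. exp (1 * L b0 g) * (\<Sum>\<sigma>\<in>S. w g \<sigma> * exp \<bar>H g \<sigma>\<bar>) \<partial>G) \<le> 6" .
  qed (auto simp: p_nonneg sum_p)
  then show "(\<integral>g. (\<Sum>\<sigma>\<in>S. w g \<sigma> * (H g \<sigma>)\<^sup>2) \<partial>G) \<le> 100 + 16 * moment_const \<kappa> C"
    using M by simp
qed

end

text \<open>Hoeffding's lemma for a fair sign: the inequality with probability \<open>1 / 2\<close>,
  evaluated at \<open>2 * x\<close> and recentered. Evenness covers negative
  \<open>x\<close>.\<close>

lemma two_cosh_le: "exp x + exp (- x) \<le> 2 * exp (x\<^sup>2 / 2)" for x :: real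
proof -
  have *: "exp x + exp (- x) \<le> 2 * exp (x\<^sup>2 / 2)" if x: "x > 0" for x :: real
  proof -
    have "- (2 * x) * (1 / 2) + ln (1 + 1 / 2 * (exp (2 * x) - 1)) \<le> (2 * x)\<^sup>2 / 8"
      using Hoeffdings_lemma_aux[of "2 * x" "1 / 2"] x by simp
    then have "ln (1 + 1 / 2 * (exp (2 * x) - 1)) \<le> x + x\<^sup>2 / 2" by (simp add: power2_eq_square)
    moreover have "1 + 1 / 2 * (exp (2 * x) - 1) > 0" by (simp add: field_simps add_pos_pos)
    ultimately have "1 + 1 / 2 * (exp (2 * x) - 1) \<le> exp (x + x\<^sup>2 / 2)" by (metis exp_le_cancel_iff exp_ln)
    then have "exp (- x) * (1 + exp (2 * x)) \<le> exp (- x) * (2 * exp (x + x\<^sup>2 / 2))"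
      by (intro mult_left_mono) (auto simp: field_simps)
    then show ?thesis by (simp add: distrib_left mult.left_commute[of _ 2] add.commute flip: exp_add)
  qed
  show ?thesis using *[of x] *[of "- x"] by (cases x "0 :: real" rule: linorder_cases) (auto simp: add.commute)
qed

section \<open>The Sherrington--Kirkpatrick model\<close>

lemma finite_sk_pairs: "finite (sk_pairs N)"
  by (rule finite_subset[of _ "{1..N} \<times> {1..N}"]) (auto simp: sk_pairs_def)

lemma sum_sk_pairs_Suc:
  "(\<Sum>k\<in>sk_pairs (Suc N). f k) = (\<Sum>k\<in>sk_pairs N. f k) + (\<Sum>i\<in>{1..N}. f (i, Suc N))"
proof -
  have "sk_pairs (Suc N) = sk_pairs N \<union> (\<lambda>i. (i, Suc N)) ` {1..N}"
    by (auto simp: sk_pairs_def)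
  moreover have "sk_pairs N \<inter> (\<lambda>i. (i, Suc N)) ` {1..N} = {}"
    by (auto simp: sk_pairs_def)
  moreover have "inj_on (\<lambda>i. (i, Suc N)) {1..N}" by (auto intro: inj_onI)
  ultimately show ?thesis
    using finite_sk_pairs[of N] by (simp add: sum.union_disjoint sum.reindex)
qed

text \<open>The diagonal plus twice the upper triangle. With
  \<open>a i = \<sigma> i * \<tau> i\<close> it expresses \<open>q\<close> through the overlap; with
  \<open>a = 1\<close> it counts the couplings.\<close>

lemma square_sum_sk_pairs:
  fixes a :: "nat \<Rightarrow> real"
  shows "(\<Sum>i\<in>{1..N}. a i)\<^sup>2 = (\<Sum>i\<in>{1..N}. (a i)\<^sup>2) + 2 * (\<Sum>k\<in>sk_pairs N. a (fst k) * a (snd k))"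
proof (induction N)
  case 0
  have "sk_pairs 0 = {}" by (auto simp: sk_pairs_def)
  then show ?case by simp
next
  case (Suc N)
  then show ?case
    by (simp add: sum_sk_pairs_Suc power2_sum sum_distrib_left sum_distrib_right mult_ac)
qed

lemma card_sk_pairs: "real (card (sk_pairs N)) = real N * (real N - 1) / 2"
  using square_sum_sk_pairs[of "\<lambda>_. 1" N] by (simp add: power2_eq_square algebra_simps)

definition sk_sign :: "(nat \<Rightarrow> real) \<Rightarrow> nat \<times> nat \<Rightarrow> real" where
  "sk_sign \<sigma> k = \<sigma> (fst k) * \<sigma> (snd k)"

lemma sk_configs_square: "\<sigma> \<in> sk_configs N \<Longrightarrow> i \<in> {1..N} \<Longrightarrow> (\<sigma> i)\<^sup>2 = 1"
  by (auto simp: sk_configs_def PiE_iff power2_eq_1_iff)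

lemma card_sk_configs: "real (card (sk_configs N)) = 2 ^ N"
  unfolding sk_configs_def by (subst card_PiE) simp_all

lemma sk_gaussian_gibbs: "gaussian_gibbs (sk_pairs N) (sk_configs N) sk_sign"
proof
  show "finite (sk_pairs N)" by (rule finite_sk_pairs)
  show "finite (sk_configs N)" unfolding sk_configs_def by (intro finite_PiE) auto
  show "sk_configs N \<noteq> {}" using card_sk_configs[of N] by auto
  fix \<sigma> k assume "\<sigma> \<in> sk_configs N" "k \<in> sk_pairs N"
  then show "(sk_sign \<sigma> k)\<^sup>2 = 1"
    unfolding sk_sign_def power_mult_distrib
    by (subst (1 2) sk_configs_square) (auto simp: sk_pairs_def)
qed

lemma sk_q: 
  assumes "\<sigma> \<in> sk_configs N" "\<tau> \<in> sk_configs N"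
  shows "gaussian_gibbs.q (sk_pairs N) sk_sign \<sigma> \<tau> = ((\<Sum>i\<in>{1..N}. \<sigma> i * \<tau> i)\<^sup>2 - real N) / 2"
proof -
  have "(\<Sum>i\<in>{1..N}. (\<sigma> i * \<tau> i)\<^sup>2) = real N"
    using assms by (simp add: power_mult_distrib sk_configs_square)
  then show ?thesis
    unfolding gaussian_gibbs.q_def[OF sk_gaussian_gibbs] sk_sign_def
    using square_sum_sk_pairs[of "\<lambda>i. \<sigma> i * \<tau> i" N] by (simp add: mult_ac)
qed

text \<open>The square in the exponent is linearized by an auxiliary Gaussian variable \<open>z\<close>, after which the
  sum over \<open>\<tau>\<close> factorizes.\<close>
lemma sk_pair_bound:
  assumes c: "0 \<le> c" "c < 1 / 2" and N: "N \<ge> 1" and \<sigma>: "\<sigma> \<in> sk_configs N"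
  shows "(\<Sum>\<tau>\<in>sk_configs N. exp (c * (\<Sum>i\<in>{1..N}. \<sigma> i * \<tau> i)\<^sup>2 / real N)) \<le> 2 ^ N * (\<integral>z. exp (c * z\<^sup>2) \<partial>std_gauss)"
proof -
  \<comment> \<open>Chosen so that averaging \<open>exp (a * s * z)\<close> over a standard Gaussian
    \<open>z\<close> gives \<open>exp (c * s\<^sup>2 / N)\<close>.\<close>
  define a where "a = sqrt (2 * c / real N)"
  have a2: "a\<^sup>2 = 2 * c / real N" using c by (simp add: a_def)
  have "(\<Sum>\<tau>\<in>sk_configs N. exp (c * (\<Sum>i\<in>{1..N}. \<sigma> i * \<tau> i)\<^sup>2 / real N))
    = (\<Sum>\<tau>\<in>sk_configs N. \<integral>z. exp ((a * (\<Sum>i\<in>{1..N}. \<sigma> i * \<tau> i)) * z) \<partial>std_gauss)"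
    unfolding std_gauss_exp(2) power_mult_distrib a2 by simp
  also have "\<dots> = (\<integral>z. (\<Sum>\<tau>\<in>sk_configs N. exp ((a * (\<Sum>i\<in>{1..N}. \<sigma> i * \<tau> i)) * z)) \<partial>std_gauss)"
    by (rule Bochner_Integration.integral_sum[symmetric]) (rule std_gauss_exp)
  also have "\<dots> \<le> (\<integral>z. 2 ^ N * exp (c * z\<^sup>2) \<partial>std_gauss)"
  proof (rule integral_mono)
    show "integrable std_gauss (\<lambda>z. \<Sum>\<tau>\<in>sk_configs N. exp ((a * (\<Sum>i\<in>{1..N}. \<sigma> i * \<tau> i)) * z))"
      by (intro Bochner_Integration.integrable_sum std_gauss_exp)
    show "integrable std_gauss (\<lambda>z. 2 ^ N * exp (c * z\<^sup>2))"
      using std_gauss_exp_square[OF c(2)] by simp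
    fix z
    have "(\<Sum>\<tau>\<in>sk_configs N. exp ((a * (\<Sum>i\<in>{1..N}. \<sigma> i * \<tau> i)) * z)) = (\<Sum>\<tau>\<in>sk_configs N. \<Prod>i\<in>{1..N}. exp (a * z * \<sigma> i * \<tau> i))"
      by (simp add: exp_sum[symmetric] sum_distrib_left sum_distrib_right mult_ac)
    also have "\<dots> = (\<Prod>i\<in>{1..N}. \<Sum>t\<in>{-1, 1}. exp (a * z * \<sigma> i * t))"
      unfolding sk_configs_def by (subst prod_sum_PiE) auto
    also have "\<dots> \<le> (\<Prod>i\<in>{1..N}. 2 * exp (c * z\<^sup>2 / real N))"
    proof (intro prod_mono conjI)
      fix i assume i: "i \<in> {1..N}"
      have "(a * z * \<sigma> i)\<^sup>2 / 2 = c * z\<^sup>2 / real N"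
        unfolding power_mult_distrib a2 sk_configs_square[OF \<sigma> i] by simp
      then show "(\<Sum>t\<in>{-1, 1}. exp (a * z * \<sigma> i * t)) \<le> 2 * exp (c * z\<^sup>2 / real N)"
        using two_cosh_le[of "a * z * \<sigma> i"] by (simp add: add.commute)
    qed (auto intro: sum_nonneg)
    also have "\<dots> = 2 ^ N * exp (c * z\<^sup>2)"
      using N by (simp add: power_mult_distrib exp_of_nat_mult[symmetric])
    finally show "(\<Sum>\<tau>\<in>sk_configs N. exp ((a * (\<Sum>i\<in>{1..N}. \<sigma> i * \<tau> i)) * z)) \<le> 2 ^ N * exp (c * z\<^sup>2)" .
  qed
  finally show ?thesis by simp
qed

section \<open>The mean square error, for increasingly general test functions\<close>

definition sk_risk :: "real \<Rightarrow> nat \<Rightarrow> (real \<Rightarrow> real) \<Rightarrow> real" where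
  "sk_risk \<beta> N u = (\<integral>g. (gibbs_avg \<beta> 0 N g (\<lambda>\<sigma>. u (sk_H \<beta> N g \<sigma>)) - (\<integral>t. u t * phi_half t \<partial>lborel))\<^sup>2 \<partial>sk_disorder N)"

lemma sk_X: "gaussian_gibbs.X (sk_pairs N) sk_sign g \<sigma> = sk_interaction N g \<sigma>"
  unfolding gaussian_gibbs.X_def[OF sk_gaussian_gibbs] sk_interaction_def sk_sign_def
  by (intro sum.cong refl) (auto simp: mult_ac)

lemma gibbs_avg_conv:
  "gibbs_avg \<beta> 0 N g F = (\<Sum>\<sigma>\<in>sk_configs N. gaussian_gibbs.p (sk_pairs N) (sk_configs N) sk_sign (\<beta> / sqrt (real N)) g \<sigma> * F \<sigma>)"
  unfolding gibbs_avg_def sk_Z_def sk_weight_def gaussian_gibbs.p_def[OF sk_gaussian_gibbs]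
    gaussian_gibbs.Z_def[OF sk_gaussian_gibbs] sk_X
  by (simp add: sum_divide_distrib mult.commute)

lemma phi_mean_bound:
  assumes [measurable]: "u \<in> borel_measurable borel" and "\<And>x. \<bar>u x\<bar> \<le> M"
  shows "integrable lborel (\<lambda>t. u t * phi_half t)" "\<bar>\<integral>t. u t * phi_half t \<partial>lborel\<bar> \<le> M"
proof -
  have M: "M \<ge> 0" using assms(2)[of 0] by linarith
  have [measurable]: "phi_half \<in> borel_measurable borel" unfolding phi_half_conv_normal by measurable
  have nn: "phi_half t \<ge> 0" for t by (simp add: phi_half_def)
  have b: "\<bar>u t * phi_half t\<bar> \<le> M * phi_half t" for t
    using assms(2)[of t] nn[of t] by (simp add: abs_mult mult_right_mono)
  show i: "integrable lborel (\<lambda>t. u t * phi_half t)"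
    by (rule Bochner_Integration.integrable_bound[of _ "\<lambda>t. M * phi_half t"])
       (use phi_half_integrable b M nn in \<open>auto simp: abs_mult\<close>)
  have "\<bar>\<integral>t. u t * phi_half t \<partial>lborel\<bar> \<le> (\<integral>t. M * phi_half t \<partial>lborel)"
    using i b phi_half_integrable by (intro order.trans[OF integral_abs_bound] integral_mono) auto
  then show "\<bar>\<integral>t. u t * phi_half t \<partial>lborel\<bar> \<le> M" using phi_half_integrable by simp
qed

text \<open>Both averages lie in \<open>[-M, M]\<close>. Used for \<open>N = 1\<close>, where there
  are no couplings.\<close>

lemma sk_risk_trivial:
  assumes "u \<in> borel_measurable borel" and "\<And>x. \<bar>u x\<bar> \<le> M"
  shows "sk_risk \<beta> N u \<le> 4 * M\<^sup>2"
proof -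
  interpret gaussian_gibbs "sk_pairs N" "sk_configs N" sk_sign by (rule sk_gaussian_gibbs)
  interpret prob_space G by (rule prob_space_G)
  have b: "(gibbs_avg \<beta> 0 N g (\<lambda>\<sigma>. u (sk_H \<beta> N g \<sigma>)) - (\<integral>t. u t * phi_half t \<partial>lborel))\<^sup>2 \<le> 4 * M\<^sup>2" for g
  proof -
    have "\<bar>gibbs_avg \<beta> 0 N g (\<lambda>\<sigma>. u (sk_H \<beta> N g \<sigma>))\<bar> \<le> M"
      unfolding gibbs_avg_conv by (rule avg_bound) (rule assms(2))
    then have "\<bar>gibbs_avg \<beta> 0 N g (\<lambda>\<sigma>. u (sk_H \<beta> N g \<sigma>)) - (\<integral>t. u t * phi_half t \<partial>lborel)\<bar> \<le> 2 * M"
      using phi_mean_bound(2)[OF assms] by linarith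
    from power_mono[OF this, of 2] show ?thesis by (simp add: power_mult_distrib)
  qed
  have "sk_risk \<beta> N u \<le> (\<integral>g. 4 * M\<^sup>2 \<partial>G)"
    unfolding sk_risk_def sk_disorder_def G_def[symmetric]
    by (rule integral_mono'[OF _ b]) auto
  then show ?thesis by (simp add: prob_space)
qed

text \<open>\<open>\<kappa>\<close> makes \<open>\<beta>\<^sup>2 + 2 * \<kappa>\<close> equal to
  \<open>(1 + \<beta>\<^sup>2) / 2\<close>, halfway between \<open>\<beta>\<^sup>2\<close> and
  \<open>1\<close>: this leaves room to tilt the overlap while the integral in \<open>C\<close>
  converges. \<open>m\<close> is \<open>moment_const\<close>, and \<open>32 = 2 * 4\<^sup>2\<close>
  reflects \<open>B = 4 * M\<close> in \<open>variance_bound\<close>.\<close>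

definition sk_const :: "real \<Rightarrow> real" where
  "sk_const \<beta> = (let \<kappa> = (1 - \<beta>\<^sup>2) / 4; C = 1 + (\<integral>z. exp ((1 + \<beta>\<^sup>2) / 4 * z\<^sup>2) \<partial>std_gauss);
     m = exp (9 * \<beta>\<^sup>2 / (2 * \<kappa>)) * (2 + 2 * C)
   in 32 * (20 + 22 * (1 + (4 + 48 * C + 16 * m) / \<kappa>\<^sup>2) + 2 * (100 + 16 * m)))"

lemma sk_sk_gibbs: "2 \<le> N \<Longrightarrow> 0 < \<beta> \<Longrightarrow> \<beta> < 1 \<Longrightarrow> sk_gibbs (sk_pairs N) (sk_configs N) sk_sign (real N) \<beta>"
  by (intro sk_gibbs.intro sk_gaussian_gibbs sk_gibbs_axioms.intro card_sk_pairs) auto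

text \<open>\<open>variance_bound\<close> for the centered function \<open>v\<close>. Centering
  doubles the bound \<open>M\<close> and Stein's solution doubles it again, so
  \<open>B = 4 * M\<close>. The derivative bound \<open>M'\<close> does not reach the conclusion,
  which makes the approximations below possible.\<close>

lemma sk_risk_smooth:
  assumes N: "2 \<le> N" and \<beta>: "0 < \<beta>" "\<beta> < 1"
    and u: "\<And>x. (u has_real_derivative u' x) (at x)" and u'm: "u' \<in> borel_measurable borel"
    and ub: "\<And>x. \<bar>u x\<bar> \<le> M" and u'b: "\<And>x. \<bar>u' x\<bar> \<le> M'"
  shows "sk_risk \<beta> N u \<le> sk_const \<beta> * M\<^sup>2 / real N"
proof -
  interpret sk_gibbs "sk_pairs N" "sk_configs N" sk_sign "real N" \<beta> by (rule sk_sk_gibbs[OF N \<beta>])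
  note uc = has_derivative_everywhere(1)[OF u] and um[measurable] = has_derivative_everywhere(2)[OF u]
  define m where "m = (\<integral>t. u t * phi_half t \<partial>lborel)"
  define v where "v x = u x - m" for x
  have mM: "\<bar>m\<bar> \<le> M" unfolding m_def by (rule phi_mean_bound(2)[OF um ub])
  have vb: "\<bar>v x\<bar> \<le> 2 * M" for x using ub[of x] mM by (simp add: v_def)
  have v: "(v has_real_derivative u' x) (at x)" for x
    unfolding v_def[abs_def] by (auto intro!: derivative_eq_intros u)
  have vb4: "\<bar>v x\<bar> \<le> 4 * M" for x using vb[of x] by linarith
  have vc: "continuous_on UNIV v" unfolding v_def by (intro continuous_intros uc)
  have "(\<integral>t. v t * phi_half t \<partial>lborel) = 0"
    unfolding v_def left_diff_distrib using phi_mean_bound(1)[OF um ub] phi_half_integrable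
    by (simp add: m_def)
  from stein_solution[OF vc vb this] obtain f f' where
    f: "\<And>x. (f has_real_derivative f' x) (at x)" "\<And>x. f' x - 2 * x * f x = v x"
    "\<And>x. \<bar>f x\<bar> \<le> 2 * (2 * M)" "\<And>x. \<bar>f' x\<bar> \<le> 2 * (2 * M)" by blast
  have M: "M \<ge> 0" using ub[of 0] by linarith
  define \<kappa> where "\<kappa> = (1 - \<beta>\<^sup>2) / 4"
  define c where "c = (1 + \<beta>\<^sup>2) / 4"
  define C where "C = 1 + (\<integral>z. exp (c * z\<^sup>2) \<partial>std_gauss)"
  have \<beta>2: "\<beta>\<^sup>2 < 1" "0 \<le> \<beta>\<^sup>2" using \<beta> by (auto simp: power_less_one_iff abs_square_less_1)
  have "0 < \<kappa>" using \<beta>2 by (simp add: \<kappa>_def)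
  moreover have "0 \<le> x \<Longrightarrow> (1 - x) / 4 \<le> 1" for x :: real by simp
  then have "\<kappa> \<le> 1" unfolding \<kappa>_def using \<beta>2(2) by blast
  ultimately have \<kappa>: "0 < \<kappa>" "\<kappa> \<le> 1" by auto
  have c: "0 \<le> c" "c < 1 / 2" using \<beta>2 by (auto simp: c_def)
  have Qe: "Q \<sigma> \<tau> = (\<Sum>i\<in>{1..N}. \<sigma> i * \<tau> i)\<^sup>2 / real N - 1" if "\<sigma> \<in> sk_configs N" "\<tau> \<in> sk_configs N" for \<sigma> \<tau>
    unfolding Q_def sk_q[OF that] using N_pos by (simp add: field_simps)
  have Q1: "- 1 \<le> Q \<sigma> \<tau>" if "\<sigma> \<in> sk_configs N" "\<tau> \<in> sk_configs N" for \<sigma> \<tau>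
    unfolding Qe[OF that] by simp
  have CC: "(\<Sum>\<sigma>\<in>sk_configs N. \<Sum>\<tau>\<in>sk_configs N. exp ((b\<^sup>2 + 2 * \<kappa> / real N) * q \<sigma> \<tau>)) / (real (card (sk_configs N)))\<^sup>2 \<le> C"
    if b: "0 \<le> b" "b \<le> b0" for b
  proof -
    define a where "a = b\<^sup>2 + 2 * \<kappa> / real N"
    have a0: "a \<ge> 0" using \<kappa> by (simp add: a_def)
    have "b\<^sup>2 \<le> b0\<^sup>2" using b by (intro power_mono)
    also have "b0\<^sup>2 = \<beta>\<^sup>2 / real N" by (simp add: b0_def power_divide)
    finally have "a \<le> \<beta>\<^sup>2 / real N + 2 * \<kappa> / real N" by (simp add: a_def)
    also have "\<dots> = (\<beta>\<^sup>2 + 2 * \<kappa>) / real N" by (rule add_divide_distrib[symmetric])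
    also have "\<beta>\<^sup>2 + 2 * \<kappa> = 2 * c" by (simp add: c_def \<kappa>_def field_simps)
    finally have ac: "a / 2 \<le> c / real N" by (simp add: mult.commute)
    have le: "exp (a * q \<sigma> \<tau>) \<le> exp (c * (\<Sum>i\<in>{1..N}. \<sigma> i * \<tau> i)\<^sup>2 / real N)"
      if "\<sigma> \<in> sk_configs N" "\<tau> \<in> sk_configs N" for \<sigma> \<tau>
    proof -
      \<comment> \<open>The summand \<open>- N\<close> in \<open>q\<close> only helps, because
        \<open>a \<ge> 0\<close>.\<close>
      have "a * q \<sigma> \<tau> \<le> a / 2 * (\<Sum>i\<in>{1..N}. \<sigma> i * \<tau> i)\<^sup>2"
        unfolding sk_q[OF that] using a0 by (simp add: field_simps mult_nonneg_nonneg)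
      also have "\<dots> \<le> c / real N * (\<Sum>i\<in>{1..N}. \<sigma> i * \<tau> i)\<^sup>2" using ac by (rule mult_right_mono) simp
      finally show ?thesis by simp
    qed
    have "(\<Sum>\<sigma>\<in>sk_configs N. \<Sum>\<tau>\<in>sk_configs N. exp (a * q \<sigma> \<tau>))
      \<le> (\<Sum>\<sigma>\<in>sk_configs N. \<Sum>\<tau>\<in>sk_configs N. exp (c * (\<Sum>i\<in>{1..N}. \<sigma> i * \<tau> i)\<^sup>2 / real N))"
      by (intro sum_mono le)
    also have "\<dots> \<le> (\<Sum>\<sigma>\<in>sk_configs N. 2 ^ N * (C - 1))"
      using N c sk_pair_bound[of c N] by (intro sum_mono) (simp add: C_def)
    also have "\<dots> \<le> (real (card (sk_configs N)))\<^sup>2 * C"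
      unfolding card_sk_configs by (simp add: card_sk_configs power2_eq_square mult_left_mono)
    finally show ?thesis using card_S_pos by (simp add: a_def divide_le_eq mult.commute)
  qed
  note mom = overlap_energy_moments[OF \<kappa> Q1 CC]
  have var: "(\<integral>g. (\<Sum>\<sigma>\<in>sk_configs N. w g \<sigma> * v (H g \<sigma>))\<^sup>2 \<partial>G)
    \<le> 2 * (4 * M)\<^sup>2 * (20 + 22 * (1 + (4 + 48 * C + 16 * moment_const \<kappa> C) / \<kappa>\<^sup>2) + 2 * (100 + 16 * moment_const \<kappa> C)) / real N"
    by (rule variance_bound[OF f(1,2) v u'm _ _ _ u'b mom]) (use f(3,4) vb4 in simp_all)
  have "sk_risk \<beta> N u = (\<integral>g. (\<Sum>\<sigma>\<in>sk_configs N. w g \<sigma> * v (H g \<sigma>))\<^sup>2 \<partial>G)"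
    unfolding sk_risk_def sk_disorder_def G_def[symmetric] gibbs_avg_conv b0_def[symmetric] m_def[symmetric]
  proof (rule Bochner_Integration.integral_cong[OF refl])
    fix g
    have "(\<Sum>\<sigma>\<in>sk_configs N. w g \<sigma> * v (H g \<sigma>)) = (\<Sum>\<sigma>\<in>sk_configs N. w g \<sigma> * u (H g \<sigma>)) - (\<Sum>\<sigma>\<in>sk_configs N. w g \<sigma> * m)"
      unfolding sum_subtractf[symmetric] by (simp add: v_def right_diff_distrib)
    then show "((\<Sum>\<sigma>\<in>sk_configs N. w g \<sigma> * u (sk_H \<beta> N g \<sigma>)) - m)\<^sup>2 = (\<Sum>\<sigma>\<in>sk_configs N. w g \<sigma> * v (H g \<sigma>))\<^sup>2"
      unfolding avg_const by (simp add: sk_H_def H_def sk_X)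
  qed
  also have "\<dots> \<le> sk_const \<beta> * M\<^sup>2 / real N"
    using var by (simp add: sk_const_def Let_def \<kappa>_def[symmetric] c_def[symmetric] C_def[symmetric] moment_const_def power_mult_distrib mult_ac)
  finally show ?thesis .
qed

text \<open>Dominated convergence in \<open>t\<close> and in the disorder. Convergence almost
  everywhere suffices: \<open>AE_X\<close> turns the exceptional null set into a null event for each
  of the finitely many configurations.\<close>

lemma sk_risk_limit:
  assumes N: "2 \<le> N" and \<beta>: "0 < \<beta>" "\<beta> < 1"
    and um: "u \<in> borel_measurable borel" and unm: "\<And>n. un n \<in> borel_measurable borel"
    and ub: "\<And>x. \<bar>u x\<bar> \<le> M" and unb: "\<And>n x. \<bar>un n x\<bar> \<le> M"
    and lim: "AE x in lborel. (\<lambda>n. un n x) \<longlonglongrightarrow> u x"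
    and le: "\<And>n. sk_risk \<beta> N (un n) \<le> K"
  shows "sk_risk \<beta> N u \<le> K"
proof -
  interpret sk_gibbs "sk_pairs N" "sk_configs N" sk_sign "real N" \<beta> by (rule sk_sk_gibbs[OF N \<beta>])
  interpret prob_space G by (rule prob_space_G)
  note [measurable] = um unm
  have [measurable]: "phi_half \<in> borel_measurable borel" unfolding phi_half_conv_normal by measurable
  have M: "M \<ge> 0" using ub[of 0] by linarith
  have nn: "phi_half t \<ge> 0" for t by (simp add: phi_half_def)
  have m: "(\<lambda>n. \<integral>t. un n t * phi_half t \<partial>lborel) \<longlonglongrightarrow> (\<integral>t. u t * phi_half t \<partial>lborel)"
  proof (rule integral_dominated_convergence[where w="\<lambda>t. M * phi_half t"])
    show "AE x in lborel. (\<lambda>n. un n x * phi_half x) \<longlonglongrightarrow> u x * phi_half x"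
      using lim by eventually_elim (intro tendsto_intros)
    show "AE x in lborel. norm (un n x * phi_half x) \<le> M * phi_half x" for n
      using unb nn by (auto simp: abs_mult intro!: mult_right_mono)
  qed (use phi_half_integrable in auto)
  have H': "sk_H \<beta> N g \<sigma> = 1 / real N * X g \<sigma> - sqrt (real N) * \<beta> / 2" for g \<sigma>
    by (simp add: sk_H_def sk_X)
  have Hm [measurable]: "(\<lambda>g. sk_H \<beta> N g \<sigma>) \<in> borel_measurable G" for \<sigma> unfolding H' by measurable
  have ne: "sk_pairs N \<noteq> {}" using card_I N_pos by auto
  have "AE g in G. (\<lambda>n. un n (sk_H \<beta> N g \<sigma>)) \<longlonglongrightarrow> u (sk_H \<beta> N g \<sigma>)" if "\<sigma> \<in> sk_configs N" for \<sigma>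
    unfolding H' by (rule AE_X[OF that ne _ lim]) (use N_pos in auto)
  then have ae: "AE g in G. \<forall>\<sigma>\<in>sk_configs N. (\<lambda>n. un n (sk_H \<beta> N g \<sigma>)) \<longlonglongrightarrow> u (sk_H \<beta> N g \<sigma>)"
    using finite_S by (intro AE_finite_allI)
  have "(\<lambda>n. sk_risk \<beta> N (un n)) \<longlonglongrightarrow> sk_risk \<beta> N u"
    unfolding sk_risk_def sk_disorder_def G_def[symmetric] gibbs_avg_conv
  proof (rule integral_dominated_convergence[where w="\<lambda>_. (2 * M)\<^sup>2"])
    show "AE g in G. (\<lambda>n. ((\<Sum>\<sigma>\<in>sk_configs N. p (\<beta> / sqrt (real N)) g \<sigma> * un n (sk_H \<beta> N g \<sigma>)) - (\<integral>t. un n t * phi_half t \<partial>lborel))\<^sup>2)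
      \<longlonglongrightarrow> ((\<Sum>\<sigma>\<in>sk_configs N. p (\<beta> / sqrt (real N)) g \<sigma> * u (sk_H \<beta> N g \<sigma>)) - (\<integral>t. u t * phi_half t \<partial>lborel))\<^sup>2"
      using ae by eventually_elim (intro tendsto_intros m, auto)
    show "AE g in G. norm (((\<Sum>\<sigma>\<in>sk_configs N. p (\<beta> / sqrt (real N)) g \<sigma> * un n (sk_H \<beta> N g \<sigma>)) - (\<integral>t. un n t * phi_half t \<partial>lborel))\<^sup>2) \<le> (2 * M)\<^sup>2" for n
    proof (rule AE_I2)
      fix g
      have "\<bar>\<Sum>\<sigma>\<in>sk_configs N. p (\<beta> / sqrt (real N)) g \<sigma> * un n (sk_H \<beta> N g \<sigma>)\<bar> \<le> M"
        by (rule avg_bound) (rule unb)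
      then have "\<bar>(\<Sum>\<sigma>\<in>sk_configs N. p (\<beta> / sqrt (real N)) g \<sigma> * un n (sk_H \<beta> N g \<sigma>)) - (\<integral>t. un n t * phi_half t \<partial>lborel)\<bar> \<le> 2 * M"
        using phi_mean_bound(2)[OF unm unb, of n] by linarith
      from power_mono[OF this, of 2]
      show "norm (((\<Sum>\<sigma>\<in>sk_configs N. p (\<beta> / sqrt (real N)) g \<sigma> * un n (sk_H \<beta> N g \<sigma>)) - (\<integral>t. un n t * phi_half t \<partial>lborel))\<^sup>2) \<le> (2 * M)\<^sup>2"
        by simp
    qed
  qed auto
  then show ?thesis by (rule LIMSEQ_le_const2) (use le in auto)
qed

text \<open>The mean of \<open>u\<close> over \<open>[x, x + h n]\<close>, written as a difference
  quotient of an antiderivative, is differentiable with bounded derivative and keeps the bound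
  \<open>M\<close>. The derivative bound blows up with \<open>n\<close>, harmlessly for
  \<open>sk_risk_smooth\<close>.\<close>

lemma sk_risk_continuous:
  assumes N: "2 \<le> N" and \<beta>: "0 < \<beta>" "\<beta> < 1"
    and u: "continuous_on UNIV u" and ub: "\<And>x. \<bar>u x\<bar> \<le> M"
  shows "sk_risk \<beta> N u \<le> sk_const \<beta> * M\<^sup>2 / real N"
proof -
  have um [measurable]: "u \<in> borel_measurable borel" by (rule borel_measurable_continuous_onI[OF u])
  have "\<exists>U. \<forall>x. - \<infinity> < ereal x \<longrightarrow> ereal x < \<infinity> \<longrightarrow> (U has_vector_derivative u x) (at x)"
    using u by (intro einterval_antiderivative) (auto simp: continuous_on_eq_continuous_at)
  then obtain U where U: "\<And>x. (U has_real_derivative u x) (at x)"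
    by (auto simp: has_real_derivative_iff_has_vector_derivative)
  define h where "h n = inverse (real (Suc n))" for n
  have h: "h n > 0" for n by (simp add: h_def)
  define un where "un n x = (U (x + h n) - U x) / h n" for n x
  have dun: "(un n has_real_derivative (u (x + h n) - u x) / h n) (at x)" for n x
  proof -
    have "((\<lambda>x. U (x + h n)) has_real_derivative u (x + h n)) (at x)"
      using U[of "x + h n"] by (simp add: DERIV_shift)
    then show ?thesis unfolding un_def[abs_def] using h[of n] by (intro DERIV_cdivide DERIV_diff U)
  qed
  have unb: "\<bar>un n x\<bar> \<le> M" for n x
  proof -
    obtain z where "U (x + h n) - U x = h n * u z"
      using mean_value_between[OF U, of x "h n"] by auto
    then show ?thesis using h[of n] ub[of z] by (simp add: un_def)
  qed
  show ?thesis
  proof (rule sk_risk_limit[OF N \<beta> um _ ub unb])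
    show "un n \<in> borel_measurable borel" for n by (rule has_derivative_everywhere(2)[OF dun])
    have "(\<lambda>n. un n x) \<longlonglongrightarrow> u x" for x
    proof -
      have "((\<lambda>k. (U (x + k) - U x) / k) \<longlongrightarrow> u x) (at 0)" using U[of x] by (simp add: DERIV_def)
      moreover have "filterlim h (at 0) sequentially"
        unfolding filterlim_at using h LIMSEQ_inverse_real_of_nat by (auto simp: h_def[abs_def] less_imp_neq[symmetric])
      ultimately show ?thesis unfolding un_def by (rule filterlim_compose)
    qed
    then show "AE x in lborel. (\<lambda>n. un n x) \<longlonglongrightarrow> u x" by simp
    show "sk_risk \<beta> N (un n) \<le> sk_const \<beta> * M\<^sup>2 / real N" for n
    proof (rule sk_risk_smooth[OF N \<beta> dun _ unb])
      show "(\<lambda>x. (u (x + h n) - u x) / h n) \<in> borel_measurable borel" by measurable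
      show "\<bar>(u (x + h n) - u x) / h n\<bar> \<le> 2 * M / h n" for x
        using ub[of x] ub[of "x + h n"] h[of n] by (simp add: abs_divide divide_right_mono)
    qed
  qed
qed

text \<open>A measurable function is a limit of continuous ones off a negligible set. Truncation to
  \<open>[-M, M]\<close> keeps continuity and the limit, and restores the bound that
  \<open>sk_risk_limit\<close> needs.\<close>

lemma sk_risk_measurable:
  assumes N: "2 \<le> N" and \<beta>: "0 < \<beta>" "\<beta> < 1"
    and um: "u \<in> borel_measurable borel" and ub: "\<And>x. \<bar>u x\<bar> \<le> M"
  shows "sk_risk \<beta> N u \<le> sk_const \<beta> * M\<^sup>2 / real N"
proof -
  have "u measurable_on UNIV"
    by (rule lebesgue_measurable_imp_measurable_on) (use um in \<open>auto intro: measurable_completion\<close>)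
  then obtain A g where A: "negligible A" and g: "\<And>n. continuous_on UNIV (g n :: real \<Rightarrow> real)"
    and lim: "\<And>x. x \<notin> A \<Longrightarrow> (\<lambda>n. g n x) \<longlonglongrightarrow> u x"
    unfolding measurable_on_def by auto
  define un where "un n x = max (- M) (min M (g n x))" for n x
  have M: "M \<ge> 0" using ub[of 0] by linarith
  have unb: "\<bar>un n x\<bar> \<le> M" for n x using M by (auto simp: un_def)
  have unc: "continuous_on UNIV (un n)" for n unfolding un_def[abs_def] by (intro continuous_intros g)
  show ?thesis
  proof (rule sk_risk_limit[OF N \<beta> um _ ub unb])
    show "un n \<in> borel_measurable borel" for n by (rule borel_measurable_continuous_onI[OF unc])
    have "AE x in lebesgue. x \<notin> A" using A by (intro AE_not_in) (simp add: negligible_iff_null_sets)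
    then have "AE x in lborel. x \<notin> A" by (simp add: AE_completion_iff)
    then show "AE x in lborel. (\<lambda>n. un n x) \<longlonglongrightarrow> u x"
    proof eventually_elim
      case (elim x)
      have "(\<lambda>n. un n x) \<longlonglongrightarrow> max (- M) (min M (u x))" unfolding un_def by (intro tendsto_intros lim elim)
      then show ?case using ub[of x] by (simp add: max_def min_def abs_le_iff split: if_splits)
    qed
    show "sk_risk \<beta> N (un n) \<le> sk_const \<beta> * M\<^sup>2 / real N" for n
      by (rule sk_risk_continuous[OF N \<beta> unc unb])
  qed
qed

theorem theorem1p6:
  fixes \<beta> :: real
  assumes "0 < \<beta>" and "\<beta> < 1"
  shows "\<exists>C::real. \<forall>N::nat. \<forall>u::real \<Rightarrow> real.
           N \<ge> 1 \<longrightarrow> u \<in> borel_measurable borel \<longrightarrow> bounded (range u) \<longrightarrow>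
           (\<integral>g. (gibbs_avg \<beta> 0 N g (\<lambda>\<sigma>. u (sk_H \<beta> N g \<sigma>))
                    - (\<integral>t. u t * phi_half t \<partial>lborel))\<^sup>2 \<partial>sk_disorder N)
           \<le> C * (SUP t. \<bar>u t\<bar>)\<^sup>2 / real N"
proof (intro exI allI impI)
  fix N :: nat and u :: "real \<Rightarrow> real"
  assume N: "N \<ge> 1" and um: "u \<in> borel_measurable borel" and "bounded (range u)"
  then obtain B where "\<And>x. \<bar>u x\<bar> \<le> B" by (auto simp: bounded_iff)
  then have ub: "\<bar>u x\<bar> \<le> (SUP t. \<bar>u t\<bar>)" for x
    by (intro cSUP_upper) (auto intro!: bdd_aboveI)
  let ?M = "SUP t. \<bar>u t\<bar>"
  \<comment> \<open>The value \<open>4\<close> serves \<open>N = 1\<close>, which the locale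
    \<open>sk_gibbs\<close> excludes.\<close>
  have "sk_risk \<beta> N u \<le> max 4 (sk_const \<beta>) * ?M\<^sup>2 / real N"
  proof (cases "N = 1")
    case True
    have "sk_risk \<beta> N u \<le> 4 * ?M\<^sup>2" by (rule sk_risk_trivial[OF um ub])
    also have "\<dots> \<le> max 4 (sk_const \<beta>) * ?M\<^sup>2" by (intro mult_right_mono) auto
    finally show ?thesis using True by simp
  next
    case False
    then have "sk_risk \<beta> N u \<le> sk_const \<beta> * ?M\<^sup>2 / real N"
      using N by (intro sk_risk_measurable assms um ub) auto
    also have "\<dots> \<le> max 4 (sk_const \<beta>) * ?M\<^sup>2 / real N" by (intro divide_right_mono mult_right_mono) auto
    finally show ?thesis .
  qed
  then show "(\<integral>g. (gibbs_avg \<beta> 0 N g (\<lambda>\<sigma>. u (sk_H \<beta> N g \<sigma>)) - (\<integral>t. u t * phi_half t \<partial>lborel))\<^sup>2 \<partial>sk_disorder N)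
    \<le> max 4 (sk_const \<beta>) * ?M\<^sup>2 / real N"
    unfolding sk_risk_def .
qed

end
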